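(* Let $V^0$ be a composition subalgebra of dimension 4 of $V$ and $W$ its orthogonal. (i) If $V^0$ is anisotropic, then so is $W$, and each has a unique self-dual norm, namely $\alpha_0=\frac12 v_F\circ Q$ and $\alpha_W=\frac12 v_F\circ Q$ respectively. The norm $\alpha_0\wedge\alpha_W$ is a self-dual algebra norm of $V$. The norm $\alpha_0$ is split by every decomposition $V^0=F'\perp F'^\perp$ where $F'$ is a subfield of $V^0$ of degree 2 over $F$ (and $F'^\perp$ its orthogonal in $V^0$). (ii) If $V^0$ is split, then for every self-dual norm $\alpha_W$ of $W$ there exists one and only one self-dual algebra norm $\alpha_0$ of $V^0$ such that $\alpha_0\wedge\alpha_W$ is a self-dual algebra norm of $V$. If moreover there exists a quadratic extension $F'$ of $F$ in $V^0$ such that $\alpha_W$ is of the form $\frac1e\alpha'$ for a self-dual $F'$-norm $\alpha'$ of $W$, where $e$ is the ramification index of $F'/F$, then $e\,\alpha_0$ is a self-dual $F'$-norm of $V^0$.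
   Context: $F$ is a non-archimedean local field of residual characteristic $p\notin\{2,3\}$, with normalized valuation $v_F$. $V$ is the (split) octonion algebra over $F$, with unit, multiplicative norm $Q$ and bilinear form $f$ with $f(x,x)=2Q(x)$. A composition subalgebra is a unital subalgebra on which $Q$ is nondegenerate; in dimension 4 it is a quaternion algebra, split or anisotropic. For a quadratic extension $F'\subset V^0$ of $F$, $V$ (hence $V^0$ and $W$) is an $F'$-space by left multiplication, with the hermitian form $\Phi$ such that $f=\mathrm{tr}_{F'/F}\circ\Phi$. For $E=F$ or $F'$, a (rational) $E$-norm on an $E$-space $X$ is $\alpha:X\to\mathbb Q\cup\{\infty\}$ with $\alpha(x+y)\ge\inf(\alpha(x),\alpha(y))$, $\alpha(\xi x)=v_E(\xi)+\alpha(x)$ for $\xi\in E$ ($v_E$ normalized), and $\alpha(x)=\infty\iff x=0$; "norm" means $F$-norm. An $F$-norm (resp. $F'$-norm) is self-dual if $\alpha(v)=\inf_x(v_F(f(v,x))-\alpha(x))$ (resp. $\alpha(v)=\inf_x(v_{F'}(\Phi(v,x))-\alpha(x))$) for all $v$, $x$ running over the space considered. An algebra norm satisfies $\alpha(xy)\ge\alpha(x)+\alpha(y)$. $(\alpha_1\wedge\alpha_2)(x_1+x_2)=\min\{\alpha_1(x_1),\alpha_2(x_2)\}$ on a direct sum; a norm on $X_1\oplus X_2$ is split by the decomposition if it equals the $\wedge$ of its restrictions. *)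

theory Defs
  imports
    "HOL-Library.Extended_Real"
    "HOL-Library.FuncSet"
    "HOL-Computational_Algebra.Primes"
begin

section \<open>Valuations and local fields\<close>

text \<open>
  Both the base field and its quadratic extensions inside the octonion algebra carry a
  valuation, so the carrier \<open>K\<close> and the multiplication \<open>m\<close> are explicit.
\<close>

definition normalized_valuation ::
  "'a::ab_group_add set \<Rightarrow> ('a \<Rightarrow> 'a \<Rightarrow> 'a) \<Rightarrow> ('a \<Rightarrow> ereal) \<Rightarrow> bool" where
  "normalized_valuation K m w \<longleftrightarrow>
     (\<forall>x\<in>K. w x = \<infinity> \<longleftrightarrow> x = 0) \<and>
     (\<forall>x\<in>K. x \<noteq> 0 \<longrightarrow> (\<exists>n::int. w x = ereal (of_int n))) \<and>
     (\<forall>x\<in>K. \<forall>y\<in>K. w (m x y) = w x + w y) \<and>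
     (\<forall>x\<in>K. \<forall>y\<in>K. min (w x) (w y) \<le> w (x + y)) \<and>
     (\<exists>x\<in>K. w x = 1)"

locale nonarch_local_field =
  fixes v :: "'f::field \<Rightarrow> ereal"
  assumes valuation: "normalized_valuation UNIV (*) v"
    and complete:
      "\<And>s :: nat \<Rightarrow> 'f. (\<forall>N::nat. \<exists>M. \<forall>i\<ge>M. \<forall>j\<ge>M. ereal (real N) \<le> v (s i - s j)) \<Longrightarrow>
         \<exists>l. \<forall>N::nat. \<exists>M. \<forall>i\<ge>M. ereal (real N) \<le> v (s i - l)"
    and finite_residue_field: "finite ((\<lambda>x. {y. 0 < v (y - x)}) ` {x. 0 \<le> v x})"

definition residual_characteristic :: "('f::field \<Rightarrow> ereal) \<Rightarrow> nat \<Rightarrow> bool" where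
  "residual_characteristic v p \<longleftrightarrow> prime p \<and> 0 < v (of_nat p)"

section \<open>Composition algebras\<close>

definition polar :: "('v::ab_group_add \<Rightarrow> 'f::field) \<Rightarrow> 'v \<Rightarrow> 'v \<Rightarrow> 'f" where
  "polar Q x y = Q (x + y) - Q x - Q y"

definition nondegenerate_on :: "('v::ab_group_add \<Rightarrow> 'f::field) \<Rightarrow> 'v set \<Rightarrow> bool" where
  "nondegenerate_on Q X \<longleftrightarrow> (\<forall>x\<in>X. (\<forall>y\<in>X. polar Q x y = 0) \<longrightarrow> x = 0)"

definition anisotropic_on :: "('v::ab_group_add \<Rightarrow> 'f::field) \<Rightarrow> 'v set \<Rightarrow> bool" where
  "anisotropic_on Q X \<longleftrightarrow> (\<forall>x\<in>X. Q x = 0 \<longrightarrow> x = 0)"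

text \<open>A composition algebra is split if its norm form has a nontrivial zero.\<close>

definition split_on :: "('v::ab_group_add \<Rightarrow> 'f::field) \<Rightarrow> 'v set \<Rightarrow> bool" where
  "split_on Q X \<longleftrightarrow> \<not> anisotropic_on Q X"

definition orthogonal_in ::
  "('v::ab_group_add \<Rightarrow> 'f::field) \<Rightarrow> 'v set \<Rightarrow> 'v set \<Rightarrow> 'v set" where
  "orthogonal_in Q X Y = {x\<in>X. \<forall>y\<in>Y. polar Q x y = 0}"

locale composition_algebra =
  vector_space scale for scale :: "'f::field \<Rightarrow> 'v::ab_group_add \<Rightarrow> 'v" +
  fixes mul :: "'v \<Rightarrow> 'v \<Rightarrow> 'v" and one :: 'v and Q :: "'v \<Rightarrow> 'f"
  assumes mul_linear_right: "\<And>x. Vector_Spaces.linear scale scale (\<lambda>y. mul x y)"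
    and mul_linear_left: "\<And>y. Vector_Spaces.linear scale scale (\<lambda>x. mul x y)"
    and mul_one_left: "\<And>x. mul one x = x"
    and mul_one_right: "\<And>x. mul x one = x"
    and Q_scale: "\<And>c x. Q (scale c x) = c ^ 2 * Q x"
    and polar_linear: "\<And>x. Vector_Spaces.linear scale (*) (polar Q x)"
    and Q_nondegenerate: "nondegenerate_on Q UNIV"
    and Q_mul: "\<And>x y. Q (mul x y) = Q x * Q y"

locale split_octonion_algebra = composition_algebra +
  assumes dim_8: "vector_space.dim scale UNIV = 8"
    and split: "split_on Q UNIV"

definition unital_subalgebra ::
  "('f::field \<Rightarrow> 'v::ab_group_add \<Rightarrow> 'v) \<Rightarrow> ('v \<Rightarrow> 'v \<Rightarrow> 'v) \<Rightarrow> 'v \<Rightarrow> 'v set \<Rightarrow> bool" where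
  "unital_subalgebra scale mul one A \<longleftrightarrow>
     module.subspace scale A \<and> one \<in> A \<and> (\<forall>x\<in>A. \<forall>y\<in>A. mul x y \<in> A)"

definition composition_subalgebra ::
  "('f::field \<Rightarrow> 'v::ab_group_add \<Rightarrow> 'v) \<Rightarrow> ('v \<Rightarrow> 'v \<Rightarrow> 'v) \<Rightarrow> 'v \<Rightarrow> ('v \<Rightarrow> 'f) \<Rightarrow> 'v set \<Rightarrow> bool"
  where
  "composition_subalgebra scale mul one Q A \<longleftrightarrow>
     unital_subalgebra scale mul one A \<and> nondegenerate_on Q A"

section \<open>Quadratic extensions inside the algebra\<close>

definition quadratic_subfield ::
  "('f::field \<Rightarrow> 'v::ab_group_add \<Rightarrow> 'v) \<Rightarrow> ('v \<Rightarrow> 'v \<Rightarrow> 'v) \<Rightarrow> 'v \<Rightarrow> 'v set \<Rightarrow> bool" where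
  "quadratic_subfield scale mul one L \<longleftrightarrow>
     unital_subalgebra scale mul one L \<and> vector_space.dim scale L = 2 \<and>
     (\<forall>x\<in>L. \<forall>y\<in>L. mul x y = mul y x) \<and>
     (\<forall>x\<in>L. \<forall>y\<in>L. \<forall>z\<in>L. mul (mul x y) z = mul x (mul y z)) \<and>
     (\<forall>x\<in>L. x \<noteq> 0 \<longrightarrow> (\<exists>y\<in>L. mul x y = one))"

text \<open>
  The unique normalized valuation of \<open>L\<close> extending \<open>v\<close> up to an integral factor, and that factor.
  Here \<open>F\<close> is embedded in \<open>L\<close> by \<open>c \<mapsto> scale c one\<close>.
\<close>

definition ext_valuation ::
  "('f::field \<Rightarrow> ereal) \<Rightarrow> ('f \<Rightarrow> 'v::ab_group_add \<Rightarrow> 'v) \<Rightarrow> ('v \<Rightarrow> 'v \<Rightarrow> 'v) \<Rightarrow> 'v \<Rightarrow> 'v set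
     \<Rightarrow> 'v \<Rightarrow> ereal" where
  "ext_valuation v scale mul one L =
     (THE w. w \<in> extensional L \<and> normalized_valuation L mul w \<and>
        (\<exists>e::nat. \<forall>c. w (scale c one) = ereal (real e) * v c))"

definition ramification_index ::
  "('f::field \<Rightarrow> ereal) \<Rightarrow> ('f \<Rightarrow> 'v::ab_group_add \<Rightarrow> 'v) \<Rightarrow> ('v \<Rightarrow> 'v \<Rightarrow> 'v) \<Rightarrow> 'v \<Rightarrow> 'v set \<Rightarrow> nat"
  where
  "ramification_index v scale mul one L =
     (THE e. \<forall>c. ext_valuation v scale mul one L (scale c one) = ereal (real e) * v c)"

text \<open>The nontrivial \<open>F\<close>-automorphism of the (separable) quadratic extension \<open>L\<close>.\<close>

definition galois_conj ::
  "('f::field \<Rightarrow> 'v::ab_group_add \<Rightarrow> 'v) \<Rightarrow> ('v \<Rightarrow> 'v \<Rightarrow> 'v) \<Rightarrow> 'v \<Rightarrow> 'v set \<Rightarrow> 'v \<Rightarrow> 'v" where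
  "galois_conj scale mul one L =
     (THE s. s \<in> extensional L \<and> bij_betw s L L \<and>
        (\<forall>x\<in>L. \<forall>y\<in>L. s (x + y) = s x + s y) \<and>
        (\<forall>x\<in>L. \<forall>y\<in>L. s (mul x y) = mul (s x) (s y)) \<and>
        (\<forall>c. s (scale c one) = scale c one) \<and>
        (\<exists>x\<in>L. s x \<noteq> x))"

definition field_trace ::
  "('f::field \<Rightarrow> 'v::ab_group_add \<Rightarrow> 'v) \<Rightarrow> ('v \<Rightarrow> 'v \<Rightarrow> 'v) \<Rightarrow> 'v \<Rightarrow> 'v set \<Rightarrow> 'v \<Rightarrow> 'f" where
  "field_trace scale mul one L z = (THE t. scale t one = z + galois_conj scale mul one L z)"

text \<open>
  The hermitian form on the whole algebra, viewed as an \<open>L\<close>-space by left multiplication, whose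
  trace is the polar form of \<open>Q\<close>. It is taken \<open>L\<close>-linear in the first variable; the other
  convention replaces \<open>h\<close> by its conjugate, which has the same valuation.
\<close>

definition hermitian_form ::
  "('f::field \<Rightarrow> 'v::ab_group_add \<Rightarrow> 'v) \<Rightarrow> ('v \<Rightarrow> 'v \<Rightarrow> 'v) \<Rightarrow> 'v \<Rightarrow> ('v \<Rightarrow> 'f) \<Rightarrow> 'v set
     \<Rightarrow> 'v \<Rightarrow> 'v \<Rightarrow> 'v" where
  "hermitian_form scale mul one Q L =
     (THE h. (\<forall>x y. h x y \<in> L) \<and>
        (\<forall>x y z. h (x + y) z = h x z + h y z) \<and>
        (\<forall>a\<in>L. \<forall>x y. h (mul a x) y = mul a (h x y)) \<and>
        (\<forall>x y. h y x = galois_conj scale mul one L (h x y)) \<and>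
        (\<forall>x y. polar Q x y = field_trace scale mul one L (h x y)))"

section \<open>Norms\<close>

text \<open>
  Norms on a space \<open>X\<close> are functions on the ambient type of which only the values on \<open>X\<close> matter;
  accordingly, uniqueness is understood as equality on \<open>X\<close>. The scalars are the elements of \<open>K\<close>,
  with valuation \<open>w\<close>, acting by \<open>act\<close>.
\<close>

definition norm_on ::
  "'s set \<Rightarrow> ('s \<Rightarrow> ereal) \<Rightarrow> ('s \<Rightarrow> 'v \<Rightarrow> 'v) \<Rightarrow> 'v::ab_group_add set \<Rightarrow> ('v \<Rightarrow> ereal) \<Rightarrow> bool" where
  "norm_on K w act X \<alpha> \<longleftrightarrow>
     (\<forall>x\<in>X. \<alpha> x \<in> insert \<infinity> (ereal ` \<rat>)) \<and>
     (\<forall>x\<in>X. \<forall>y\<in>X. min (\<alpha> x) (\<alpha> y) \<le> \<alpha> (x + y)) \<and>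
     (\<forall>c\<in>K. \<forall>x\<in>X. \<alpha> (act c x) = w c + \<alpha> x) \<and>
     (\<forall>x\<in>X. \<alpha> x = \<infinity> \<longleftrightarrow> x = 0)"

text \<open>
  Omitting \<open>x = 0\<close> from the infimum avoids \<open>\<infinity> - \<infinity>\<close>; this term is \<open>\<infinity>\<close> by convention.
\<close>

definition self_dual ::
  "('s \<Rightarrow> ereal) \<Rightarrow> ('v \<Rightarrow> 'v \<Rightarrow> 's) \<Rightarrow> 'v::ab_group_add set \<Rightarrow> ('v \<Rightarrow> ereal) \<Rightarrow> bool" where
  "self_dual w B X \<alpha> \<longleftrightarrow> (\<forall>u\<in>X. \<alpha> u = (INF x\<in>X - {0}. w (B u x) - \<alpha> x))"

definition self_dual_norm ::
  "('f::field \<Rightarrow> ereal) \<Rightarrow> ('f \<Rightarrow> 'v::ab_group_add \<Rightarrow> 'v) \<Rightarrow> ('v \<Rightarrow> 'f) \<Rightarrow> 'v set \<Rightarrow> ('v \<Rightarrow> ereal) \<Rightarrow> bool"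
  where
  "self_dual_norm v scale Q X \<alpha> \<longleftrightarrow> norm_on UNIV v scale X \<alpha> \<and> self_dual v (polar Q) X \<alpha>"

definition self_dual_ext_norm ::
  "('f::field \<Rightarrow> ereal) \<Rightarrow> ('f \<Rightarrow> 'v::ab_group_add \<Rightarrow> 'v) \<Rightarrow> ('v \<Rightarrow> 'v \<Rightarrow> 'v) \<Rightarrow> 'v \<Rightarrow> ('v \<Rightarrow> 'f)
     \<Rightarrow> 'v set \<Rightarrow> 'v set \<Rightarrow> ('v \<Rightarrow> ereal) \<Rightarrow> bool" where
  "self_dual_ext_norm v scale mul one Q L X \<alpha> \<longleftrightarrow>
     norm_on L (ext_valuation v scale mul one L) mul X \<alpha> \<and>
     self_dual (ext_valuation v scale mul one L) (hermitian_form scale mul one Q L) X \<alpha>"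

definition self_dual_algebra_norm ::
  "('f::field \<Rightarrow> ereal) \<Rightarrow> ('f \<Rightarrow> 'v::ab_group_add \<Rightarrow> 'v) \<Rightarrow> ('v \<Rightarrow> 'v \<Rightarrow> 'v) \<Rightarrow> ('v \<Rightarrow> 'f) \<Rightarrow> 'v set
     \<Rightarrow> ('v \<Rightarrow> ereal) \<Rightarrow> bool" where
  "self_dual_algebra_norm v scale mul Q A \<alpha> \<longleftrightarrow>
     self_dual_norm v scale Q A \<alpha> \<and> (\<forall>x\<in>A. \<forall>y\<in>A. \<alpha> x + \<alpha> y \<le> \<alpha> (mul x y))"

definition direct_sum_decomp ::
  "'v::ab_group_add set \<Rightarrow> 'v set \<Rightarrow> 'v set \<Rightarrow> bool" where
  "direct_sum_decomp X X1 X2 \<longleftrightarrow> X = {x1 + x2 |x1 x2. x1 \<in> X1 \<and> x2 \<in> X2} \<and> X1 \<inter> X2 = {0}"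

text \<open>Only meaningful on the direct sum of the subspaces \<open>X1\<close> and \<open>X2\<close>.\<close>

definition wedge ::
  "'v::ab_group_add set \<Rightarrow> 'v set \<Rightarrow> ('v \<Rightarrow> ereal) \<Rightarrow> ('v \<Rightarrow> ereal) \<Rightarrow> 'v \<Rightarrow> ereal" where
  "wedge X1 X2 \<alpha>1 \<alpha>2 x =
     (THE r. \<exists>x1\<in>X1. \<exists>x2\<in>X2. x = x1 + x2 \<and> r = min (\<alpha>1 x1) (\<alpha>2 x2))"

definition split_by ::
  "'v::ab_group_add set \<Rightarrow> 'v set \<Rightarrow> 'v set \<Rightarrow> ('v \<Rightarrow> ereal) \<Rightarrow> bool" where
  "split_by X X1 X2 \<alpha> \<longleftrightarrow>
     direct_sum_decomp X X1 X2 \<and> (\<forall>x\<in>X. \<alpha> x = wedge X1 X2 \<alpha> \<alpha> x)"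

end

theory Submission
  imports Defs "HOL-Analysis.Determinants"
begin

text \<open>
  In (i) the half-norm \<open>v (Q x) / 2\<close> dominates every self-dual norm on an anisotropic space, and duality
  reverses inequalities; it is itself a self-dual norm by Hensel's lemma.

  In (ii) the norm is the operator norm \<open>\<alpha>0 x = inf (\<alpha>W (x w) - \<alpha>W w)\<close> of the left multiplication by
  \<open>x\<close> on \<open>W\<close>. It dominates every admissible norm, which gives uniqueness as before. Its self-duality
  and the inequality \<open>\<alpha>W t + \<alpha>W u \<le> \<alpha>0 (t u)\<close> on \<open>W\<close> both come down to
  \<open>\<alpha>W t + \<alpha>W u + \<alpha>W r + \<alpha>W s \<le> v (f (t u, r s))\<close>. Modulo products of values of \<open>f\<close>, the form
  \<open>2 f (t u, r s)\<close> on the four-dimensional space \<open>W\<close> is alternating, so its square is the Gram determinant of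
  \<open>t, u, r, s\<close>, whose valuation is bounded termwise by self-duality of \<open>\<alpha>W\<close>.
\<close>

section \<open>Composition algebras\<close>

text \<open>Residual characteristic different from 2 enters as \<open>v 2 = 0\<close>: values of
  \<open>Q\<close> and of \<open>form\<close> on the diagonal agree up to a unit, and orthogonal
  projections exist. The algebra is not associative, so its identities are obtained by testing
  against \<open>form\<close> and moving factors across. Left multiplication turns out to make
  \<open>W\<close> a module over the opposite of \<open>V0\<close>, which is why an operator norm on
  \<open>W\<close> is submultiplicative on \<open>V0\<close>. The determinant route needs no basis
  of \<open>W\<close> adapted to \<open>\<alpha>W\<close>: squaring the alternating form replaces an
  estimate of a product of four vectors by estimates of pairings \<open>form x y\<close>, and these
  are exactly what self-duality supplies. An infimum of rational values need be neither finite nor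
  rational. Finiteness comes from writing \<open>scale (Q a) x\<close> as a product of two elements
  of \<open>W\<close>, rationality from a common denominator for all values of a norm. For a
  quadratic subfield the extended valuation is \<open>e\<close> times \<open>half_norm\<close>, so
  the hermitian statement becomes one about \<open>half_norm\<close>, and the hermitian form is
  reached through its trace.\<close>

context composition_algebra
begin

notation mul (infixl "\<odot>" 70)

abbreviation form :: "'v \<Rightarrow> 'v \<Rightarrow> 'f" where "form \<equiv> polar Q"

definition conj :: "'v \<Rightarrow> 'v" where "conj x = scale (form x one) one - x"

lemma mul_add_right: "x \<odot> (y + z) = x \<odot> y + x \<odot> z"
  using mul_linear_right[of x] by (simp add: Vector_Spaces.linear_iff)

lemma mul_add_left: "(y + z) \<odot> x = y \<odot> x + z \<odot> x"
  using mul_linear_left[of x] by (simp add: Vector_Spaces.linear_iff)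

lemma mul_scale_right: "x \<odot> scale c y = scale c (x \<odot> y)"
  using mul_linear_right[of x] by (simp add: Vector_Spaces.linear_iff)

lemma mul_scale_left: "scale c y \<odot> x = scale c (y \<odot> x)"
  using mul_linear_left[of x] by (simp add: Vector_Spaces.linear_iff)

lemma mul_minus_right: "x \<odot> (- y) = - (x \<odot> y)"
  using mul_scale_right[of x "-1" y] by simp

lemma mul_minus_left: "(- y) \<odot> x = - (y \<odot> x)"
  using mul_scale_left[of "-1" y x] by simp

lemma mul_diff_right: "x \<odot> (y - z) = x \<odot> y - x \<odot> z"
  using mul_add_right[of x y "- z"] by (simp add: mul_minus_right)

lemma mul_diff_left: "(y - z) \<odot> x = y \<odot> x - z \<odot> x"
  using mul_add_left[of y "- z" x] by (simp add: mul_minus_left)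

lemma mul_zero_right: "x \<odot> 0 = 0"
  using mul_scale_right[of x 0 0] by simp

lemma mul_zero_left: "0 \<odot> x = 0"
  using mul_scale_left[of 0 0 x] by simp

lemmas mul_simps = mul_add_left mul_add_right mul_scale_left mul_scale_right mul_minus_left
  mul_minus_right mul_diff_left mul_diff_right mul_zero_left mul_zero_right mul_one_left mul_one_right

lemma form_commute: "form x y = form y x"
  by (simp add: polar_def add.commute)

lemma form_add_right: "form x (y + z) = form x y + form x z"
  using polar_linear[of x] by (simp add: Vector_Spaces.linear_iff)

lemma form_scale_right: "form x (scale c y) = c * form x y"
  using polar_linear[of x] by (simp add: Vector_Spaces.linear_iff)

lemma form_add_left: "form (y + z) x = form y x + form z x"
  by (metis form_commute form_add_right)

lemma form_scale_left: "form (scale c y) x = c * form y x"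
  by (metis form_commute form_scale_right)

lemma form_minus_right: "form x (- y) = - form x y"
  using form_scale_right[of x "-1" y] by simp

lemma form_minus_left: "form (- y) x = - form y x"
  using form_scale_left[of "-1" y x] by simp

lemma form_diff_right: "form x (y - z) = form x y - form x z"
  using form_add_right[of x y "- z"] by (simp add: form_minus_right)

lemma form_diff_left: "form (y - z) x = form y x - form z x"
  using form_add_left[of y "- z" x] by (simp add: form_minus_left)

lemma form_zero_right: "form x 0 = 0"
  using form_scale_right[of x 0 0] by simp

lemma form_zero_left: "form 0 x = 0"
  using form_scale_left[of 0 0 x] by simp

lemma form_sum_right: "form x (sum g S) = (\<Sum>i\<in>S. form x (g i))"
  by (induction S rule: infinite_finite_induct) (simp_all add: form_zero_right form_add_right)

lemma form_sum_left: "form (sum g S) x = (\<Sum>i\<in>S. form (g i) x)"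
  by (induction S rule: infinite_finite_induct) (simp_all add: form_zero_left form_add_left)

lemmas form_simps = form_add_left form_add_right form_scale_left form_scale_right form_minus_left
  form_minus_right form_diff_left form_diff_right form_zero_left form_zero_right

lemma Q_zero: "Q 0 = 0"
  using Q_scale[of 0 0] by simp

lemma Q_minus: "Q (- x) = Q x"
  using Q_scale[of "-1" x] by simp

lemma Q_add: "Q (x + y) = Q x + Q y + form x y"
  by (simp add: polar_def)

lemma form_self: "form x x = 2 * Q x"
proof -
  have "scale 2 x = x + x"
    using scale_left_distrib[of 1 1 x] by simp
  then have "form x x = 2\<^sup>2 * Q x - Q x - Q x"
    unfolding polar_def by (metis Q_scale)
  then show ?thesis by (simp add: power2_eq_square)
qed

lemma form_eqI: "x = y" if "\<And>z. form x z = form y z"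
proof -
  have "form (x - y) z = 0" for z
    using that by (simp add: form_diff_left)
  then have "x - y = 0"
    using Q_nondegenerate unfolding nondegenerate_on_def by blast
  then show ?thesis by simp
qed

lemma form_mul_right: "form (x \<odot> z) (y \<odot> z) = form x y * Q z"
  unfolding polar_def by (simp add: Q_mul mul_add_left[symmetric] algebra_simps)

lemma form_mul_left: "form (z \<odot> x) (z \<odot> y) = Q z * form x y"
  unfolding polar_def by (simp add: Q_mul mul_add_right[symmetric] algebra_simps)

text \<open>Polarization of \<open>form_mul_right\<close> in its common right factor. The two
  adjunctions, the reversal in \<open>mul_mul_W\<close> and two of the swaps of
  \<open>volume\<close> are instances of it.\<close>

lemma form_exchange: "form (x \<odot> z) (y \<odot> w) + form (x \<odot> w) (y \<odot> z) = form x y * form z w"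
  using form_mul_right[of x "z + w" y] form_mul_right[of x z y] form_mul_right[of x w y]
  by (simp add: mul_simps form_simps Q_add algebra_simps form_commute[of w z])

end

section \<open>Conjugation, adjunctions and cancellation laws\<close>

locale nontrivial_composition_algebra = composition_algebra scale mul one Q
  for scale :: "'f::field \<Rightarrow> 'v::ab_group_add \<Rightarrow> 'v" and mul one Q +
  assumes one_nonzero: "one \<noteq> 0" and two_nonzero: "(2::'f) \<noteq> 0"
begin

lemma Q_one: "Q one = 1"
proof -
  have "Q one \<noteq> 0"
  proof
    assume "Q one = 0"
    then have Q0: "Q x = 0" for x
      using Q_mul[of x one] by (simp add: mul_one_right)
    have "one = 0"
      by (rule form_eqI) (simp add: polar_def Q0)
    then show False using one_nonzero by simp
  qed
  then show ?thesis using Q_mul[of one one] by (simp add: mul_one_left)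
qed

lemma form_one_one: "form one one = 2"
  by (simp add: form_self Q_one)

lemma form_conj_one: "form (conj x) one = form x one"
  by (simp add: conj_def form_simps form_one_one)

lemma conj_conj: "conj (conj x) = x"
  unfolding conj_def[of "conj x"] form_conj_one by (simp add: conj_def)

lemma conj_one: "conj one = one"
  unfolding conj_def form_one_one using scale_left_distrib[of 1 1 one] by simp

lemma Q_conj: "Q (conj x) = Q x"
proof -
  have "2 * Q (conj x) = 2 * Q x"
    unfolding form_self[symmetric]
    by (simp add: conj_def form_simps form_one_one form_commute[of one x] algebra_simps)
  then show ?thesis using two_nonzero by simp
qed

lemma form_conj_left: "form (conj x) y = form x (conj y)"
  by (simp add: conj_def form_simps form_commute[of one y] algebra_simps)

text \<open>With \<open>one\<close> in one slot of \<open>form_exchange\<close>, the product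
  \<open>form x one * form y z\<close> is absorbed into \<open>conj x\<close>.\<close>

lemma form_mul_left_adjoint: "form (x \<odot> y) z = form y (conj x \<odot> z)"
  using form_exchange[of x y one z]
  by (simp add: conj_def mul_simps form_simps form_commute[of "x \<odot> z" y] algebra_simps)

lemma form_mul_right_adjoint: "form (x \<odot> y) z = form x (z \<odot> conj y)"
  using form_exchange[of x y z one]
  by (simp add: conj_def mul_simps form_simps form_commute[of x "z \<odot> y"] algebra_simps)

text \<open>This stands in for associativity. Left multiplication by \<open>x\<close> is adjoint to
  that by \<open>conj x\<close>, and it scales \<open>form\<close> by \<open>Q x\<close>.\<close>

lemma conj_mul_cancel_left: "conj x \<odot> (x \<odot> y) = scale (Q x) y"
  by (rule form_eqI)
    (simp add: form_mul_left_adjoint[of "conj x"] conj_conj form_mul_left form_scale_left)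

lemma mul_conj_cancel_left: "x \<odot> (conj x \<odot> y) = scale (Q x) y"
  using conj_mul_cancel_left[of "conj x" y] by (simp add: conj_conj Q_conj)

text \<open>The polarization of \<open>conj_mul_cancel_left\<close> in \<open>x\<close>. In
  \<open>N_self_dual\<close> it writes \<open>form u x\<close> times a vector of \<open>W\<close> as
  a sum of two iterated products, each controlled by the operator norm.\<close>

lemma conj_mul_linearized: "conj x \<odot> (y \<odot> z) + conj y \<odot> (x \<odot> z) = scale (form x y) z"
proof (rule form_eqI)
  fix u
  have "form (conj x \<odot> (y \<odot> z)) u + form (conj y \<odot> (x \<odot> z)) u
      = form (y \<odot> z) (x \<odot> u) + form (x \<odot> z) (y \<odot> u)"
    by (simp add: form_mul_left_adjoint[of "conj _"] conj_conj)
  also have "\<dots> = form x y * form z u"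
    using form_exchange[of x z y u] by (simp add: form_commute add.commute)
  finally show "form (conj x \<odot> (y \<odot> z) + conj y \<odot> (x \<odot> z)) u = form (scale (form x y) z) u"
    by (simp add: form_simps)
qed

lemma mul_conj_cancel_right: "(y \<odot> x) \<odot> conj x = scale (Q x) y"
  by (rule form_eqI)
    (simp add: form_mul_right_adjoint[of _ "conj x"] conj_conj form_mul_right form_scale_left)

lemma conj_mul: "conj (x \<odot> y) = conj y \<odot> conj x"
proof (rule form_eqI)
  fix z
  have "form (conj (x \<odot> y)) z = form y (conj x \<odot> conj z)"
    by (simp add: form_conj_left form_mul_left_adjoint)
  also have "\<dots> = form (y \<odot> z) (conj x)"
    by (simp add: form_mul_right_adjoint)
  also have "\<dots> = form (conj x) (y \<odot> z)"
    by (rule form_commute)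
  also have "\<dots> = form (conj y \<odot> conj x) z"
    by (simp add: form_mul_left_adjoint[of "conj y"] conj_conj)
  finally show "form (conj (x \<odot> y)) z = form (conj y \<odot> conj x) z" .
qed

lemma conj_mul_self: "conj x \<odot> x = scale (Q x) one"
  using conj_mul_cancel_left[of x one] by (simp add: mul_one_right)

lemma mul_conj_self: "x \<odot> conj x = scale (Q x) one"
  using mul_conj_cancel_left[of x one] by (simp add: mul_one_right)

section \<open>Orthogonal sets of anisotropic vectors, and projections\<close>

definition orthogonal_set :: "'v set \<Rightarrow> bool" where
  "orthogonal_set E \<longleftrightarrow> (\<forall>x\<in>E. Q x \<noteq> 0) \<and> (\<forall>x\<in>E. \<forall>y\<in>E. x \<noteq> y \<longrightarrow> form x y = 0)"

lemma form_orthogonal_sum: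
  assumes "orthogonal_set E" "finite T" "T \<subseteq> E" "e \<in> T"
  shows "form (\<Sum>x\<in>T. scale (c x) x) e = c e * (2 * Q e)"
proof -
  have "form (\<Sum>x\<in>T. scale (c x) x) e = (\<Sum>x\<in>T. c x * form x e)"
    by (simp add: form_sum_left form_scale_left)
  also have "\<dots> = (\<Sum>x\<in>T. if x = e then c e * (2 * Q e) else 0)"
  proof (rule sum.cong[OF refl])
    fix x assume "x \<in> T"
    then have "x \<noteq> e \<Longrightarrow> form x e = 0"
      using assms by (auto simp: orthogonal_set_def)
    then show "c x * form x e = (if x = e then c e * (2 * Q e) else 0)"
      by (auto simp: form_self)
  qed
  also have "\<dots> = c e * (2 * Q e)"
    using assms by simp
  finally show ?thesis .
qed

lemma orthogonal_set_independent:
  assumes "orthogonal_set E" shows "independent E"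
  unfolding independent_explicit_module
proof (intro allI impI)
  fix T c e assume T: "finite T" "T \<subseteq> E" "(\<Sum>x\<in>T. scale (c x) x) = 0" "e \<in> T"
  then have "c e * (2 * Q e) = 0"
    using form_orthogonal_sum[OF assms T(1,2,4), of c] by (simp add: form_zero_left)
  moreover have "Q e \<noteq> 0" using assms T by (auto simp: orthogonal_set_def)
  ultimately show "c e = 0" using two_nonzero by simp
qed

text \<open>For a finite orthogonal set this is the orthogonal projection onto its span; the
  denominator is \<open>form e e\<close>.\<close>

definition proj :: "'v set \<Rightarrow> 'v \<Rightarrow> 'v" where
  "proj E x = (\<Sum>e\<in>E. scale (form x e / (2 * Q e)) e)"

lemma form_proj:
  assumes "orthogonal_set E" "finite E" "e \<in> E"
  shows "form (proj E x) e = form x e"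
proof -
  have "Q e \<noteq> 0" using assms by (auto simp: orthogonal_set_def)
  then show ?thesis
    unfolding proj_def using form_orthogonal_sum[OF assms(1,2) order.refl assms(3)] two_nonzero
    by simp
qed

lemma proj_in_span: "proj E x \<in> span E"
  unfolding proj_def by (intro span_sum span_scale span_base)

lemma form_span_zero:
  assumes "\<And>e. e \<in> E \<Longrightarrow> form x e = 0" "y \<in> span E"
  shows "form x y = 0"
  using assms(2) by (induction rule: span_induct_alt) (simp_all add: form_simps assms(1))

lemma form_minus_proj:
  assumes "orthogonal_set E" "finite E" "y \<in> span E"
  shows "form (x - proj E x) y = 0"
  by (rule form_span_zero[OF _ assms(3)]) (simp add: form_diff_left form_proj[OF assms(1,2)])

end

section \<open>Orthogonal bases of nondegenerate subspaces\<close>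

locale octonion_algebra = nontrivial_composition_algebra scale mul one Q
  for scale :: "'f::field \<Rightarrow> 'v::ab_group_add \<Rightarrow> 'v" and mul one Q +
  assumes dim_8: "dim UNIV = 8"
begin

text \<open>The locale knows only the number \<open>dim UNIV\<close>, so a finite basis is produced
  here and the finite-dimensional theory is interpreted locally in the lemmas that follow.\<close>

lemma finite_dimensional: obtains B where "finite_dimensional_vector_space scale B" "card B = 8"
proof -
  obtain B where B: "B \<subseteq> UNIV" "independent B" "UNIV \<subseteq> span B" "card B = dim UNIV"
    using basis_exists by blast
  then have "finite B" using dim_8 by (metis card.infinite zero_neq_numeral)
  then have "finite_dimensional_vector_space scale B"
    using B by unfold_locales auto
  then show thesis using that B dim_8 by simp
qed

lemma independent_finite: "independent E \<Longrightarrow> finite E"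
proof -
  obtain B where "finite_dimensional_vector_space scale B" by (rule finite_dimensional)
  then interpret fd: finite_dimensional_vector_space scale B .
  show "independent E \<Longrightarrow> finite E" by (rule fd.finiteI_independent)
qed

lemma independent_card_le: "independent E \<Longrightarrow> E \<subseteq> X \<Longrightarrow> card E \<le> dim X"
proof -
  obtain B where "finite_dimensional_vector_space scale B" by (rule finite_dimensional)
  then interpret fd: finite_dimensional_vector_space scale B .
  show "independent E \<Longrightarrow> E \<subseteq> X \<Longrightarrow> card E \<le> dim X" by (rule fd.independent_card_le_dim)
qed

lemma span_of_card_ge: "E \<subseteq> X \<Longrightarrow> independent E \<Longrightarrow> dim X \<le> card E \<Longrightarrow> X \<subseteq> span E"
proof -
  obtain B where "finite_dimensional_vector_space scale B" by (rule finite_dimensional)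
  then interpret fd: finite_dimensional_vector_space scale B .
  show "E \<subseteq> X \<Longrightarrow> independent E \<Longrightarrow> dim X \<le> card E \<Longrightarrow> X \<subseteq> span E"
    by (rule fd.card_ge_dim_independent)
qed

text \<open>Take an orthogonal set of maximal size. On its orthogonal \<open>Y\<close> in
  \<open>X\<close>, \<open>Q\<close> vanishes by maximality, hence \<open>form\<close> vanishes by
  polarization. So \<open>Y\<close> lies in the radical of \<open>X\<close>, which is zero.\<close>

lemma orthogonal_basis_exists:
  assumes X: "subspace X" "nondegenerate_on Q X"
  obtains E where "E \<subseteq> X" "finite E" "orthogonal_set E" "span E = X" "card E = dim X"
proof -
  let ?P = "\<lambda>n. \<exists>E. E \<subseteq> X \<and> orthogonal_set E \<and> card E = n"
  have "?P 0" by (rule exI[of _ "{}"]) (simp add: orthogonal_set_def)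
  moreover have "n \<le> dim X" if "?P n" for n
    using that independent_card_le orthogonal_set_independent by blast
  ultimately obtain n where n: "?P n" "\<And>m. ?P m \<Longrightarrow> m \<le> n"
    using Nat.ex_has_greatest_nat[of ?P 0 "dim X"] by blast
  then obtain E where E: "E \<subseteq> X" "orthogonal_set E" "card E = n" by blast
  have ind: "independent E" by (rule orthogonal_set_independent[OF E(2)])
  have fin: "finite E" by (rule independent_finite[OF ind])
  have spanE: "span E \<subseteq> X" using E(1) X(1) by (simp add: span_minimal)
  define Y where "Y = {y\<in>X. \<forall>e\<in>E. form y e = 0}"
  have Q0: "Q y = 0" if y: "y \<in> Y" for y
  proof (rule ccontr)
    assume "Q y \<noteq> 0"
    then have "orthogonal_set (insert y E)"
      using E(2) y by (auto simp: orthogonal_set_def Y_def form_commute)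
    moreover have "y \<notin> E"
      using y \<open>Q y \<noteq> 0\<close> two_nonzero by (auto simp: Y_def form_self)
    ultimately have "?P (Suc n)"
      using E y fin by (intro exI[of _ "insert y E"]) (auto simp: Y_def)
    then show False using n(2) by fastforce
  qed
  have "X \<subseteq> span E"
  proof
    fix x assume x: "x \<in> X"
    define y where "y = x - proj E x"
    have yX: "y \<in> X"
      using x spanE proj_in_span[of E x] X(1) unfolding y_def by (intro subspace_diff) auto
    have yY: "y \<in> Y"
      using yX E(2) fin form_minus_proj[OF E(2) fin span_base] by (simp add: Y_def y_def)
    have "form y z = 0" if z: "z \<in> X" for z
    proof -
      define z' where "z' = z - proj E z"
      have "z' \<in> X"
        using z spanE proj_in_span[of E z] X(1) unfolding z'_def by (intro subspace_diff) auto
      then have z'Y: "z' \<in> Y"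
        using form_minus_proj[OF E(2) fin span_base] by (simp add: Y_def z'_def)
      have "y + z' \<in> Y"
        using yY z'Y X(1) by (auto simp: Y_def form_add_left subspace_add)
      then have "form y z' = 0"
        using Q0[OF yY] Q0[OF z'Y] Q0[of "y + z'"] by (simp add: Q_add)
      moreover have "form y (proj E z) = 0"
        using yY by (intro form_span_zero[OF _ proj_in_span]) (simp add: Y_def)
      ultimately show ?thesis
        unfolding z'_def by (simp add: form_diff_right)
    qed
    then have "y = 0" using X(2) yX unfolding nondegenerate_on_def by blast
    then show "x \<in> span E" using proj_in_span[of E x] by (simp add: y_def)
  qed
  then have "span E = X" using spanE by auto
  then show thesis using that E(1,2) fin ind basis_card_eq_dim[of E X] by auto
qed

end

section \<open>The decomposition into \<open>V0\<close> and \<open>W\<close>, and its multiplication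
  rules\<close>

locale quaternion_subalgebra = octonion_algebra scale mul one Q
  for scale :: "'f::field \<Rightarrow> 'v::ab_group_add \<Rightarrow> 'v" and mul one Q +
  fixes V0 W
  assumes V0: "composition_subalgebra scale mul one Q V0" and dim_V0: "dim V0 = 4"
    and W_def: "W = orthogonal_in Q UNIV V0"
begin

lemma V0_subspace: "subspace V0" and one_in_V0: "one \<in> V0"
  and V0_mul: "x \<in> V0 \<Longrightarrow> y \<in> V0 \<Longrightarrow> x \<odot> y \<in> V0" and V0_nondegenerate: "nondegenerate_on Q V0"
  using V0 by (auto simp: composition_subalgebra_def unital_subalgebra_def)

lemma V0_conj: "x \<in> V0 \<Longrightarrow> conj x \<in> V0"
  unfolding conj_def using V0_subspace one_in_V0 by (intro subspace_diff subspace_scale)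

lemma W_iff: "w \<in> W \<longleftrightarrow> (\<forall>x\<in>V0. form w x = 0)"
  by (simp add: W_def orthogonal_in_def)

lemma W_subspace: "subspace W"
  by (rule subspaceI) (auto simp: W_iff form_simps)

lemma form_W_V0: "w \<in> W \<Longrightarrow> x \<in> V0 \<Longrightarrow> form w x = 0"
  by (simp add: W_iff)

lemma form_V0_W: "w \<in> W \<Longrightarrow> x \<in> V0 \<Longrightarrow> form x w = 0"
  by (metis form_W_V0 form_commute)

lemma conj_W: "w \<in> W \<Longrightarrow> conj w = - w"
  using form_W_V0[OF _ one_in_V0] by (simp add: conj_def)

lemma decompose: obtains x w where "z = x + w" "x \<in> V0" "w \<in> W"
proof -
  obtain E where E: "E \<subseteq> V0" "finite E" "orthogonal_set E" "span E = V0"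
    using orthogonal_basis_exists[OF V0_subspace V0_nondegenerate] by metis
  have "z - proj E z \<in> W"
    using form_minus_proj[OF E(3,2)] E(4) by (simp add: W_iff)
  then show thesis
    using that[of "proj E z" "z - proj E z"] proj_in_span[of E z] E(4) by simp
qed

lemma V0_inter_W: "V0 \<inter> W = {0}"
proof -
  have "x = 0" if "x \<in> V0" "x \<in> W" for x
    using that V0_nondegenerate form_W_V0 unfolding nondegenerate_on_def by blast
  then show ?thesis using subspace_0[OF V0_subspace] subspace_0[OF W_subspace] by auto
qed

lemma W_nondegenerate: "nondegenerate_on Q W"
  unfolding nondegenerate_on_def
proof (intro ballI impI)
  fix x assume x: "x \<in> W" "\<forall>y\<in>W. form x y = 0"
  show "x = 0"
  proof (rule form_eqI)
    fix z
    obtain z0 w where "z = z0 + w" "z0 \<in> V0" "w \<in> W" by (rule decompose)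
    then show "form x z = form 0 z"
      using x by (simp add: form_add_right form_zero_left form_W_V0)
  qed
qed

text \<open>If \<open>x\<close> is orthogonal to \<open>W\<close>, so is its
  \<open>W\<close>-component, which then vanishes by nondegeneracy.\<close>

lemma V0_iff: "x \<in> V0 \<longleftrightarrow> (\<forall>w\<in>W. form x w = 0)"
proof
  assume "\<forall>w\<in>W. form x w = 0"
  moreover obtain x0 w where x: "x = x0 + w" "x0 \<in> V0" "w \<in> W" by (rule decompose)
  ultimately have "\<forall>u\<in>W. form w u = 0" by (simp add: form_add_left form_V0_W)
  then have "w = 0" using W_nondegenerate x(3) unfolding nondegenerate_on_def by blast
  then show "x \<in> V0" using x by simp
qed (simp add: form_V0_W)

text \<open>Orthogonal bases of \<open>V0\<close> and of \<open>W\<close> together form an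
  orthogonal basis of the whole space.\<close>

lemma dim_W: "dim W = 4"
proof -
  obtain E where E: "E \<subseteq> V0" "finite E" "orthogonal_set E" "span E = V0" "card E = dim V0"
    using orthogonal_basis_exists[OF V0_subspace V0_nondegenerate] by metis
  obtain F where F: "F \<subseteq> W" "finite F" "orthogonal_set F" "span F = W" "card F = dim W"
    using orthogonal_basis_exists[OF W_subspace W_nondegenerate] by metis
  have "orthogonal_set (E \<union> F)"
    unfolding orthogonal_set_def
  proof (intro conjI ballI impI)
    fix x assume "x \<in> E \<union> F"
    then show "Q x \<noteq> 0" using E(3) F(3) by (auto simp: orthogonal_set_def)
  next
    fix x y assume "x \<in> E \<union> F" "y \<in> E \<union> F" "x \<noteq> y"
    moreover have "form x y = 0" if "x \<in> E" "y \<in> F"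
      using that E(1) F(1) by (intro form_V0_W) auto
    moreover have "form x y = 0" if "x \<in> F" "y \<in> E"
      using that E(1) F(1) by (intro form_W_V0) auto
    ultimately show "form x y = 0" using E(3) F(3) by (auto simp: orthogonal_set_def)
  qed
  then have ind: "independent (E \<union> F)" by (rule orthogonal_set_independent)
  have "0 \<notin> E" using E(3) by (auto simp: orthogonal_set_def Q_zero)
  moreover have "E \<inter> F \<subseteq> {0}" unfolding V0_inter_W[symmetric] using E(1) F(1) by (rule Int_mono)
  ultimately have disj: "E \<inter> F = {}" by auto
  have "UNIV \<subseteq> span (E \<union> F)"
  proof
    fix z
    obtain x w where "z = x + w" "x \<in> V0" "w \<in> W" by (rule decompose)
    moreover have "V0 \<subseteq> span (E \<union> F)" "W \<subseteq> span (E \<union> F)"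
      unfolding E(4)[symmetric] F(4)[symmetric] by (intro span_mono; simp)+
    ultimately show "z \<in> span (E \<union> F)" by (simp add: span_add subset_iff)
  qed
  then have "card (E \<union> F) = 8" using ind basis_card_eq_dim[of "E \<union> F" UNIV] dim_8 by simp
  then show ?thesis
    using card_Un_disjoint[OF E(2) F(2) disj] E(5) F(5) dim_V0 by simp
qed

lemma V0_mul_W: "x \<in> V0 \<Longrightarrow> w \<in> W \<Longrightarrow> x \<odot> w \<in> W"
  by (simp add: W_iff form_mul_left_adjoint V0_conj V0_mul)

lemma W_mul_V0: "x \<in> V0 \<Longrightarrow> w \<in> W \<Longrightarrow> w \<odot> x \<in> W"
  by (simp add: W_iff form_mul_right_adjoint V0_conj V0_mul)

text \<open>If \<open>t\<close> is anisotropic, then \<open>t V0\<close> has dimension 4, hence equals \<open>W\<close>, and it is orthogonal to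
  \<open>t W\<close>. The anisotropic vectors span \<open>W\<close>.\<close>

lemma W_mul_W: assumes t: "t \<in> W" and u: "u \<in> W" shows "t \<odot> u \<in> V0"
proof -
  obtain E where E: "E \<subseteq> V0" "finite E" "orthogonal_set E" "span E = V0" "card E = dim V0"
    using orthogonal_basis_exists[OF V0_subspace V0_nondegenerate] by metis
  have aniso: "s \<odot> u \<in> V0" if s: "s \<in> W" "Q s \<noteq> 0" for s
  proof -
    have "inj_on (\<lambda>x. s \<odot> x) UNIV"
      by (rule injI) (metis conj_mul_cancel_left s(2) scale_left_imp_eq)
    then have inj: "inj_on (\<lambda>x. s \<odot> x) E" by (rule inj_on_subset) simp
    have "orthogonal_set ((\<lambda>x. s \<odot> x) ` E)"
      using E(3) s by (auto simp: orthogonal_set_def Q_mul form_mul_left)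
    then have "independent ((\<lambda>x. s \<odot> x) ` E)" by (rule orthogonal_set_independent)
    moreover have "(\<lambda>x. s \<odot> x) ` E \<subseteq> W" using E(1) s W_mul_V0 by auto
    ultimately have "W \<subseteq> span ((\<lambda>x. s \<odot> x) ` E)"
      using span_of_card_ge card_image[OF inj] E(5) dim_V0 dim_W by simp
    moreover have "form (s \<odot> u) z = 0" if z: "z \<in> (\<lambda>x. s \<odot> x) ` E" for z
    proof -
      obtain x where "z = s \<odot> x" "x \<in> V0" using z E(1) by blast
      then show ?thesis using u by (simp add: form_mul_left form_W_V0)
    qed
    ultimately have "form (s \<odot> u) w = 0" if "w \<in> W" for w
      using that form_span_zero[of "(\<lambda>x. s \<odot> x) ` E" "s \<odot> u" w] by blast
    then show ?thesis by (simp add: V0_iff)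
  qed
  obtain F where F: "F \<subseteq> W" "finite F" "orthogonal_set F" "span F = W"
    using orthogonal_basis_exists[OF W_subspace W_nondegenerate] by metis
  have "t \<in> span F" using t F(4) by simp
  then show ?thesis
  proof (induction rule: span_induct_alt)
    case base
    show ?case using subspace_0[OF V0_subspace] by (simp add: mul_zero_left)
  next
    case (step c x y)
    then have "x \<odot> u \<in> V0" using aniso F(1,3) by (auto simp: orthogonal_set_def)
    then show ?case
      using step V0_subspace by (simp add: mul_simps subspace_add subspace_scale)
  qed
qed

text \<open>Conjugation reverses products and is -1 on \<open>W\<close>, which contains both
  \<open>w\<close> and \<open>w \<odot> x\<close>.\<close>

lemma W_mul_V0_eq: assumes "x \<in> V0" "w \<in> W" shows "w \<odot> x = conj x \<odot> w"
proof -
  have "- (w \<odot> x) = conj (w \<odot> x)" using assms W_mul_V0 conj_W by simp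
  also have "\<dots> = - (conj x \<odot> w)" using assms by (simp add: conj_mul conj_W mul_minus_right)
  finally show ?thesis by simp
qed

text \<open>The order of the factors is reversed: \<open>W\<close> is a left module over the
  opposite algebra of \<open>V0\<close>. Both sides lie in \<open>W\<close>, so only pairings with
  \<open>u\<close> in \<open>W\<close> matter; there \<open>form_exchange\<close> loses its
  right-hand side because \<open>form x u = 0\<close>.\<close>

lemma mul_mul_W:
  assumes x: "x \<in> V0" and y: "y \<in> V0" and w: "w \<in> W"
  shows "(x \<odot> y) \<odot> w = y \<odot> (x \<odot> w)"
proof (rule form_eqI)
  fix z
  obtain z0 u where z: "z = z0 + u" "z0 \<in> V0" "u \<in> W" by (rule decompose)
  have "form ((x \<odot> y) \<odot> w) u = - form (x \<odot> y) (u \<odot> w)"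
    using w by (simp add: form_mul_right_adjoint conj_W mul_minus_right form_minus_right)
  also have "\<dots> = form (x \<odot> w) (u \<odot> y)"
    using form_exchange[of x y u w] form_V0_W[OF z(3) x] by (simp add: add_eq_0_iff)
  also have "\<dots> = form (x \<odot> w) (conj y \<odot> u)"
    using W_mul_V0_eq[OF y z(3)] by simp
  also have "\<dots> = form (y \<odot> (x \<odot> w)) u"
    by (simp add: form_mul_left_adjoint)
  finally show "form ((x \<odot> y) \<odot> w) z = form (y \<odot> (x \<odot> w)) z"
    using x y w z by (simp add: form_add_right form_W_V0 V0_mul V0_mul_W)
qed

lemma anisotropic_vector_W: obtains a where "a \<in> W" "Q a \<noteq> 0"
proof -
  obtain E where E: "E \<subseteq> W" "orthogonal_set E" "card E = dim W"
    using orthogonal_basis_exists[OF W_subspace W_nondegenerate] by metis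
  then have "E \<noteq> {}" using dim_W by auto
  then show thesis using that E(1,2) by (auto simp: orthogonal_set_def)
qed

end

text \<open>The explicit 24 terms serve to recognize the determinant in the expansion of
  \<open>volume\<close>.\<close>

lemma det_4:
  "det (A::'a::comm_ring_1^4^4) =
    A$1$1 * A$2$2 * A$3$3 * A$4$4 - A$1$1 * A$2$2 * A$3$4 * A$4$3
  - A$1$1 * A$2$3 * A$3$2 * A$4$4 + A$1$1 * A$2$3 * A$3$4 * A$4$2
  + A$1$1 * A$2$4 * A$3$2 * A$4$3 - A$1$1 * A$2$4 * A$3$3 * A$4$2
  - A$1$2 * A$2$1 * A$3$3 * A$4$4 + A$1$2 * A$2$1 * A$3$4 * A$4$3
  + A$1$2 * A$2$3 * A$3$1 * A$4$4 - A$1$2 * A$2$3 * A$3$4 * A$4$1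
  - A$1$2 * A$2$4 * A$3$1 * A$4$3 + A$1$2 * A$2$4 * A$3$3 * A$4$1
  + A$1$3 * A$2$1 * A$3$2 * A$4$4 - A$1$3 * A$2$1 * A$3$4 * A$4$2
  - A$1$3 * A$2$2 * A$3$1 * A$4$4 + A$1$3 * A$2$2 * A$3$4 * A$4$1
  + A$1$3 * A$2$4 * A$3$1 * A$4$2 - A$1$3 * A$2$4 * A$3$2 * A$4$1
  - A$1$4 * A$2$1 * A$3$2 * A$4$3 + A$1$4 * A$2$1 * A$3$3 * A$4$2
  + A$1$4 * A$2$2 * A$3$1 * A$4$3 - A$1$4 * A$2$2 * A$3$3 * A$4$1
  - A$1$4 * A$2$3 * A$3$1 * A$4$2 + A$1$4 * A$2$3 * A$3$2 * A$4$1"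
proof -
  have f: "finite {2::4, 3, 4}" "1 \<notin> {2::4, 3, 4}" "finite {3::4, 4}" "2 \<notin> {3::4, 4}"
    "finite {4::4}" "3 \<notin> {4::4}"
    by auto
  show ?thesis
    unfolding det_def UNIV_4
    unfolding sum_over_permutations_insert[OF f(1,2)]
    unfolding sum_over_permutations_insert[OF f(3,4)]
    unfolding sum_over_permutations_insert[OF f(5,6)]
    unfolding permutes_sing
    by (simp add: sign_swap_id sign_compose sign_id swap_id_eq permutation_swap_id permutation_compose
        algebra_simps)
qed

section \<open>An alternating 4-form on \<open>W\<close> and its square\<close>

context quaternion_subalgebra
begin

text \<open>On \<open>W\<close> the triple product \<open>(t u) s\<close> is, up to terms of the form \<open>scale (form x y) z\<close>, alternating;
  the associated 4-form is half of \<open>volume\<close>.\<close>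

definition volume :: "'v \<Rightarrow> 'v \<Rightarrow> 'v \<Rightarrow> 'v \<Rightarrow> 'f" where
  "volume t u r s = 2 * form (t \<odot> u) (r \<odot> s)
     - (form t r * form u s + form t u * form r s - form t s * form u r)"

text \<open>On \<open>W\<close>, \<open>conj\<close> exchanges \<open>t \<odot> u\<close> and
  \<open>u \<odot> t\<close>. Unfolding it inside \<open>form\<close> produces the product
  \<open>form t u * form r s\<close>, since the trace of \<open>t \<odot> u\<close> is
  \<open>- form t u\<close>.\<close>

lemma volume_swap12:
  assumes "t \<in> W" "u \<in> W" "r \<in> W" "s \<in> W"
  shows "volume u t r s = - volume t u r s"
proof -
  have "conj (t \<odot> u) = u \<odot> t"
    using assms by (simp add: conj_mul conj_W mul_simps)
  then have "u \<odot> t = scale (form (t \<odot> u) one) one - t \<odot> u"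
    by (simp add: conj_def)
  moreover have "form (t \<odot> u) one = - form t u" if "t \<in> W" "u \<in> W" for t u
    using that form_mul_right_adjoint[of t u one] by (simp add: conj_W mul_simps form_simps)
  ultimately have "form (u \<odot> t) (r \<odot> s) = form t u * form r s - form (t \<odot> u) (r \<odot> s)"
    using assms by (simp add: form_simps form_commute[of one])
  then show ?thesis
    unfolding volume_def
    by (simp add: form_commute[of u t] form_commute[of u s] form_commute[of u r]
        form_commute[of t s] right_diff_distrib)
qed

lemma volume_swap13: "volume r u t s = - volume t u r s"
proof -
  have "form (r \<odot> u) (t \<odot> s) = form t r * form u s - form (t \<odot> u) (r \<odot> s)"
    using form_exchange[of t u r s] form_commute[of "r \<odot> u" "t \<odot> s"] by (simp add: algebra_simps)
  then show ?thesis
    unfolding volume_def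
    by (simp add: form_commute[of r t] form_commute[of r u] form_commute[of s r] form_commute[of u t]
        right_diff_distrib)
qed

lemma volume_swap24: "volume t s r u = - volume t u r s"
proof -
  have "form (t \<odot> s) (r \<odot> u) = form t r * form u s - form (t \<odot> u) (r \<odot> s)"
    using form_exchange[of t u r s] by (simp add: algebra_simps)
  then show ?thesis
    unfolding volume_def
    by (simp add: form_commute[of s u] form_commute[of s r] form_commute[of u r] right_diff_distrib)
qed

lemma volume_add1: "volume (x + y) u r s = volume x u r s + volume y u r s"
  by (simp add: volume_def form_simps mul_simps algebra_simps)

lemma volume_scale1: "volume (scale c x) u r s = c * volume x u r s"
  by (simp add: volume_def form_simps mul_simps algebra_simps)

lemma volume_add2: "volume u (x + y) r s = volume u x r s + volume u y r s"
  by (simp add: volume_def form_simps mul_simps algebra_simps)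

lemma volume_scale2: "volume u (scale c x) r s = c * volume u x r s"
  by (simp add: volume_def form_simps mul_simps algebra_simps)

lemma volume_add3: "volume u r (x + y) s = volume u r x s + volume u r y s"
  by (simp add: volume_def form_simps mul_simps algebra_simps)

lemma volume_scale3: "volume u r (scale c x) s = c * volume u r x s"
  by (simp add: volume_def form_simps mul_simps algebra_simps)

lemma volume_add4: "volume u r s (x + y) = volume u r s x + volume u r s y"
  by (simp add: volume_def form_simps mul_simps algebra_simps)

lemma volume_scale4: "volume u r s (scale c x) = c * volume u r s x"
  by (simp add: volume_def form_simps mul_simps algebra_simps)

lemmas volume_simps = volume_add1 volume_add2 volume_add3 volume_add4
  volume_scale1 volume_scale2 volume_scale3 volume_scale4

text \<open>The available swaps are (12), (13) and (24). The transposition (23) is the conjugate of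
  (13) by (12), and (34) is a conjugate of (24) by a word in (12) and (13).\<close>

lemma volume_swaps:
  assumes "a \<in> W" "b \<in> W" "c \<in> W" "d \<in> W"
  shows "volume b a c d = - volume a b c d" "volume a c b d = - volume a b c d"
    "volume a b d c = - volume a b c d"
proof -
  show "volume b a c d = - volume a b c d" by (rule volume_swap12[OF assms])
  show "volume a c b d = - volume a b c d"
    using assms volume_swap12[of a c b d] volume_swap13[of c a b d] volume_swap12[of a b c d] by simp
  show "volume a b d c = - volume a b c d"
    using assms volume_swap13[of a b d c] volume_swap12[of d b a c] volume_swap24[of b d a c]
      volume_swap12[of b c a d] volume_swap13[of c b a d] by simp
qed

lemma volume_eq_zero:
  assumes "a \<in> W" "b \<in> W" "c \<in> W"
  shows "volume a a b c = 0" "volume a b a c = 0" "volume a b c a = 0"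
    "volume b a a c = 0" "volume b a c a = 0" "volume b c a a = 0"
proof -
  have *: "x = 0" if "x = - x" for x :: 'f
  proof -
    have "2 * x = x + x" by simp
    also have "\<dots> = 0" using that by (metis add.right_inverse)
    finally show ?thesis using two_nonzero by simp
  qed
  have 1: "volume x x y z = 0" if "x \<in> W" "y \<in> W" "z \<in> W" for x y z
    by (rule *) (rule volume_swaps(1)[OF that(1,1,2,3)])
  have 2: "volume x y x z = 0" if "x \<in> W" "y \<in> W" "z \<in> W" for x y z
    using volume_swaps(2)[of x x y z] that 1 by simp
  show "volume a a b c = 0" "volume a b a c = 0" using assms 1 2 by auto
  show "volume a b c a = 0" using volume_swaps(3)[of a b a c] assms 2 by simp
  show 3: "volume b a a c = 0" using volume_swaps(1)[of a b a c] assms 2 by simp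
  show "volume b a c a = 0" using volume_swaps(3)[of b a a c] assms 3 by simp
  then show "volume b c a a = 0" using volume_swaps(2)[of b a c a] assms by simp
qed

text \<open>An abstract \<open>B\<close> allows the use both for the first and for the last two
  arguments of \<open>volume\<close>. The coefficients are the 2x2 minors of the two coordinate
  rows.\<close>

lemma alternating_expand:
  fixes e :: "4 \<Rightarrow> 'v"
  assumes add_left: "\<And>x y z. B (x + y) z = B x z + B y z"
    and add_right: "\<And>x y z. B z (x + y) = B z x + B z y"
    and scale_left: "\<And>c x z. B (scale c x) z = c * B x z"
    and scale_right: "\<And>c x z. B z (scale c x) = c * B z x"
    and zero: "\<And>i. B (e i) (e i) = (0::'f)"
    and anti: "\<And>i j. B (e i) (e j) = - B (e j) (e i)"
  shows "B (\<Sum>j\<in>UNIV. scale (a j) (e j)) (\<Sum>j\<in>UNIV. scale (b j) (e j)) =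
    (a 1 * b 2 - a 2 * b 1) * B (e 1) (e 2) +
    (a 1 * b 3 - a 3 * b 1) * B (e 1) (e 3) +
    (a 1 * b 4 - a 4 * b 1) * B (e 1) (e 4) +
    (a 2 * b 3 - a 3 * b 2) * B (e 2) (e 3) +
    (a 2 * b 4 - a 4 * b 2) * B (e 2) (e 4) +
    (a 3 * b 4 - a 4 * b 3) * B (e 3) (e 4)"
  unfolding sum_4
  by (simp add: add_left add_right scale_left scale_right zero anti[of 2 1] anti[of 3 1] anti[of 4 1] anti[of 3 2] anti[of 4 2] anti[of 4 3])
    (simp add: algebra_simps)

text \<open>A Laplace expansion along rows 1, 2 and rows 3, 4: of the 36 products of 2x2 minors only
  the six with complementary columns survive, and they add up to the determinant.\<close>

lemma volume_expand:
  fixes m :: "'f^4^4" and e w :: "4 \<Rightarrow> 'v"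
  assumes e: "\<And>j. e j \<in> W" and w: "\<And>i. w i = (\<Sum>j\<in>UNIV. scale (m$i$j) (e j))"
  shows "volume (w 1) (w 2) (w 3) (w 4) = det m * volume (e 1) (e 2) (e 3) (e 4)"
proof -
  have wW: "w i \<in> W" for i
    unfolding w using e W_subspace by (intro subspace_sum subspace_scale) auto
  have 1: "volume (w 1) (w 2) x y =
      (m$1$1 * m$2$2 - m$1$2 * m$2$1) * volume (e 1) (e 2) x y +
      (m$1$1 * m$2$3 - m$1$3 * m$2$1) * volume (e 1) (e 3) x y +
      (m$1$1 * m$2$4 - m$1$4 * m$2$1) * volume (e 1) (e 4) x y +
      (m$1$2 * m$2$3 - m$1$3 * m$2$2) * volume (e 2) (e 3) x y +
      (m$1$2 * m$2$4 - m$1$4 * m$2$2) * volume (e 2) (e 4) x y +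
      (m$1$3 * m$2$4 - m$1$4 * m$2$3) * volume (e 3) (e 4) x y"
    if "x \<in> W" "y \<in> W" for x y
    unfolding w[of 1] w[of 2]
    by (rule alternating_expand[of "\<lambda>a b. volume a b x y"])
      (simp_all add: volume_simps volume_eq_zero that e, rule volume_swaps(1)[OF e e that])
  have 2: "volume x y (w 3) (w 4) =
      (m$3$1 * m$4$2 - m$3$2 * m$4$1) * volume x y (e 1) (e 2) +
      (m$3$1 * m$4$3 - m$3$3 * m$4$1) * volume x y (e 1) (e 3) +
      (m$3$1 * m$4$4 - m$3$4 * m$4$1) * volume x y (e 1) (e 4) +
      (m$3$2 * m$4$3 - m$3$3 * m$4$2) * volume x y (e 2) (e 3) +
      (m$3$2 * m$4$4 - m$3$4 * m$4$2) * volume x y (e 2) (e 4) +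
      (m$3$3 * m$4$4 - m$3$4 * m$4$3) * volume x y (e 3) (e 4)"
    if "x \<in> W" "y \<in> W" for x y
    unfolding w[of 3] w[of 4]
    by (rule alternating_expand)
      (simp_all add: volume_simps volume_eq_zero that e, rule volume_swaps(3)[OF that e e])
  \<comment> \<open>These oriented instances sort the basis vectors into one fixed order, so that
    every surviving term becomes a multiple of the same value.\<close>
  note swaps =
      volume_swaps(1)[of "e 2" "e 1"] volume_swaps(2)[of _ "e 2" "e 1"] volume_swaps(3)[of _ _ "e 2" "e 1"]
      volume_swaps(1)[of "e 3" "e 1"] volume_swaps(2)[of _ "e 3" "e 1"] volume_swaps(3)[of _ _ "e 3" "e 1"]
      volume_swaps(1)[of "e 4" "e 1"] volume_swaps(2)[of _ "e 4" "e 1"] volume_swaps(3)[of _ _ "e 4" "e 1"]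
      volume_swaps(1)[of "e 3" "e 2"] volume_swaps(2)[of _ "e 3" "e 2"] volume_swaps(3)[of _ _ "e 3" "e 2"]
      volume_swaps(1)[of "e 4" "e 2"] volume_swaps(2)[of _ "e 4" "e 2"] volume_swaps(3)[of _ _ "e 4" "e 2"]
      volume_swaps(1)[of "e 4" "e 3"] volume_swaps(2)[of _ "e 4" "e 3"] volume_swaps(3)[of _ _ "e 4" "e 3"]
  show ?thesis
    unfolding 1[OF wW wW] 2[OF e e] det_4
    by (simp add: volume_eq_zero swaps e) (simp add: algebra_simps)
qed

text \<open>The vector \<open>n\<close> acts as a cross product: pairing it with \<open>r\<close>
  gives \<open>volume\<close> with \<open>r\<close> in the third slot, up to the factor -1/2. So
  \<open>n\<close> is orthogonal to all basis vectors except \<open>e 3\<close> and is a multiple of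
  it. Multiplicativity of \<open>Q\<close> gives the square of the coefficient.\<close>

lemma volume_orthogonal:
  fixes e :: "4 \<Rightarrow> 'v"
  assumes e: "\<And>i. e i \<in> W" and orth: "\<And>i j. i \<noteq> j \<Longrightarrow> form (e i) (e j) = 0"
    and aniso: "\<And>i. Q (e i) \<noteq> 0"
    and span: "\<And>x. x \<in> W \<Longrightarrow> (\<And>i. form x (e i) = 0) \<Longrightarrow> x = 0"
  shows "(volume (e 1) (e 2) (e 3) (e 4))\<^sup>2 = (\<Prod>i\<in>UNIV. 2 * Q (e i))"
proof -
  define n where "n = (e 1 \<odot> e 2) \<odot> e 4"
  have nW: "n \<in> W" unfolding n_def using e by (intro V0_mul_W W_mul_W)
  have n: "2 * form n r = - volume (e 1) (e 2) r (e 4)" if "r \<in> W" for r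
    unfolding n_def volume_def using e by (simp add: form_mul_right_adjoint[of "e 1 \<odot> e 2"] conj_W mul_simps form_simps orth)
  have zero: "form n (e i) = 0" if "i \<noteq> 3" for i
  proof -
    have "volume (e 1) (e 2) (e i) (e 4) = 0"
      using exhaust_4[of i] that e volume_eq_zero by auto
    then show ?thesis using n[OF e[of i]] two_nonzero by simp
  qed
  define c where "c = form n (e 3) / (2 * Q (e 3))"
  have form3: "form n (e 3) = c * (2 * Q (e 3))"
    using aniso two_nonzero by (simp add: c_def)
  have "n - scale c (e 3) = 0"
  proof (rule span)
    show "n - scale c (e 3) \<in> W"
      using nW e W_subspace by (intro subspace_diff subspace_scale)
    show "form (n - scale c (e 3)) (e i) = 0" for i
      by (cases "i = 3") (simp_all add: form_simps form3 form_self zero orth)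
  qed
  then have "Q n = c\<^sup>2 * Q (e 3)" by (simp add: Q_scale)
  moreover have "Q n = Q (e 1) * Q (e 2) * Q (e 4)" by (simp add: n_def Q_mul)
  ultimately have "c\<^sup>2 * Q (e 3) = Q (e 1) * Q (e 2) * Q (e 4)" by (rule subst)
  moreover have vol: "volume (e 1) (e 2) (e 3) (e 4) = - (4 * c * Q (e 3))"
  proof -
    have "volume (e 1) (e 2) (e 3) (e 4) = - (2 * form n (e 3))"
      using n[OF e[of 3]] by simp
    then show ?thesis unfolding form3 by simp
  qed
  moreover have "(- (4 * c * Q (e 3)))\<^sup>2 = 16 * Q (e 3) * (c\<^sup>2 * Q (e 3))"
    by (simp add: power2_eq_square)
  ultimately have "(volume (e 1) (e 2) (e 3) (e 4))\<^sup>2 = 16 * Q (e 3) * (Q (e 1) * Q (e 2) * Q (e 4))"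
    by simp
  also have "\<dots> = 2 * Q (e 1) * (2 * Q (e 2) * (2 * Q (e 3) * (2 * Q (e 4))))"
    by simp
  also have "\<dots> = (\<Prod>i\<in>UNIV. 2 * Q (e i))"
    unfolding UNIV_4 by simp
  finally show ?thesis .
qed

text \<open>The two sides are the squares of \<open>volume\<close> and of the determinant of coordinates, up to the same
  constant, computed in an orthogonal basis of \<open>W\<close>.\<close>

lemma volume_square:
  fixes w :: "4 \<Rightarrow> 'v"
  assumes w: "\<And>i. w i \<in> W"
  shows "(volume (w 1) (w 2) (w 3) (w 4))\<^sup>2 = det (\<chi> i j. form (w i) (w j))"
proof -
  obtain E where E: "E \<subseteq> W" "finite E" "orthogonal_set E" "span E = W" "card E = dim W"
    using orthogonal_basis_exists[OF W_subspace W_nondegenerate] by metis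
  have "card E = card (UNIV :: 4 set)" using E(5) dim_W by simp
  then obtain e where e: "bij_betw e (UNIV :: 4 set) E"
    using finite_same_card_bij[of "UNIV :: 4 set" E] E(2) by auto
  have eE: "e i \<in> E" for i using e by (auto simp: bij_betw_def)
  have eW: "e i \<in> W" for i using eE E(1) by auto
  have aniso: "Q (e i) \<noteq> 0" for i using eE E(3) by (auto simp: orthogonal_set_def)
  have orth: "form (e i) (e j) = 0" if "i \<noteq> j" for i j
  proof -
    have "e i \<noteq> e j" using e that by (auto simp: bij_betw_def inj_def)
    then show ?thesis using eE E(3) by (auto simp: orthogonal_set_def)
  qed
  have spanning: "x = 0" if x: "x \<in> W" "\<And>i. form x (e i) = 0" for x
  proof -
    have "form x y = 0" if y: "y \<in> W" for y
    proof (rule form_span_zero)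
      show "y \<in> span E" using y E(4) by simp
      fix z assume "z \<in> E"
      then obtain i where "z = e i" using e by (auto simp: bij_betw_def)
      then show "form x z = 0" using x(2) by simp
    qed
    then show ?thesis using W_nondegenerate x(1) unfolding nondegenerate_on_def by blast
  qed
  define m where "m = (\<chi> i j. form (w i) (e j) / (2 * Q (e j)))"
  have form_sum: "form (\<Sum>j\<in>UNIV. scale (c j) (e j)) (e k) = c k * (2 * Q (e k))" for c k
  proof -
    have "form (\<Sum>j\<in>UNIV. scale (c j) (e j)) (e k) = (\<Sum>j\<in>UNIV. if j = k then c k * (2 * Q (e k)) else 0)"
      unfolding form_sum_left by (intro sum.cong) (auto simp: form_scale_left form_self orth)
    then show ?thesis by simp
  qed
  have wm: "w i = (\<Sum>j\<in>UNIV. scale (m$i$j) (e j))" for i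
  proof -
    have "w i - (\<Sum>j\<in>UNIV. scale (m$i$j) (e j)) = 0"
    proof (rule spanning)
      show "w i - (\<Sum>j\<in>UNIV. scale (m$i$j) (e j)) \<in> W"
        using w eW W_subspace by (intro subspace_diff subspace_sum subspace_scale) auto
      show "form (w i - (\<Sum>j\<in>UNIV. scale (m$i$j) (e j))) (e k) = 0" for k
        unfolding form_diff_left form_sum using aniso two_nonzero by (simp add: m_def)
    qed
    then show ?thesis by simp
  qed
  define d where "d = ((\<chi> i j. if i = j then 2 * Q (e i) else 0) :: 'f^4^4)"
  have gram: "(\<chi> i j. form (w i) (w j)) = m ** (d ** transpose m)"
  proof -
    have "form (w i) (w j) = (m ** (d ** transpose m)) $ i $ j" for i j
    proof -
      have "form (w i) (w j) = (\<Sum>k\<in>UNIV. m$j$k * form (w i) (e k))"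
        by (subst wm[of j]) (simp add: form_sum_right form_scale_right)
      also have "\<dots> = (\<Sum>k\<in>UNIV. m$i$k * (2 * Q (e k) * m$j$k))"
        by (rule sum.cong[OF refl]) (subst wm[of i], simp add: form_sum)
      also have "\<dots> = (m ** (d ** transpose m)) $ i $ j"
        by (simp add: matrix_matrix_mult_def d_def transpose_def if_distrib[of "\<lambda>x. x * _"] cong: if_cong)
      finally show ?thesis .
    qed
    then show ?thesis by (simp add: vec_eq_iff)
  qed
  have "det d = (\<Prod>i\<in>UNIV. 2 * Q (e i))"
    by (subst det_diagonal) (simp_all add: d_def)
  also have "\<dots> = (volume (e 1) (e 2) (e 3) (e 4))\<^sup>2"
    by (rule volume_orthogonal[of e, OF eW orth aniso spanning, symmetric])
  finally show ?thesis
    unfolding gram det_mul det_transpose volume_expand[of e w m, OF eW wm]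
    by (simp add: power2_eq_square mult_ac)
qed

end

section \<open>Valuations and norms\<close>

context nonarch_local_field
begin

lemma v_infinity_iff: "v x = \<infinity> \<longleftrightarrow> x = 0"
  and v_mult: "v (x * y) = v x + v y"
  and v_add: "min (v x) (v y) \<le> v (x + y)"
  and v_int: "x \<noteq> 0 \<Longrightarrow> \<exists>n::int. v x = ereal (of_int n)"
  and v_uniformizer: "\<exists>x. v x = 1"
  using valuation by (auto simp: normalized_valuation_def)

lemma v_zero: "v 0 = \<infinity>" by (simp add: v_infinity_iff)

lemma v_finite: "x \<noteq> 0 \<Longrightarrow> \<bar>v x\<bar> \<noteq> \<infinity>"
  using v_int by fastforce

lemma v_one: "v 1 = 0"
proof -
  obtain n where "v 1 = ereal (of_int n)" using v_int[of 1] by auto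
  then show ?thesis using v_mult[of 1 1] by (simp add: zero_ereal_def)
qed

lemma v_minus: "v (- x) = v x"
proof -
  obtain n where "v (- 1) = ereal (of_int n)" using v_int[of "- 1"] by auto
  then have "v (- 1) = 0" using v_mult[of "- 1" "- 1"] v_one by (simp add: zero_ereal_def)
  then show ?thesis using v_mult[of "- 1" x] by simp
qed

lemma v_inverse: "x \<noteq> 0 \<Longrightarrow> v x + v (inverse x) = 0"
  using v_mult[of x "inverse x"] v_one by simp

lemma v_addI: "c \<le> v x \<Longrightarrow> c \<le> v y \<Longrightarrow> c \<le> v (x + y)"
  using v_add[of x y] by (meson min.bounded_iff order_trans)

lemma v_diffI: "c \<le> v x \<Longrightarrow> c \<le> v y \<Longrightarrow> c \<le> v (x - y)"
  using v_addI[of c x "- y"] by (simp add: v_minus)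

lemma v_sumI: "(\<And>i. i \<in> S \<Longrightarrow> c \<le> v (g i)) \<Longrightarrow> c \<le> v (sum g S)"
  by (induction S rule: infinite_finite_induct) (auto simp: v_zero intro: v_addI)

lemma v_prod: "finite S \<Longrightarrow> v (prod g S) = (\<Sum>i\<in>S. v (g i))"
  by (induction S rule: finite_induct) (auto simp: v_one v_mult)

lemma v_of_int_nonneg: "0 \<le> v (of_int k)"
proof -
  have "0 \<le> v (of_nat n)" for n
    by (induction n) (auto simp: v_zero v_one intro: v_addI)
  then show ?thesis by (cases k) (auto simp: v_minus simp del: of_nat_Suc)
qed

lemma v_ge_one: "0 < v x \<Longrightarrow> 1 \<le> v x"
proof (cases "x = 0")
  case False
  then obtain n where "v x = ereal (of_int n)" using v_int by blast
  then show "0 < v x \<Longrightarrow> 1 \<le> v x" by (simp add: one_ereal_def)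
qed (simp add: v_zero)

lemma eq_zero_if_v_ge: "(\<And>N::nat. ereal (real N) \<le> v x) \<Longrightarrow> x = 0"
proof (rule ccontr)
  assume *: "\<And>N::nat. ereal (real N) \<le> v x" and "x \<noteq> 0"
  then obtain n where n: "v x = ereal (of_int n)" using v_int by blast
  then show False using *[of "nat (n + 1)"] by (cases "0 \<le> n") auto
qed

text \<open>Since \<open>p = 2 * k + 1\<close> is odd, positive valuations of both \<open>p\<close>
  and 2 would give 1 a positive valuation.\<close>

lemma v_two_eq_zero:
  assumes "residual_characteristic v p" "p \<noteq> 2"
  shows "v 2 = 0"
proof (rule ccontr)
  assume "v 2 \<noteq> 0"
  then have 2: "0 < v 2" using v_of_int_nonneg[of 2] by simp
  have p: "prime p" "0 < v (of_nat p)" using assms by (auto simp: residual_characteristic_def)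
  then have "odd p" using assms(2) primes_dvd_imp_eq two_is_prime_nat by blast
  then obtain k where k: "p = 2 * k + 1" by (rule oddE)
  have "1 = of_nat p - 2 * (of_nat k :: 'f)" by (simp add: k)
  moreover have "1 \<le> v (of_nat p)" using p v_ge_one by simp
  moreover have "1 \<le> v (2 * of_nat k)"
    using add_mono[OF v_ge_one[OF 2] v_of_int_nonneg[of "int k"]] by (simp add: v_mult)
  ultimately have "1 \<le> v 1" using v_diffI by metis
  then show False by (simp add: v_one)
qed

text \<open>The root is the fixed point of the contraction \<open>x \<mapsto> (z - x\<^sup>2) / 2\<close>.\<close>

lemma hensel_sqrt:
  assumes z: "0 < v z" and two: "v 2 = 0"
  shows "\<exists>s. s\<^sup>2 = 1 + z"
proof -
  have two0: "(2::'f) \<noteq> 0" using two v_zero by force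
  have v_half: "v (x / 2) = v x" for x
    using v_mult[of "x / 2" 2] two two0 by simp
  define t where "t = rec_nat 0 (\<lambda>_ x. (z - x\<^sup>2) / 2)"
  have t0: "t 0 = 0" and tS: "t (Suc n) = (z - (t n)\<^sup>2) / 2" for n
    by (simp_all add: t_def)
  have z1: "1 \<le> v z" by (rule v_ge_one[OF z])
  have t1: "1 \<le> v (t n)" for n
  proof (induction n)
    case (Suc n)
    have "1 + 0 \<le> v (t n) + v (t n)"
      using Suc by (intro add_mono) (auto intro: order_trans[of 0 1])
    then show ?case by (simp add: tS v_half z1 v_diffI power2_eq_square v_mult)
  qed (simp add: t0 v_zero)
  \<comment> \<open>Up to sign, each step multiplies the last increment by
    \<open>(t (Suc n) + t n) / 2\<close>, whose valuation is at least 1.\<close>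
  have step: "ereal (real (Suc n)) \<le> v (t (Suc n) - t n)" for n
  proof (induction n)
    case 0
    show ?case using z1 by (simp add: t0 tS v_half one_ereal_def)
  next
    case (Suc n)
    have "t (Suc (Suc n)) - t (Suc n) = (z - (t (Suc n))\<^sup>2) / 2 - (z - (t n)\<^sup>2) / 2"
      by (simp only: tS)
    also have "\<dots> = (- ((t (Suc n) - t n) * (t (Suc n) + t n))) / 2"
      unfolding diff_divide_distrib[symmetric] by (simp add: power2_eq_square algebra_simps)
    finally have "v (t (Suc (Suc n)) - t (Suc n)) = v (- ((t (Suc n) - t n) * (t (Suc n) + t n)))"
      by (simp only: v_half)
    then have "v (t (Suc (Suc n)) - t (Suc n)) = v (t (Suc n) - t n) + v (t (Suc n) + t n)"
      by (simp only: v_minus v_mult)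
    moreover have "ereal (real (Suc n)) + 1 \<le> v (t (Suc n) - t n) + v (t (Suc n) + t n)"
      by (intro add_mono Suc v_addI t1)
    ultimately show ?case by (simp add: one_ereal_def algebra_simps)
  qed
  have tail: "ereal (real M) \<le> v (t (M + k) - t M)" for M k
  proof (induction k)
    case (Suc k)
    have *: "ereal (real M) \<le> v (t (Suc (M + k)) - t (M + k))"
      by (rule order_trans[OF _ step]) simp
    have "t (M + Suc k) - t M = (t (Suc (M + k)) - t (M + k)) + (t (M + k) - t M)" by simp
    then show ?case using v_addI[OF * Suc] by (simp only:)
  qed (simp add: v_zero)
  have tail': "ereal (real M) \<le> v (t i - t M)" if "M \<le> i" for i M
    using tail[of M "i - M"] that by simp
  have "\<forall>N::nat. \<exists>M. \<forall>i\<ge>M. \<forall>j\<ge>M. ereal (real N) \<le> v (t i - t j)"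
  proof (intro allI exI impI)
    fix N i j :: nat assume "N \<le> i" "N \<le> j"
    then have "ereal (real N) \<le> v ((t i - t N) - (t j - t N))" by (intro v_diffI tail')
    then show "ereal (real N) \<le> v (t i - t j)" by simp
  qed
  then obtain l where l: "\<forall>N::nat. \<exists>M. \<forall>i\<ge>M. ereal (real N) \<le> v (t i - l)"
    using complete by blast
  \<comment> \<open>The fixed-point equation for \<open>l\<close>, equivalent to
    \<open>(1 + l)\<^sup>2 = 1 + z\<close>.\<close>
  have "2 * l + l\<^sup>2 - z = 0"
  proof (rule eq_zero_if_v_ge)
    fix N :: nat
    obtain M where M: "\<And>i. i \<ge> M \<Longrightarrow> ereal (real N) \<le> v (t i - l)" using l by blast
    obtain M' where M': "\<And>i. i \<ge> M' \<Longrightarrow> ereal (real 1) \<le> v (t i - l)" using l by blast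
    define i where "i = M + M'"
    have "1 \<le> v (t i - l)"
      using M'[of i] by (simp add: i_def one_ereal_def)
    then have "1 \<le> v (t i - (t i - l))" by (rule v_diffI[OF t1])
    then have "1 \<le> v (l + t i)" using t1[of i] by (simp add: v_addI)
    then have nonneg: "0 \<le> v (l + t i)" by (rule order_trans[rotated]) simp
    have "2 * t (Suc i) = z - (t i)\<^sup>2" by (simp add: tS two0)
    then have eq: "2 * l + l\<^sup>2 - z = - (2 * (t (Suc i) - l)) - (t i - l) * (l + t i)"
      by (simp add: algebra_simps power2_eq_square)
    have "ereal (real N) \<le> v (t (Suc i) - l)" "ereal (real N) \<le> v (t i - l)"
      by (rule M, simp add: i_def)+
    then have "ereal (real N) \<le> v (- (2 * (t (Suc i) - l)))"
      "ereal (real N) \<le> v ((t i - l) * (l + t i))"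
      using add_mono[OF _ nonneg, of "ereal (real N)" "v (t i - l)"]
      by (simp_all only: v_minus v_mult two add_0 add_0_right)
    then show "ereal (real N) \<le> v (2 * l + l\<^sup>2 - z)"
      unfolding eq by (rule v_diffI)
  qed
  then have "(1 + l)\<^sup>2 = 1 + z" by (simp add: power2_eq_square algebra_simps)
  then show ?thesis by blast
qed

end

lemma ereal_double_le: "a + a \<le> b + b \<Longrightarrow> a \<le> b" for a b :: ereal
  by (cases a; cases b) auto

lemma ereal_double_eq: "a + a = b + b \<Longrightarrow> a = b" for a b :: ereal
  by (cases a; cases b) auto

lemma ereal_add_right_cancel_le: "a + c \<le> b + c \<Longrightarrow> \<bar>c\<bar> \<noteq> \<infinity> \<Longrightarrow> a \<le> b" for a b c :: ereal
  by (cases a; cases b; cases c) auto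

lemma ereal_half_double: "a / 2 + a / 2 = a" for a :: ereal
  by (cases a) auto

text \<open>Describing the infimum by its lower bounds removes subtraction of extended reals.
  Finiteness on nonzero vectors is what permits moving \<open>\<alpha> x\<close> across the
  inequality.\<close>

lemma self_dual_iff:
  assumes "\<And>x. x \<in> X \<Longrightarrow> x \<noteq> 0 \<Longrightarrow> \<bar>\<alpha> x\<bar> \<noteq> \<infinity>"
  shows "self_dual w B X \<alpha> \<longleftrightarrow>
    (\<forall>u\<in>X. \<forall>c. c \<le> \<alpha> u \<longleftrightarrow> (\<forall>x\<in>X. x \<noteq> 0 \<longrightarrow> c + \<alpha> x \<le> w (B u x)))"
proof -
  have "c \<le> (INF x\<in>X - {0}. w (B u x) - \<alpha> x) \<longleftrightarrow> (\<forall>x\<in>X. x \<noteq> 0 \<longrightarrow> c + \<alpha> x \<le> w (B u x))" for u c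
    using assms by (auto simp: le_INF_iff ereal_le_minus)
  moreover have "a = b \<longleftrightarrow> (\<forall>c. c \<le> a \<longleftrightarrow> c \<le> b)" for a b :: ereal
    by (auto intro: antisym)
  ultimately show ?thesis unfolding self_dual_def by simp
qed

section \<open>Norms, duality, and half the valuation of \<open>Q\<close>\<close>

locale valued_quaternion_subalgebra = quaternion_subalgebra scale mul one Q V0 W + nonarch_local_field v
  for scale :: "'f::field \<Rightarrow> 'v::ab_group_add \<Rightarrow> 'v" and mul one Q V0 W and v :: "'f \<Rightarrow> ereal" +
  assumes v_two: "v 2 = 0"
begin

abbreviation norm :: "'v set \<Rightarrow> ('v \<Rightarrow> ereal) \<Rightarrow> bool" where
  "norm \<equiv> norm_on UNIV v scale"

definition half_norm :: "'v \<Rightarrow> ereal" where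
  "half_norm x = v (Q x) / 2"

lemma v_2_mult: "v (2 * x) = v x"
  by (simp add: v_mult v_two)

lemma norm_ultrametric: "norm X \<alpha> \<Longrightarrow> x \<in> X \<Longrightarrow> y \<in> X \<Longrightarrow> c \<le> \<alpha> x \<Longrightarrow> c \<le> \<alpha> y \<Longrightarrow> c \<le> \<alpha> (x + y)"
  unfolding norm_on_def by (meson min.bounded_iff order_trans)

lemma norm_scale: "norm X \<alpha> \<Longrightarrow> x \<in> X \<Longrightarrow> \<alpha> (scale c x) = v c + \<alpha> x"
  unfolding norm_on_def by simp

lemma norm_minus: "norm X \<alpha> \<Longrightarrow> x \<in> X \<Longrightarrow> \<alpha> (- x) = \<alpha> x"
  using norm_scale[of X \<alpha> x "- 1"] by (simp add: v_minus v_one)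

lemma norm_zero: "norm X \<alpha> \<Longrightarrow> 0 \<in> X \<Longrightarrow> \<alpha> 0 = \<infinity>"
  unfolding norm_on_def by simp

lemma norm_rational: "norm X \<alpha> \<Longrightarrow> x \<in> X \<Longrightarrow> x \<noteq> 0 \<Longrightarrow> \<exists>r\<in>\<rat>. \<alpha> x = ereal r"
  unfolding norm_on_def by blast

lemma norm_finite: "norm X \<alpha> \<Longrightarrow> x \<in> X \<Longrightarrow> x \<noteq> 0 \<Longrightarrow> \<bar>\<alpha> x\<bar> \<noteq> \<infinity>"
  using norm_rational by fastforce

lemma self_dual_norm_iff:
  "self_dual_norm v scale Q X \<alpha> \<longleftrightarrow> norm X \<alpha> \<and>
    (\<forall>u\<in>X. \<forall>c. c \<le> \<alpha> u \<longleftrightarrow> (\<forall>x\<in>X. x \<noteq> 0 \<longrightarrow> c + \<alpha> x \<le> v (form u x)))"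
proof (cases "norm X \<alpha>")
  case True
  then show ?thesis
    unfolding self_dual_norm_def by (simp add: self_dual_iff[of X \<alpha>, OF norm_finite[OF True]])
qed (simp add: self_dual_norm_def)

lemma self_dual_norm_le:
  assumes "self_dual_norm v scale Q X \<alpha>" "u \<in> X" "x \<in> X"
  shows "\<alpha> u + \<alpha> x \<le> v (form u x)"
proof (cases "x = 0")
  case True then show ?thesis by (simp add: form_zero_right v_zero)
next
  case False then show ?thesis using assms unfolding self_dual_norm_iff by blast
qed

lemma self_dual_norm_ge:
  assumes "self_dual_norm v scale Q X \<alpha>" "u \<in> X" "\<And>x. x \<in> X \<Longrightarrow> x \<noteq> 0 \<Longrightarrow> c + \<alpha> x \<le> v (form u x)"
  shows "c \<le> \<alpha> u"
  using assms unfolding self_dual_norm_iff by blast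

lemma half_norm_double: "half_norm x + half_norm x = v (Q x)"
  unfolding half_norm_def by (rule ereal_half_double)

lemma half_norm_eqI: "c + c = v (Q x) \<Longrightarrow> half_norm x = c"
  by (rule ereal_double_eq) (simp add: half_norm_double)

lemma half_norm_mul: "half_norm (x \<odot> y) = half_norm x + half_norm y"
  by (rule half_norm_eqI) (simp add: Q_mul v_mult half_norm_double[symmetric] add_ac)

lemma half_norm_scale: "half_norm (scale c x) = v c + half_norm x"
  by (rule half_norm_eqI) (simp add: Q_scale v_mult power2_eq_square half_norm_double[symmetric] add_ac)

lemma half_norm_minus: "half_norm (- x) = half_norm x"
  by (simp add: half_norm_def Q_minus)

lemma half_norm_finite: "Q x \<noteq> 0 \<Longrightarrow> \<bar>half_norm x\<bar> \<noteq> \<infinity>"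
  using v_int[of "Q x"] by (auto simp: half_norm_def)

text \<open>Otherwise Hensel's lemma would provide a root of \<open>Q (t x + y)\<close>, a quadratic polynomial in \<open>t\<close>.\<close>

lemma anisotropic_half_norm_le:
  assumes X: "subspace X" "anisotropic_on Q X" and x: "x \<in> X" and y: "y \<in> X"
  shows "half_norm x + half_norm y \<le> v (form x y)"
proof (rule ccontr)
  assume "\<not> ?thesis"
  then have less: "v (form x y) < half_norm x + half_norm y" by simp
  let ?a = "Q x" and ?b = "form x y" and ?c = "Q y"
  have b: "?b \<noteq> 0" using less by (auto simp: v_zero)
  then have "x \<noteq> 0" by (auto simp: form_zero_left)
  then have a: "?a \<noteq> 0" using X(2) x by (auto simp: anisotropic_on_def)
  \<comment> \<open>The discriminant of \<open>Q (scale t x + y)\<close> as a polynomial in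
    \<open>t\<close> is \<open>?b\<^sup>2 * (1 + z)\<close>, so it is a square as soon as
    \<open>z\<close> has positive valuation.\<close>
  define z where "z = - (4 * ?a * ?c / ?b\<^sup>2)"
  have v4: "v 4 = 0" using v_mult[of 2 2] v_two by simp
  have "v z + (v ?b + v ?b) = v ?a + v ?c"
    using v_mult[of "4 * ?a * ?c / ?b\<^sup>2" "?b\<^sup>2"] b
    by (simp add: z_def v_minus v_mult v4 power2_eq_square)
  then have "v ?b + v ?b < v z + (v ?b + v ?b)"
    using ereal_add_strict_mono2[OF less less] by (simp add: half_norm_double[symmetric] add_ac)
  moreover obtain n where "v ?b = ereal (of_int n)" using v_int[OF b] by blast
  ultimately have "0 < v z" by (cases "v z") auto
  then obtain s where s: "s\<^sup>2 = 1 + z" using hensel_sqrt v_two by blast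
  define t where "t = ?b * (s - 1) / (2 * ?a)"
  have t2: "2 * ?a * t = ?b * (s - 1)" using a two_nonzero by (simp add: t_def)
  have "4 * ?a * (?a * t\<^sup>2 + ?b * t + ?c) = (2 * ?a * t)\<^sup>2 + 2 * ?b * (2 * ?a * t) + 4 * ?a * ?c"
    by (simp add: power2_eq_square algebra_simps)
  also have "\<dots> = ?b\<^sup>2 * (s\<^sup>2 - 1) + 4 * ?a * ?c"
    unfolding t2 by (simp add: power2_eq_square algebra_simps)
  also have "\<dots> = 0" using b by (simp add: s z_def)
  finally have "?a * t\<^sup>2 + ?b * t + ?c = 0" using a v4 v_zero by force
  moreover have "Q (scale t x + y) = ?a * t\<^sup>2 + ?b * t + ?c"
    unfolding Q_add Q_scale form_scale_left by (simp add: add_ac mult_ac)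
  ultimately have "Q (scale t x + y) = 0" by simp
  moreover have "scale t x + y \<in> X" using X(1) x y by (intro subspace_add subspace_scale)
  ultimately have "scale t x + y = 0" using X(2) by (auto simp: anisotropic_on_def)
  then have "y = scale (- t) x" by (simp add: eq_neg_iff_add_eq_0 add.commute)
  \<comment> \<open>For proportional vectors the claimed inequality is an equality, against the
    assumption.\<close>
  then have "v ?b = half_norm x + half_norm y"
    by (simp add: form_minus_right form_scale_right form_self half_norm_minus half_norm_scale v_mult
        v_two v_minus half_norm_double[symmetric] add_ac)
  then show False using less by simp
qed

text \<open>The ultrametric inequality is proved in doubled form, where \<open>Q (x + y)\<close> can
  be expanded; its cross term is bounded by \<open>anisotropic_half_norm_le\<close>.\<close>

lemma half_norm_norm:
  assumes X: "subspace X" "anisotropic_on Q X"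
  shows "norm X half_norm"
  unfolding norm_on_def
proof (intro conjI ballI)
  fix x assume x: "x \<in> X"
  show "half_norm x \<in> insert \<infinity> (ereal ` \<rat>)"
  proof (cases "Q x = 0")
    case False
    then obtain n where "v (Q x) = ereal (of_int n)" using v_int by blast
    then have "half_norm x = ereal (of_int n / 2)" by (simp add: half_norm_def)
    then show ?thesis by (auto intro!: imageI Rats_divide)
  qed (simp add: half_norm_def v_zero)
  show "(half_norm x = \<infinity>) = (x = 0)"
    using X(2) x half_norm_finite[of x] by (auto simp: half_norm_def Q_zero v_zero anisotropic_on_def)
  show "half_norm (scale c x) = v c + half_norm x" for c by (rule half_norm_scale)
  fix y assume y: "y \<in> X"
  let ?m = "min (half_norm x) (half_norm y)"
  have "?m + ?m \<le> v (Q x + Q y + form x y)"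
  proof (intro v_addI)
    show "?m + ?m \<le> v (Q x)" unfolding half_norm_double[symmetric] by (intro add_mono) simp_all
    show "?m + ?m \<le> v (Q y)" unfolding half_norm_double[symmetric] by (intro add_mono) simp_all
    have "?m + ?m \<le> half_norm x + half_norm y" by (intro add_mono) simp_all
    also have "\<dots> \<le> v (form x y)" by (rule anisotropic_half_norm_le[OF X x y])
    finally show "?m + ?m \<le> v (form x y)" .
  qed
  then show "?m \<le> half_norm (x + y)"
    unfolding Q_add[symmetric] half_norm_double[symmetric] by (rule ereal_double_le)
qed

text \<open>One direction is \<open>anisotropic_half_norm_le\<close>. For the other,
  \<open>u\<close> itself is the extremal test vector, because
  \<open>form u u = 2 * Q u\<close>.\<close>

lemma half_norm_self_dual:
  assumes X: "subspace X" "anisotropic_on Q X"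
  shows "self_dual_norm v scale Q X half_norm"
  unfolding self_dual_norm_iff
proof (intro conjI ballI allI iffI impI half_norm_norm X)
  fix u c x assume ux: "u \<in> X" "x \<in> X" and "c \<le> half_norm u"
  then have "c + half_norm x \<le> half_norm u + half_norm x" by (intro add_right_mono)
  also have "\<dots> \<le> v (form u x)" by (rule anisotropic_half_norm_le[OF X ux])
  finally show "c + half_norm x \<le> v (form u x)" .
next
  fix u c assume u: "u \<in> X" and c: "\<forall>x\<in>X. x \<noteq> 0 \<longrightarrow> c + half_norm x \<le> v (form u x)"
  show "c \<le> half_norm u"
  proof (cases "u = 0")
    case False
    then have "c + half_norm u \<le> half_norm u + half_norm u"
      using c u by (auto simp: form_self v_2_mult half_norm_double)
    moreover have "Q u \<noteq> 0" using X(2) u False by (auto simp: anisotropic_on_def)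
    ultimately show ?thesis by (rule ereal_add_right_cancel_le[OF _ half_norm_finite])
  qed (simp add: half_norm_def Q_zero v_zero)
qed

text \<open>The duality inequality with both arguments equal to \<open>x\<close>.\<close>

lemma self_dual_norm_le_half_norm:
  assumes "self_dual_norm v scale Q X \<beta>" "x \<in> X"
  shows "\<beta> x \<le> half_norm x"
  by (rule ereal_double_le)
    (simp only: half_norm_double self_dual_norm_le[OF assms(1,2,2), unfolded form_self v_2_mult])

lemma self_dual_norm_unique:
  assumes \<alpha>: "self_dual_norm v scale Q X \<alpha>" and \<beta>: "self_dual_norm v scale Q X \<beta>"
    and le: "\<And>x. x \<in> X \<Longrightarrow> \<beta> x \<le> \<alpha> x" and x: "x \<in> X"
  shows "\<beta> x = \<alpha> x"
proof (rule antisym)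
  show "\<alpha> x \<le> \<beta> x"
  proof (rule self_dual_norm_ge[OF \<beta> x])
    fix y assume y: "y \<in> X" "y \<noteq> 0"
    have "\<alpha> x + \<beta> y \<le> \<alpha> x + \<alpha> y" using le y by (intro add_left_mono)
    also have "\<dots> \<le> v (form x y)" by (rule self_dual_norm_le[OF \<alpha> x y(1)])
    finally show "\<alpha> x + \<beta> y \<le> v (form x y)" .
  qed
qed (rule le[OF x])

lemma half_norm_unique:
  assumes "self_dual_norm v scale Q X half_norm" "self_dual_norm v scale Q X \<beta>" "x \<in> X"
  shows "\<beta> x = half_norm x"
  by (rule self_dual_norm_unique[OF assms(1,2) self_dual_norm_le_half_norm[OF assms(2)] assms(3)])

text \<open>Multiplying an isotropic \<open>x\<close> of \<open>W\<close> by an anisotropic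
  \<open>a\<close> of \<open>W\<close> gives an isotropic element of \<open>V0\<close>, hence 0, and
  \<open>a\<close> can be cancelled.\<close>

lemma anisotropic_W:
  assumes "anisotropic_on Q V0"
  shows "anisotropic_on Q W"
  unfolding anisotropic_on_def
proof (intro ballI impI)
  fix x assume x: "x \<in> W" "Q x = 0"
  obtain a where a: "a \<in> W" "Q a \<noteq> 0" by (rule anisotropic_vector_W)
  have "x \<odot> a \<in> V0" "Q (x \<odot> a) = 0" using x a W_mul_W by (auto simp: Q_mul)
  then have "x \<odot> a = 0" using assms by (auto simp: anisotropic_on_def)
  then have "scale (Q a) x = 0" using mul_conj_cancel_right[of x a] by (simp add: mul_zero_left)
  then show "x = 0" using a by simp
qed

lemma direct_sum_unique:
  assumes X: "subspace X1" "subspace X2" "X1 \<inter> X2 = {0}"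
    and eq: "x1 + x2 = y1 + y2" and x: "x1 \<in> X1" "x2 \<in> X2" and y: "y1 \<in> X1" "y2 \<in> X2"
  shows "x1 = y1 \<and> x2 = y2"
proof -
  have d: "x1 - y1 = y2 - x2" using eq by (simp add: algebra_simps)
  have "x1 - y1 \<in> X1" using X x y by (intro subspace_diff)
  moreover have "x1 - y1 \<in> X2" unfolding d using X x y by (intro subspace_diff)
  ultimately have "x1 - y1 = 0" using X(3) by blast
  then show ?thesis using eq by simp
qed

lemma wedge_eq:
  assumes X: "subspace X1" "subspace X2" "X1 \<inter> X2 = {0}" and x: "x1 \<in> X1" "x2 \<in> X2"
  shows "wedge X1 X2 \<alpha>1 \<alpha>2 (x1 + x2) = min (\<alpha>1 x1) (\<alpha>2 x2)"
  unfolding wedge_def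
proof (rule the_equality)
  show "\<exists>y1\<in>X1. \<exists>y2\<in>X2. x1 + x2 = y1 + y2 \<and> min (\<alpha>1 x1) (\<alpha>2 x2) = min (\<alpha>1 y1) (\<alpha>2 y2)"
    using x by blast
  fix r assume "\<exists>y1\<in>X1. \<exists>y2\<in>X2. x1 + x2 = y1 + y2 \<and> r = min (\<alpha>1 y1) (\<alpha>2 y2)"
  then obtain y1 y2 where "y1 \<in> X1" "y2 \<in> X2" "x1 + x2 = y1 + y2" "r = min (\<alpha>1 y1) (\<alpha>2 y2)"
    by blast
  then show "r = min (\<alpha>1 x1) (\<alpha>2 x2)" using direct_sum_unique[OF X] x by blast
qed

text \<open>An orthogonal component \<open>y\<close> of \<open>x\<close> satisfies
  \<open>form x y = form y y\<close>, so \<open>anisotropic_half_norm_le\<close> shows that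
  projecting cannot lower \<open>half_norm\<close>. The reverse bound is the ultrametric
  inequality.\<close>

lemma split_by_subspace:
  assumes X: "subspace X" "anisotropic_on Q X" and L: "subspace L" "L \<subseteq> X"
  shows "split_by X L (orthogonal_in Q X L) half_norm"
proof -
  let ?M = "orthogonal_in Q X L"
  have aniso: "anisotropic_on Q L" using X(2) L(2) by (auto simp: anisotropic_on_def)
  have M: "subspace ?M"
    using X(1) by (intro subspaceI)
      (auto simp: orthogonal_in_def form_simps subspace_0 subspace_add subspace_scale)
  have inter: "L \<inter> ?M = {0}"
  proof -
    have "x = 0" if "x \<in> L" "x \<in> ?M" for x
    proof -
      have "2 * Q x = 0" using that unfolding form_self[symmetric] by (auto simp: orthogonal_in_def)
      then show ?thesis using aniso that(1) two_nonzero by (auto simp: anisotropic_on_def)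
    qed
    then show ?thesis using subspace_0[OF L(1)] subspace_0[OF M] by blast
  qed
  have "nondegenerate_on Q L"
    unfolding nondegenerate_on_def using aniso two_nonzero form_self by (auto simp: anisotropic_on_def)
  then obtain E where E: "finite E" "orthogonal_set E" "span E = L"
    using orthogonal_basis_exists[OF L(1)] by metis
  have decomp: "proj E x \<in> L" "x - proj E x \<in> ?M" if "x \<in> X" for x
  proof -
    show 1: "proj E x \<in> L" using proj_in_span E(3) by auto
    show "x - proj E x \<in> ?M"
      unfolding orthogonal_in_def using X(1) L(2) 1 that form_minus_proj[OF E(2,1)] E(3)
      by (auto intro: subspace_diff)
  qed
  have "direct_sum_decomp X L ?M"
    unfolding direct_sum_decomp_def
  proof (intro conjI inter subset_antisym subsetI)
    fix x assume "x \<in> X"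
    moreover have "x = proj E x + (x - proj E x)" by simp
    ultimately show "x \<in> {x1 + x2 |x1 x2. x1 \<in> L \<and> x2 \<in> ?M}" using decomp by blast
  next
    fix x assume "x \<in> {x1 + x2 |x1 x2. x1 \<in> L \<and> x2 \<in> ?M}"
    then show "x \<in> X" using L(2) X(1) by (auto simp: orthogonal_in_def intro!: subspace_add)
  qed
  moreover have "half_norm x = wedge L ?M half_norm half_norm x" if x: "x \<in> X" for x
  proof -
    define l m where "l = proj E x" and "m = x - l"
    have lm: "l \<in> L" "m \<in> ?M" "x = l + m" using decomp[OF x] by (auto simp: l_def m_def)
    then have X': "l \<in> X" "m \<in> X" using L(2) by (auto simp: orthogonal_in_def)
    have orth: "form l m = 0" "form m l = 0" using lm by (auto simp: orthogonal_in_def form_commute)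
    have component: "half_norm x \<le> half_norm y" if y: "y \<in> X" "form x y = form y y" for y
    proof (cases "y = 0")
      case False
      have "half_norm x + half_norm y \<le> half_norm y + half_norm y"
        using anisotropic_half_norm_le[OF X x y(1)] y(2) by (simp add: form_self v_2_mult half_norm_double)
      moreover have "Q y \<noteq> 0" using X(2) y False by (auto simp: anisotropic_on_def)
      ultimately show ?thesis by (rule ereal_add_right_cancel_le[OF _ half_norm_finite])
    qed (simp add: half_norm_def Q_zero v_zero)
    have "half_norm x = min (half_norm l) (half_norm m)"
    proof (rule antisym)
      show "half_norm x \<le> min (half_norm l) (half_norm m)"
        unfolding min.bounded_iff
        by (intro conjI component X') (simp_all add: lm(3) form_add_left orth)
      show "min (half_norm l) (half_norm m) \<le> half_norm x"
        unfolding lm(3) by (rule norm_ultrametric[OF half_norm_norm[OF X] X']) simp_all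
    qed
    then show ?thesis unfolding lm(3) wedge_eq[OF L(1) M inter lm(1,2)] .
  qed
  ultimately show ?thesis by (simp add: split_by_def)
qed

section \<open>Gluing norms of \<open>V0\<close> and \<open>W\<close>\<close>

lemma wedge_V0_W:
  "x \<in> V0 \<Longrightarrow> w \<in> W \<Longrightarrow> wedge V0 W \<alpha>0 \<alpha>W (x + w) = min (\<alpha>0 x) (\<alpha>W w)"
  by (rule wedge_eq[OF V0_subspace W_subspace V0_inter_W])

lemma wedge_norm:
  assumes \<alpha>0: "norm V0 \<alpha>0" and \<alpha>W: "norm W \<alpha>W"
  shows "norm UNIV (wedge V0 W \<alpha>0 \<alpha>W)"
  unfolding norm_on_def
proof (intro conjI ballI)
  let ?\<alpha> = "wedge V0 W \<alpha>0 \<alpha>W"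
  fix z
  obtain x w where z: "z = x + w" "x \<in> V0" "w \<in> W" by (rule decompose)
  have \<alpha>z: "?\<alpha> z = min (\<alpha>0 x) (\<alpha>W w)" unfolding z(1) using z by (intro wedge_V0_W)
  have "\<alpha>0 x \<in> insert \<infinity> (ereal ` \<rat>)" "\<alpha>W w \<in> insert \<infinity> (ereal ` \<rat>)"
    using \<alpha>0 \<alpha>W z unfolding norm_on_def by blast+
  then show "?\<alpha> z \<in> insert \<infinity> (ereal ` \<rat>)" unfolding \<alpha>z min_def by (cases "\<alpha>0 x \<le> \<alpha>W w") simp_all
  have "x + w = 0 \<longleftrightarrow> x = 0 \<and> w = 0"
    using direct_sum_unique[OF V0_subspace W_subspace V0_inter_W, of x w 0 0] z
      subspace_0[OF V0_subspace] subspace_0[OF W_subspace] by auto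
  moreover have "\<alpha>0 x = \<infinity> \<longleftrightarrow> x = 0" "\<alpha>W w = \<infinity> \<longleftrightarrow> w = 0"
    using \<alpha>0 \<alpha>W z unfolding norm_on_def by blast+
  moreover have "min a b = \<infinity> \<longleftrightarrow> a = \<infinity> \<and> b = \<infinity>" for a b :: ereal
    by (auto simp: min_def)
  ultimately have "?\<alpha> z = \<infinity> \<longleftrightarrow> x + w = 0" unfolding \<alpha>z by simp
  then show "?\<alpha> z = \<infinity> \<longleftrightarrow> z = 0" by (simp only: z(1))
  show "?\<alpha> (scale c z) = v c + ?\<alpha> z" for c
  proof -
    have "scale c z = scale c x + scale c w" by (simp add: z(1) scale_right_distrib)
    then have "?\<alpha> (scale c z) = min (\<alpha>0 (scale c x)) (\<alpha>W (scale c w))"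
      using wedge_V0_W[OF subspace_scale[OF V0_subspace z(2)] subspace_scale[OF W_subspace z(3)]] by simp
    also have "\<dots> = min (v c + \<alpha>0 x) (v c + \<alpha>W w)"
      using norm_scale[OF \<alpha>0 z(2)] norm_scale[OF \<alpha>W z(3)] by simp
    also have "\<dots> = v c + ?\<alpha> z" unfolding \<alpha>z
      by (cases "\<alpha>0 x \<le> \<alpha>W w") (simp_all add: min_absorb1 min_absorb2 add_left_mono)
    finally show ?thesis .
  qed
  fix z'
  obtain x' w' where z': "z' = x' + w'" "x' \<in> V0" "w' \<in> W" by (rule decompose)
  have \<alpha>z': "?\<alpha> z' = min (\<alpha>0 x') (\<alpha>W w')" unfolding z'(1) using z' by (intro wedge_V0_W)
  have "z + z' = (x + x') + (w + w')" by (simp add: z(1) z'(1) algebra_simps)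
  then have "?\<alpha> (z + z') = min (\<alpha>0 (x + x')) (\<alpha>W (w + w'))"
    using wedge_V0_W[OF subspace_add[OF V0_subspace z(2) z'(2)] subspace_add[OF W_subspace z(3) z'(3)]]
    by simp
  moreover have "min (?\<alpha> z) (?\<alpha> z') \<le> \<alpha>0 (x + x')"
    by (rule norm_ultrametric[OF \<alpha>0 z(2) z'(2)]) (simp_all add: \<alpha>z \<alpha>z' min.coboundedI1 min.coboundedI2)
  moreover have "min (?\<alpha> z) (?\<alpha> z') \<le> \<alpha>W (w + w')"
    by (rule norm_ultrametric[OF \<alpha>W z(3) z'(3)]) (simp_all add: \<alpha>z \<alpha>z' min.coboundedI1 min.coboundedI2)
  ultimately show "min (?\<alpha> z) (?\<alpha> z') \<le> ?\<alpha> (z + z')" by simp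
qed

text \<open>The sum is orthogonal, so \<open>form\<close> splits into its two parts; testing against
  vectors of a single summand recovers the bound on each component.\<close>

lemma wedge_self_dual:
  assumes \<alpha>0: "self_dual_norm v scale Q V0 \<alpha>0" and \<alpha>W: "self_dual_norm v scale Q W \<alpha>W"
  shows "self_dual_norm v scale Q UNIV (wedge V0 W \<alpha>0 \<alpha>W)"
  unfolding self_dual_norm_iff
proof (intro conjI ballI allI iffI impI)
  have n0: "norm V0 \<alpha>0" and nW: "norm W \<alpha>W"
    using \<alpha>0 \<alpha>W by (simp_all add: self_dual_norm_iff)
  then show "norm UNIV (wedge V0 W \<alpha>0 \<alpha>W)" by (rule wedge_norm)
  let ?\<alpha> = "wedge V0 W \<alpha>0 \<alpha>W"
  have zeros: "0 \<in> V0" "0 \<in> W" using subspace_0 V0_subspace W_subspace by auto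
  fix z c
  obtain x w where z: "z = x + w" "x \<in> V0" "w \<in> W" by (rule decompose)
  have \<alpha>z: "?\<alpha> z = min (\<alpha>0 x) (\<alpha>W w)" unfolding z(1) using z by (intro wedge_V0_W)
  {
    fix z' assume c: "c \<le> ?\<alpha> z"
    obtain x' w' where z': "z' = x' + w'" "x' \<in> V0" "w' \<in> W" by (rule decompose)
    have \<alpha>z': "?\<alpha> z' = min (\<alpha>0 x') (\<alpha>W w')" unfolding z'(1) using z' by (intro wedge_V0_W)
    have "c + ?\<alpha> z' \<le> \<alpha>0 x + \<alpha>0 x'" "c + ?\<alpha> z' \<le> \<alpha>W w + \<alpha>W w'"
      using c unfolding \<alpha>z \<alpha>z' by (auto intro!: add_mono)
    then have "c + ?\<alpha> z' \<le> v (form x x')" "c + ?\<alpha> z' \<le> v (form w w')"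
      using self_dual_norm_le[OF \<alpha>0 z(2) z'(2)] self_dual_norm_le[OF \<alpha>W z(3) z'(3)] by (auto intro: order_trans)
    moreover have "form z z' = form x x' + form w w'"
      using z z' by (simp add: form_simps form_W_V0 form_V0_W)
    ultimately show "c + ?\<alpha> z' \<le> v (form z z')" by (simp add: v_addI)
  next
    assume c: "\<forall>z'\<in>UNIV. z' \<noteq> 0 \<longrightarrow> c + ?\<alpha> z' \<le> v (form z z')"
    have "c \<le> \<alpha>0 x"
    proof (rule self_dual_norm_ge[OF \<alpha>0 z(2)])
      fix y assume y: "y \<in> V0" "y \<noteq> 0"
      have "?\<alpha> y = \<alpha>0 y" using wedge_V0_W[OF y(1) zeros(2)] norm_zero[OF nW zeros(2)] by simp
      moreover have "form z y = form x y" using z y by (simp add: form_simps form_W_V0)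
      ultimately show "c + \<alpha>0 y \<le> v (form x y)" using c y(2) by (metis UNIV_I)
    qed
    moreover have "c \<le> \<alpha>W w"
    proof (rule self_dual_norm_ge[OF \<alpha>W z(3)])
      fix y assume y: "y \<in> W" "y \<noteq> 0"
      have "?\<alpha> y = \<alpha>W y" using wedge_V0_W[OF zeros(1) y(1)] norm_zero[OF n0 zeros(1)] by simp
      moreover have "form z y = form w y" using z y by (simp add: form_simps form_V0_W)
      ultimately show "c + \<alpha>W y \<le> v (form w y)" using c y(2) by (metis UNIV_I)
    qed
    ultimately show "c \<le> ?\<alpha> z" by (simp add: \<alpha>z)
  }
qed

text \<open>The algebra is graded modulo 2 with even part \<open>V0\<close> and odd part
  \<open>W\<close>, so submultiplicativity has to be checked on four kinds of products.\<close>

lemma wedge_algebra_norm: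
  assumes \<alpha>0: "self_dual_norm v scale Q V0 \<alpha>0" and \<alpha>W: "self_dual_norm v scale Q W \<alpha>W"
    and V0_V0: "\<And>x y. x \<in> V0 \<Longrightarrow> y \<in> V0 \<Longrightarrow> \<alpha>0 x + \<alpha>0 y \<le> \<alpha>0 (x \<odot> y)"
    and V0_W: "\<And>x w. x \<in> V0 \<Longrightarrow> w \<in> W \<Longrightarrow> \<alpha>0 x + \<alpha>W w \<le> \<alpha>W (x \<odot> w)"
    and W_V0: "\<And>x w. x \<in> V0 \<Longrightarrow> w \<in> W \<Longrightarrow> \<alpha>W w + \<alpha>0 x \<le> \<alpha>W (w \<odot> x)"
    and W_W: "\<And>u w. u \<in> W \<Longrightarrow> w \<in> W \<Longrightarrow> \<alpha>W u + \<alpha>W w \<le> \<alpha>0 (u \<odot> w)"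
  shows "self_dual_algebra_norm v scale mul Q UNIV (wedge V0 W \<alpha>0 \<alpha>W)"
  unfolding self_dual_algebra_norm_def
proof (intro conjI ballI wedge_self_dual \<alpha>0 \<alpha>W)
  have n0: "norm V0 \<alpha>0" and nW: "norm W \<alpha>W"
    using \<alpha>0 \<alpha>W by (simp_all add: self_dual_norm_iff)
  let ?\<alpha> = "wedge V0 W \<alpha>0 \<alpha>W"
  fix z z'
  obtain x w where z: "z = x + w" "x \<in> V0" "w \<in> W" by (rule decompose)
  obtain x' w' where z': "z' = x' + w'" "x' \<in> V0" "w' \<in> W" by (rule decompose)
  have \<alpha>z: "?\<alpha> z = min (\<alpha>0 x) (\<alpha>W w)" unfolding z(1) using z by (intro wedge_V0_W)
  have \<alpha>z': "?\<alpha> z' = min (\<alpha>0 x') (\<alpha>W w')" unfolding z'(1) using z' by (intro wedge_V0_W)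
  have zz: "z \<odot> z' = (x \<odot> x' + w \<odot> w') + (x \<odot> w' + w \<odot> x')"
    by (simp add: z(1) z'(1) mul_simps algebra_simps)
  have mem: "x \<odot> x' \<in> V0" "w \<odot> w' \<in> V0" "x \<odot> w' \<in> W" "w \<odot> x' \<in> W"
    using z z' V0_mul W_mul_W V0_mul_W W_mul_V0 by auto
  have "?\<alpha> z + ?\<alpha> z' \<le> \<alpha>0 (x \<odot> x')"
    by (rule order_trans[OF _ V0_V0[OF z(2) z'(2)]]) (auto simp: \<alpha>z \<alpha>z' intro!: add_mono)
  moreover have "?\<alpha> z + ?\<alpha> z' \<le> \<alpha>0 (w \<odot> w')"
    by (rule order_trans[OF _ W_W[OF z(3) z'(3)]]) (auto simp: \<alpha>z \<alpha>z' intro!: add_mono)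
  moreover have "?\<alpha> z + ?\<alpha> z' \<le> \<alpha>W (x \<odot> w')"
    by (rule order_trans[OF _ V0_W[OF z(2) z'(3)]]) (auto simp: \<alpha>z \<alpha>z' intro!: add_mono)
  moreover have "?\<alpha> z + ?\<alpha> z' \<le> \<alpha>W (w \<odot> x')"
    by (rule order_trans[OF _ W_V0[OF z'(2) z(3)]]) (auto simp: \<alpha>z \<alpha>z' intro!: add_mono)
  ultimately have "?\<alpha> z + ?\<alpha> z' \<le> \<alpha>0 (x \<odot> x' + w \<odot> w')" "?\<alpha> z + ?\<alpha> z' \<le> \<alpha>W (x \<odot> w' + w \<odot> x')"
    using norm_ultrametric[OF n0 mem(1,2)] norm_ultrametric[OF nW mem(3,4)] by blast+
  moreover have "?\<alpha> (z \<odot> z') = min (\<alpha>0 (x \<odot> x' + w \<odot> w')) (\<alpha>W (x \<odot> w' + w \<odot> x'))"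
    unfolding zz
    by (rule wedge_V0_W[OF subspace_add[OF V0_subspace mem(1,2)] subspace_add[OF W_subspace mem(3,4)]])
  ultimately show "?\<alpha> z + ?\<alpha> z' \<le> ?\<alpha> (z \<odot> z')" by simp
qed

text \<open>The square of the 4-form is a Gram determinant, each term of which has valuation at least twice the
  left-hand side.\<close>

lemma form_mul_mul_ge:
  assumes \<alpha>: "\<And>x y. x \<in> W \<Longrightarrow> y \<in> W \<Longrightarrow> \<alpha> x + \<alpha> y \<le> v (form x y)"
    and W: "t \<in> W" "u \<in> W" "r \<in> W" "s \<in> W"
  shows "\<alpha> t + \<alpha> u + \<alpha> r + \<alpha> s \<le> v (form (t \<odot> u) (r \<odot> s))"
proof -
  define w where "w = (\<lambda>i::4. if i = 1 then t else if i = 2 then u else if i = 3 then r else s)"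
  have w: "w 1 = t" "w 2 = u" "w 3 = r" "w 4 = s" by (simp_all add: w_def)
  have wW: "w i \<in> W" for i using W by (simp add: w_def)
  define c where "c = (\<Sum>i\<in>UNIV. \<alpha> (w i))"
  have c: "c = \<alpha> t + \<alpha> u + \<alpha> r + \<alpha> s" by (simp add: c_def sum_4 w)
  have "c + c \<le> v (det (\<chi> i j. form (w i) (w j)))"
    unfolding det_def
  proof (rule v_sumI)
    fix p :: "4 \<Rightarrow> 4" assume "p \<in> {p. p permutes UNIV}"
    then have p: "p permutes UNIV" by simp
    \<comment> \<open>In a term of the determinant every index occurs once as a row and once as a
      column, which accounts for the second copy of \<open>c\<close>.\<close>
    have "c + c = (\<Sum>i\<in>UNIV. \<alpha> (w i) + \<alpha> (w (p i)))"
      unfolding sum.distrib c_def using sum.permute[OF p, of "\<lambda>i. \<alpha> (w i)"] by (simp add: o_def)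
    also have "\<dots> \<le> (\<Sum>i\<in>UNIV. v (form (w i) (w (p i))))"
      by (intro sum_mono \<alpha> wW)
    also have "\<dots> = v (\<Prod>i\<in>UNIV. form (w i) (w (p i)))"
      by (simp add: v_prod)
    also have "\<dots> \<le> v (of_int (sign p)) + v (\<Prod>i\<in>UNIV. form (w i) (w (p i)))"
      using add_right_mono[OF v_of_int_nonneg[of "sign p"]] by simp
    finally show "c + c \<le> v (of_int (sign p) * (\<Prod>i\<in>UNIV. (\<chi> i j. form (w i) (w j)) $ i $ p i))"
      by (simp add: v_mult)
  qed
  then have "c + c \<le> v (volume t u r s) + v (volume t u r s)"
    using volume_square[of w, OF wW] by (simp add: w power2_eq_square v_mult[symmetric])
  then have vol: "c \<le> v (volume t u r s)" by (rule ereal_double_le)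
  \<comment> \<open>Each product in the correction term of \<open>volume\<close> pairs off the four
    vectors, so the hypothesis applies to both factors.\<close>
  have pairs: "c \<le> v (form t r * form u s)" "c \<le> v (form t u * form r s)" "c \<le> v (form t s * form u r)"
    using add_mono[OF \<alpha>[OF W(1,3)] \<alpha>[OF W(2,4)]] add_mono[OF \<alpha>[OF W(1,2)] \<alpha>[OF W(3,4)]]
      add_mono[OF \<alpha>[OF W(1,4)] \<alpha>[OF W(2,3)]]
    by (simp_all add: c v_mult add_ac)
  have "2 * form (t \<odot> u) (r \<odot> s) =
      volume t u r s + (form t r * form u s + form t u * form r s - form t s * form u r)"
    by (simp add: volume_def)
  then have "c \<le> v (2 * form (t \<odot> u) (r \<odot> s))"
    using vol pairs by (simp only: v_addI v_diffI)
  then show ?thesis by (simp add: v_2_mult c)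
qed

section \<open>Discreteness of the values of a norm\<close>

lemma norm_sum_greater:
  assumes \<alpha>: "norm X \<alpha>" and X: "subspace X" and c: "c < \<infinity>"
    and g: "\<And>i. i \<in> S \<Longrightarrow> g i \<in> X \<and> c < \<alpha> (g i)"
  shows "c < \<alpha> (sum g S)"
  using g
proof (induction S rule: infinite_finite_induct)
  case (insert i S)
  then have "g i \<in> X" "c < \<alpha> (g i)" "sum g S \<in> X" "c < \<alpha> (sum g S)"
    using X by (auto intro: subspace_sum)
  then have "min (\<alpha> (g i)) (\<alpha> (sum g S)) \<le> \<alpha> (g i + sum g S)" "c < min (\<alpha> (g i)) (\<alpha> (sum g S))"
    using norm_ultrametric[OF \<alpha>, of "g i" "sum g S" "min (\<alpha> (g i)) (\<alpha> (sum g S))"] by simp_all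
  then have "c < \<alpha> (g i + sum g S)" by (rule less_le_trans[rotated])
  then show ?case using insert(1,2) by simp
qed (use c norm_zero[OF \<alpha> subspace_0[OF X]] in simp_all)

text \<open>Scalars shift values by integers, so the nonzero terms of a linear relation have
  pairwise distinct values. The term of least value then cannot be cancelled by the others.\<close>

lemma independent_of_values_distinct:
  assumes \<alpha>: "norm X \<alpha>" and X: "subspace X" and T: "T \<subseteq> X" "0 \<notin> T"
    and distinct: "\<And>s t k. s \<in> T \<Longrightarrow> t \<in> T \<Longrightarrow> s \<noteq> t \<Longrightarrow> \<alpha> s \<noteq> \<alpha> t + ereal (of_int k)"
  shows "independent T"
  unfolding independent_explicit_module
proof (intro allI impI)
  fix S c e assume S: "finite S" "S \<subseteq> T" "(\<Sum>x\<in>S. scale (c x) x) = 0" "e \<in> S"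
  show "c e = 0"
  proof (rule ccontr)
    assume "c e \<noteq> 0"
    \<comment> \<open>Terms with coefficient 0 have value \<open>\<infinity>\<close> and must be
      dropped before a strict minimum can be sought.\<close>
    define R where "R = {x\<in>S. c x \<noteq> 0}"
    have R: "finite R" "R \<noteq> {}" using S \<open>c e \<noteq> 0\<close> by (auto simp: R_def)
    let ?g = "\<lambda>x. scale (c x) x"
    obtain m where m: "m \<in> R" "\<And>x. x \<in> R \<Longrightarrow> \<alpha> (?g m) \<le> \<alpha> (?g x)"
      using ex_min_if_finite[of "(\<lambda>x. \<alpha> (?g x)) ` R"] R by (auto simp: not_less) 
    have RX: "x \<in> X" "x \<noteq> 0" "c x \<noteq> 0" if "x \<in> R" for x using that S T by (auto simp: R_def)
    have fin: "\<bar>\<alpha> (?g m)\<bar> \<noteq> \<infinity>"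
      using RX[OF m(1)] X by (intro norm_finite[OF \<alpha>] subspace_scale) auto
    have greater: "\<alpha> (?g m) < \<alpha> (?g x)" if x: "x \<in> R - {m}" for x
    proof -
      obtain a where a: "v (c x) = ereal (of_int a)" using v_int RX(3) x by blast
      obtain b where b: "v (c m) = ereal (of_int b)" using v_int RX(3) m by blast
      have mx: "m \<in> T" "x \<in> T" "m \<noteq> x" using m(1) x S(2) by (auto simp: R_def)
      have "\<bar>\<alpha> m\<bar> \<noteq> \<infinity>" "\<bar>\<alpha> x\<bar> \<noteq> \<infinity>"
        using norm_finite[OF \<alpha> RX(1,2)] norm_finite[OF \<alpha> RX(1,2)] m x by auto
      then have "\<alpha> (?g m) \<noteq> \<alpha> (?g x)"
        using distinct[OF mx, of "a - b"] x RX(1)[of x] RX(1)[OF m(1)]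
        by (cases "\<alpha> m"; cases "\<alpha> x") (auto simp: norm_scale[OF \<alpha>] a b)
      then show ?thesis using m(2)[of x] x by auto
    qed
    have "(\<Sum>x\<in>S. ?g x) = (\<Sum>x\<in>R. ?g x)"
      by (rule sum.mono_neutral_right) (use S in \<open>auto simp: R_def\<close>)
    also have "\<dots> = ?g m + (\<Sum>x\<in>R - {m}. ?g x)"
      by (rule sum.remove[OF R(1) m(1)])
    finally have "(\<Sum>x\<in>R - {m}. ?g x) = - ?g m" using S(3) by (simp add: eq_neg_iff_add_eq_0 add.commute)
    moreover have "\<alpha> (?g m) < \<alpha> (\<Sum>x\<in>R - {m}. ?g x)"
      by (rule norm_sum_greater[OF \<alpha> X]) (use fin greater RX X in \<open>auto intro: subspace_scale\<close>)
    ultimately show False using norm_minus[OF \<alpha> subspace_scale[OF X RX(1)[OF m(1)]]] by simp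
  qed
qed

lemma common_denominator:
  assumes "finite R" "R \<subseteq> \<rat>"
  shows "\<exists>N>0. \<forall>r\<in>R. \<exists>k. r = of_int k / (of_int N :: real)"
  using assms
proof (induction R rule: finite_induct)
  case empty
  then show ?case by (intro exI[of _ 1]) simp
next
  case (insert r R)
  then obtain N :: int where N: "N > 0" "\<forall>r\<in>R. \<exists>k. r = of_int k / (of_int N :: real)" by auto
  have "r \<in> \<rat>" using insert by simp
  then obtain a b where ab: "b > 0" "r = of_int a / of_int b"
    by (elim Rats_cases') auto
  have "\<exists>k. s = of_int k / of_int (N * b)" if "s \<in> insert r R" for s
  proof (cases "s = r")
    case True
    then have "s = of_int (a * N) / of_int (N * b)" using ab N by simp
    then show ?thesis by blast
  next
    case False
    then have "s \<in> R" using that by simp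
    then obtain k where "s = of_int k / of_int N" using N(2) by blast
    then have "s = of_int (k * b) / of_int (N * b)" using ab by simp
    then show ?thesis by blast
  qed
  moreover have "N * b > 0" using N ab by simp
  ultimately have "N * b > 0 \<and> (\<forall>s\<in>insert r R. \<exists>k. s = of_int k / of_int (N * b))"
    by (intro conjI ballI)
  then show ?case ..
qed

text \<open>Vectors whose values are pairwise distinct modulo the integers are linearly independent, so there
  are finitely many values modulo the integers.\<close>

lemma norm_values_discrete:
  assumes \<alpha>: "norm X \<alpha>" and X: "subspace X"
  obtains N where "N > 0" "\<And>x. x \<in> X \<Longrightarrow> x \<noteq> 0 \<Longrightarrow> \<exists>k. \<alpha> x = ereal (of_int k / of_int N)"
proof -
  let ?D = "\<lambda>T. T \<subseteq> X \<and> 0 \<notin> T \<and> (\<forall>s\<in>T. \<forall>t\<in>T. s \<noteq> t \<longrightarrow> (\<forall>k. \<alpha> s \<noteq> \<alpha> t + ereal (of_int k)))"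
  let ?P = "\<lambda>n. \<exists>T. ?D T \<and> card T = n"
  have ind: "independent T" if "?D T" for T
    using that by (intro independent_of_values_distinct[OF \<alpha> X]) auto
  have "?P 0" by (intro exI[of _ "{}"]) simp
  moreover have "n \<le> dim X" if "?P n" for n
    using that ind independent_card_le by blast
  ultimately have "\<exists>n. ?P n \<and> (\<forall>m. ?P m \<longrightarrow> m \<le> n)"
    by (intro Nat.ex_has_greatest_nat[of ?P 0 "dim X"]) simp_all
  then obtain n where "?P n \<and> (\<forall>m. ?P m \<longrightarrow> m \<le> n)" ..
  note n = conjunct1[OF this] conjunct2[OF this]
  from n(1) obtain T where T: "?D T" "card T = n" by blast
  have finT: "finite T" using ind[OF T(1)] by (rule independent_finite)
  have near: "\<exists>t\<in>T. \<exists>k. \<alpha> x = \<alpha> t + ereal (of_int k)" if x: "x \<in> X" "x \<noteq> 0" for x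
  proof (rule ccontr)
    assume *: "\<not> ?thesis"
    have "\<alpha> t \<noteq> \<alpha> x + ereal (of_int k)" if t: "t \<in> T" for t k
    proof
      assume "\<alpha> t = \<alpha> x + ereal (of_int k)"
      then have "\<alpha> x = \<alpha> t + ereal (of_int (- k))" by (cases "\<alpha> x") auto
      then show False using * t by blast
    qed
    moreover have "x \<notin> T"
    proof
      assume "x \<in> T"
      moreover have "\<alpha> x = \<alpha> x + ereal (of_int 0)" by simp
      ultimately show False using * by blast
    qed
    ultimately have "?D (insert x T)" "card (insert x T) = Suc n"
      using T x finT * by auto
    then have "?P (Suc n)" by blast
    from n(2)[rule_format, OF this] show False by simp
  qed
  let ?R = "(\<lambda>t. real_of_ereal (\<alpha> t)) ` T"
  have rat: "\<exists>r\<in>\<rat>. \<alpha> t = ereal r" if "t \<in> T" for t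
    using that T(1) norm_rational[OF \<alpha>] by blast
  then have "?R \<subseteq> \<rat>" by fastforce
  then obtain N where N: "N > 0" "\<forall>r\<in>?R. \<exists>k. r = of_int k / (of_int N :: real)"
    using common_denominator[of ?R] finT by blast
  show thesis
  proof (rule that[OF N(1)])
    fix x assume "x \<in> X" "x \<noteq> 0"
    then obtain t k where t: "t \<in> T" "\<alpha> x = \<alpha> t + ereal (of_int k)" using near by blast
    obtain r where r: "\<alpha> t = ereal r" using rat t by blast
    then have "r \<in> ?R" using t by force
    then obtain k' where "r = of_int k' / of_int N" using N by blast
    then have "\<alpha> x = ereal (of_int (k' + k * N) / of_int N)"
      using t r N(1) by (simp add: field_simps)
    then show "\<exists>k. \<alpha> x = ereal (of_int k / of_int N)" by blast
  qed
qed

end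

section \<open>The operator norm on the quaternion subalgebra\<close>

context valued_quaternion_subalgebra
begin

definition op_norm :: "('v \<Rightarrow> ereal) \<Rightarrow> 'v \<Rightarrow> ereal" where
  "op_norm \<alpha> x = (INF w\<in>W - {0}. \<alpha> (x \<odot> w) - \<alpha> w)"

lemma zero_in_W: "0 \<in> W" by (rule subspace_0[OF W_subspace])

text \<open>The vector 0, excluded from the infimum, is harmless here because its value on the right
  is \<open>\<infinity>\<close>.\<close>

lemma le_op_norm_iff:
  assumes "norm W \<alpha>"
  shows "c \<le> op_norm \<alpha> x \<longleftrightarrow> (\<forall>w\<in>W. c + \<alpha> w \<le> \<alpha> (x \<odot> w))"
proof -
  have "c \<le> op_norm \<alpha> x \<longleftrightarrow> (\<forall>w\<in>W - {0}. c + \<alpha> w \<le> \<alpha> (x \<odot> w))"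
    unfolding op_norm_def le_INF_iff using norm_finite[OF assms] by (intro ball_cong) (simp_all add: ereal_le_minus)
  moreover have "c + \<alpha> 0 \<le> \<alpha> (x \<odot> 0)"
    by (simp add: mul_zero_right norm_zero[OF assms zero_in_W])
  ultimately show ?thesis by blast
qed

end

locale self_dual_norm_W = valued_quaternion_subalgebra scale mul one Q V0 W v
  for scale :: "'f::field \<Rightarrow> 'v::ab_group_add \<Rightarrow> 'v" and mul one Q V0 W and v :: "'f \<Rightarrow> ereal" +
  fixes \<alpha> :: "'v \<Rightarrow> ereal"
  assumes \<alpha>: "self_dual_norm v scale Q W \<alpha>"
begin

lemma \<alpha>_norm: "norm W \<alpha>" using \<alpha> by (simp add: self_dual_norm_iff)

abbreviation N :: "'v \<Rightarrow> ereal" where "N \<equiv> op_norm \<alpha>"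

lemma N_geI: "(\<And>w. w \<in> W \<Longrightarrow> c + \<alpha> w \<le> \<alpha> (x \<odot> w)) \<Longrightarrow> c \<le> N x"
  by (simp add: le_op_norm_iff[OF \<alpha>_norm])

lemma N_le: "w \<in> W \<Longrightarrow> N x + \<alpha> w \<le> \<alpha> (x \<odot> w)"
  using le_op_norm_iff[OF \<alpha>_norm, of "N x" x] by simp

text \<open>Left multiplication by \<open>conj x\<close> is the adjoint of that by \<open>x\<close>,
  and by self-duality of \<open>\<alpha>\<close> an operator and its adjoint satisfy the same
  bounds.\<close>

lemma N_conj_ge: assumes x: "x \<in> V0" shows "N x \<le> N (conj x)"
proof (rule N_geI)
  fix w assume w: "w \<in> W"
  show "N x + \<alpha> w \<le> \<alpha> (conj x \<odot> w)"
  proof (rule self_dual_norm_ge[OF \<alpha> V0_mul_W[OF V0_conj[OF x] w]])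
    fix t assume t: "t \<in> W" "t \<noteq> 0"
    have "N x + \<alpha> w + \<alpha> t \<le> \<alpha> w + \<alpha> (x \<odot> t)"
      using add_left_mono[OF N_le[OF t(1), of x], of "\<alpha> w"] by (simp add: add_ac)
    also have "\<dots> \<le> v (form w (x \<odot> t))" by (rule self_dual_norm_le[OF \<alpha> w V0_mul_W[OF x t(1)]])
    also have "\<dots> = v (form (conj x \<odot> w) t)" by (simp add: form_mul_left_adjoint[of "conj x"] conj_conj)
    finally show "N x + \<alpha> w + \<alpha> t \<le> v (form (conj x \<odot> w) t)" .
  qed
qed

lemma N_conj: "x \<in> V0 \<Longrightarrow> N (conj x) = N x"
  using N_conj_ge[of x] N_conj_ge[of "conj x"] V0_conj[of x] by (simp add: conj_conj antisym)

text \<open>The reversal of factors in \<open>mul_mul_W\<close> does no harm, because the two bounds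
  are simply added.\<close>

lemma N_mul: assumes x: "x \<in> V0" and y: "y \<in> V0" shows "N x + N y \<le> N (x \<odot> y)"
proof (rule N_geI)
  fix w assume w: "w \<in> W"
  have "N x + N y + \<alpha> w = N y + (N x + \<alpha> w)" by (simp add: add_ac)
  also have "\<dots> \<le> N y + \<alpha> (x \<odot> w)" by (rule add_left_mono[OF N_le[OF w]])
  also have "\<dots> \<le> \<alpha> (y \<odot> (x \<odot> w))" by (rule N_le[OF V0_mul_W[OF x w]])
  finally show "N x + N y + \<alpha> w \<le> \<alpha> ((x \<odot> y) \<odot> w)" by (simp add: mul_mul_W[OF x y w])
qed

text \<open>Self-duality of \<open>\<alpha>\<close> turns the bound on
  \<open>(t \<odot> u) \<odot> s\<close> into bounds on its pairings with \<open>r\<close>, and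
  moving \<open>s\<close> across gives \<open>form (t \<odot> u) (r \<odot> s)\<close> up to
  sign.\<close>

lemma N_W_mul_W: assumes t: "t \<in> W" and u: "u \<in> W" shows "\<alpha> t + \<alpha> u \<le> N (t \<odot> u)"
proof (rule N_geI)
  fix s assume s: "s \<in> W"
  show "\<alpha> t + \<alpha> u + \<alpha> s \<le> \<alpha> ((t \<odot> u) \<odot> s)"
  proof (rule self_dual_norm_ge[OF \<alpha> V0_mul_W[OF W_mul_W[OF t u] s]])
    fix r assume r: "r \<in> W" "r \<noteq> 0"
    have "form ((t \<odot> u) \<odot> s) r = - form (t \<odot> u) (r \<odot> s)"
      using s by (simp add: form_mul_right_adjoint[of "t \<odot> u"] conj_W mul_minus_right form_minus_right)
    then show "\<alpha> t + \<alpha> u + \<alpha> s + \<alpha> r \<le> v (form ((t \<odot> u) \<odot> s) r)"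
      using form_mul_mul_ge[OF self_dual_norm_le[OF \<alpha>] t u r(1) s] by (simp add: v_minus add_ac)
  qed
qed

lemma N_add: assumes x: "x \<in> V0" and y: "y \<in> V0" shows "min (N x) (N y) \<le> N (x + y)"
proof (rule N_geI)
  fix w assume w: "w \<in> W"
  have "min (N x) (N y) + \<alpha> w \<le> \<alpha> (x \<odot> w)" "min (N x) (N y) + \<alpha> w \<le> \<alpha> (y \<odot> w)"
    by (rule order_trans[OF add_right_mono N_le[OF w]], simp)+
  then show "min (N x) (N y) + \<alpha> w \<le> \<alpha> ((x + y) \<odot> w)"
    unfolding mul_add_left using x y w V0_mul_W by (intro norm_ultrametric[OF \<alpha>_norm]) auto
qed

lemma N_zero: "N 0 = \<infinity>"
proof -
  have "\<infinity> \<le> N 0"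
    by (rule N_geI) (simp add: mul_zero_left norm_zero[OF \<alpha>_norm zero_in_W])
  then show ?thesis by simp
qed

lemma N_scale_ge: assumes x: "x \<in> V0" shows "v c + N x \<le> N (scale c x)"
proof (rule N_geI)
  fix w assume w: "w \<in> W"
  have "v c + N x + \<alpha> w \<le> v c + \<alpha> (x \<odot> w)"
    using add_left_mono[OF N_le[OF w, of x], of "v c"] by (simp add: add_ac)
  then show "v c + N x + \<alpha> w \<le> \<alpha> (scale c x \<odot> w)"
    by (simp add: mul_scale_left norm_scale[OF \<alpha>_norm V0_mul_W[OF x w]])
qed

lemma N_scale: assumes x: "x \<in> V0" shows "N (scale c x) = v c + N x"
proof (cases "c = 0")
  case True then show ?thesis by (simp add: N_zero v_zero)
next
  case False
  \<comment> \<open>The missing inequality is \<open>N_scale_ge\<close> for the inverse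
    scalar.\<close>
  have "N (scale c x) = v c + (v (inverse c) + N (scale c x))"
    using v_inverse[OF False] by (simp add: add.assoc[symmetric])
  also have "\<dots> \<le> v c + N (scale (inverse c) (scale c x))"
    using V0_subspace x by (intro add_left_mono N_scale_ge subspace_scale)
  also have "\<dots> = v c + N x" using False by simp
  finally show ?thesis using N_scale_ge[OF x] by (rule antisym)
qed

text \<open>Evaluating at an anisotropic \<open>a\<close> of \<open>W\<close> bounds
  \<open>N x\<close> from above. From below, \<open>scale (Q a) x\<close> is the product of
  \<open>x \<odot> a\<close> and \<open>- a\<close>, both in \<open>W\<close>, so
  \<open>N_W_mul_W\<close> applies.\<close>

lemma N_finite: assumes x: "x \<in> V0" "x \<noteq> 0" shows "\<bar>N x\<bar> \<noteq> \<infinity>"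
proof -
  obtain a where a: "a \<in> W" "Q a \<noteq> 0" by (rule anisotropic_vector_W)
  have a0: "a \<noteq> 0" using a(2) by (auto simp: Q_zero)
  have xa: "x \<odot> a \<in> W" using V0_mul_W x a by auto
  have eq: "(x \<odot> a) \<odot> conj a = scale (Q a) x" by (rule mul_conj_cancel_right)
  have xa0: "x \<odot> a \<noteq> 0"
  proof
    assume "x \<odot> a = 0"
    then have "scale (Q a) x = 0" using eq by (simp add: mul_zero_left)
    then show False using x a by simp
  qed
  have fin: "\<bar>\<alpha> a\<bar> \<noteq> \<infinity>" "\<bar>\<alpha> (x \<odot> a)\<bar> \<noteq> \<infinity>"
    using norm_finite[OF \<alpha>_norm] a a0 xa xa0 by auto
  have "\<alpha> (x \<odot> a) + \<alpha> (- a) \<le> N ((x \<odot> a) \<odot> (- a))"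
    using a xa W_subspace by (intro N_W_mul_W subspace_neg)
  then have "\<alpha> (x \<odot> a) + \<alpha> a \<le> v (Q a) + N x"
    using eq conj_W[OF a(1)] norm_minus[OF \<alpha>_norm a(1)] N_scale[OF x(1)] by simp
  moreover have "N x + \<alpha> a \<le> \<alpha> (x \<odot> a)" by (rule N_le[OF a(1)])
  ultimately show ?thesis
    using fin v_finite[OF a(2)] by (cases "N x"; cases "\<alpha> a"; cases "\<alpha> (x \<odot> a)"; cases "v (Q a)") auto
qed

text \<open>All values of \<open>\<alpha>\<close> have a common denominator \<open>D\<close>, hence
  so do the differences of which \<open>N x\<close> is the infimum. Rounding \<open>N x\<close> up
  to the next multiple of \<open>1 / D\<close> still gives a lower bound, so \<open>N x\<close> is
  such a multiple.\<close>

lemma N_rational: assumes x: "x \<in> V0" shows "N x \<in> insert \<infinity> (ereal ` \<rat>)"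
proof (cases "x = 0")
  case False
  obtain D where D: "D > 0" "\<And>w. w \<in> W \<Longrightarrow> w \<noteq> 0 \<Longrightarrow> \<exists>k. \<alpha> w = ereal (of_int k / of_int D)"
    by (rule norm_values_discrete[OF \<alpha>_norm W_subspace]) (rule that)
  obtain r where r: "N x = ereal r" using N_finite[OF x False] by (cases "N x") auto
  have "ereal (of_int \<lceil>r * of_int D\<rceil> / of_int D) \<le> N x"
  proof (rule N_geI)
    fix w assume w: "w \<in> W"
    show "ereal (of_int \<lceil>r * of_int D\<rceil> / of_int D) + \<alpha> w \<le> \<alpha> (x \<odot> w)"
    proof (cases "x \<odot> w = 0")
      case True
      then show ?thesis by (simp add: norm_zero[OF \<alpha>_norm zero_in_W])
    next
      case xw: False
      then have "w \<noteq> 0" by (auto simp: mul_zero_right)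
      then obtain k where k: "\<alpha> w = ereal (of_int k / of_int D)" using D(2) w by blast
      obtain l where l: "\<alpha> (x \<odot> w) = ereal (of_int l / of_int D)"
        using D(2)[OF V0_mul_W[OF x w] xw] by blast
      have "r + of_int k / of_int D \<le> of_int l / of_int D"
        using N_le[OF w, of x] by (simp add: k l r)
      then have "r \<le> of_int (l - k) / of_int D" by (simp add: diff_divide_distrib)
      then have "r * of_int D \<le> of_int (l - k)" using D(1) by (simp add: pos_le_divide_eq)
      then have "\<lceil>r * of_int D\<rceil> \<le> l - k" by (rule ceiling_le)
      then have "real_of_int \<lceil>r * of_int D\<rceil> \<le> of_int l - of_int k" by linarith
      then have "(of_int \<lceil>r * of_int D\<rceil> + of_int k) / real_of_int D \<le> of_int l / of_int D"
        using D(1) by (intro divide_right_mono) simp_all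
      then show ?thesis by (simp add: k l add_divide_distrib)
    qed
  qed
  then have "of_int \<lceil>r * of_int D\<rceil> \<le> r * of_int D" using D(1) by (simp add: r field_simps)
  then have "r * of_int D = of_int \<lceil>r * of_int D\<rceil>" by linarith
  then have "r = of_int \<lceil>r * of_int D\<rceil> / of_int D" using D(1) by (simp add: field_simps)
  then have "r \<in> \<rat>" by (metis Rats_divide Rats_of_int)
  then show ?thesis by (simp add: r)
qed (simp add: N_zero)

lemma N_norm: "norm V0 N"
  unfolding norm_on_def
proof (intro conjI ballI N_rational N_add N_scale)
  fix x assume "x \<in> V0"
  then show "(N x = \<infinity>) = (x = 0)" using N_finite[of x] N_zero by (cases "x = 0") auto
qed

text \<open>For the upper bound on \<open>N u + N x\<close>, apply
  \<open>conj_mul_linearized\<close> to a vector \<open>a\<close> of \<open>W\<close>: both summands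
  have value at least \<open>N u + N x + \<alpha> a\<close>, the sum has value
  \<open>v (form u x) + \<alpha> a\<close>, and \<open>\<alpha> a\<close> cancels. Conversely,
  pairing \<open>u \<odot> w\<close> with \<open>t\<close> amounts to pairing \<open>u\<close> with
  \<open>t \<odot> w\<close>, an element of \<open>V0\<close> whose \<open>N\<close> is bounded
  below by \<open>N_W_mul_W\<close>.\<close>

lemma N_self_dual: "self_dual_norm v scale Q V0 N"
  unfolding self_dual_norm_iff
proof (intro conjI ballI allI iffI impI N_norm)
  fix u c x assume u: "u \<in> V0" and x: "x \<in> V0" and c: "c \<le> N u"
  obtain a where a: "a \<in> W" "Q a \<noteq> 0" by (rule anisotropic_vector_W)
  then have a0: "a \<noteq> 0" by (auto simp: Q_zero)
  have *: "N u + N x + \<alpha> a \<le> \<alpha> (conj u \<odot> (x \<odot> a))" if "u \<in> V0" "x \<in> V0" for u x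
  proof -
    have "N u + N x + \<alpha> a = N (conj u) + (N x + \<alpha> a)" using N_conj that by (simp add: add_ac)
    also have "\<dots> \<le> N (conj u) + \<alpha> (x \<odot> a)" by (rule add_left_mono[OF N_le[OF a(1)]])
    also have "\<dots> \<le> \<alpha> (conj u \<odot> (x \<odot> a))" by (rule N_le[OF V0_mul_W[OF that(2) a(1)]])
    finally show ?thesis .
  qed
  have mem: "conj u \<odot> (x \<odot> a) \<in> W" "conj x \<odot> (u \<odot> a) \<in> W"
    using u x a by (simp_all add: V0_mul_W V0_conj)
  have "N u + N x + \<alpha> a \<le> \<alpha> (conj u \<odot> (x \<odot> a) + conj x \<odot> (u \<odot> a))"
    using *[OF u x] *[OF x u] by (intro norm_ultrametric[OF \<alpha>_norm mem]) (simp_all add: add_ac)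
  also have "\<dots> = v (form u x) + \<alpha> a"
    unfolding conj_mul_linearized by (rule norm_scale[OF \<alpha>_norm a(1)])
  finally have "N u + N x \<le> v (form u x)"
    using norm_finite[OF \<alpha>_norm a(1) a0] by (rule ereal_add_right_cancel_le)
  then show "c + N x \<le> v (form u x)" using add_right_mono[OF c] order_trans by blast
next
  fix u c assume u: "u \<in> V0" and c: "\<forall>x\<in>V0. x \<noteq> 0 \<longrightarrow> c + N x \<le> v (form u x)"
  show "c \<le> N u"
  proof (rule N_geI)
    fix w assume w: "w \<in> W"
    show "c + \<alpha> w \<le> \<alpha> (u \<odot> w)"
    proof (rule self_dual_norm_ge[OF \<alpha> V0_mul_W[OF u w]])
      fix t assume t: "t \<in> W" "t \<noteq> 0"
      have eq: "v (form (u \<odot> w) t) = v (form u (t \<odot> w))"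
        using w by (simp add: form_mul_right_adjoint[of u] conj_W mul_minus_right form_minus_right v_minus)
      show "c + \<alpha> w + \<alpha> t \<le> v (form (u \<odot> w) t)"
      \<comment> \<open>The hypothesis on \<open>c\<close> says nothing about the zero vector, so
        this case is separate.\<close>
      proof (cases "t \<odot> w = 0")
        case True then show ?thesis by (simp add: eq form_zero_right v_zero)
      next
        case False
        have "c + \<alpha> w + \<alpha> t = c + (\<alpha> t + \<alpha> w)" by (simp add: add_ac)
        also have "\<dots> \<le> c + N (t \<odot> w)" by (intro add_left_mono N_W_mul_W t w)
        also have "\<dots> \<le> v (form u (t \<odot> w))" using c W_mul_W[OF t(1) w] False by blast
        finally show ?thesis by (simp add: eq)
      qed
    qed
  qed
qed

lemma N_self_dual_algebra_norm: "self_dual_algebra_norm v scale mul Q V0 N"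
  unfolding self_dual_algebra_norm_def using N_self_dual N_mul by blast

text \<open>Right multiplication by \<open>x\<close> on \<open>W\<close> is left multiplication by
  \<open>conj x\<close>, so the remaining product is covered by \<open>N_conj\<close>.\<close>

lemma N_wedge: "self_dual_algebra_norm v scale mul Q UNIV (wedge V0 W N \<alpha>)"
proof (rule wedge_algebra_norm[OF N_self_dual \<alpha> N_mul N_le _ N_W_mul_W])
  fix x w assume x: "x \<in> V0" and w: "w \<in> W"
  have "\<alpha> w + N x = N (conj x) + \<alpha> w" by (simp add: N_conj[OF x] add.commute)
  also have "\<dots> \<le> \<alpha> (conj x \<odot> w)" by (rule N_le[OF w])
  finally show "\<alpha> w + N x \<le> \<alpha> (w \<odot> x)" by (simp add: W_mul_V0_eq[OF x w])
qed

lemma N_unique: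
  assumes \<beta>: "self_dual_algebra_norm v scale mul Q V0 \<beta>"
    and wedge: "self_dual_algebra_norm v scale mul Q UNIV (wedge V0 W \<beta> \<alpha>)" and x: "x \<in> V0"
  shows "\<beta> x = N x"
proof (rule self_dual_norm_unique[OF N_self_dual _ _ x])
  show sd: "self_dual_norm v scale Q V0 \<beta>" using \<beta> by (simp add: self_dual_algebra_norm_def)
  then have \<beta>_norm: "norm V0 \<beta>" by (simp add: self_dual_norm_iff)
  have zero: "0 \<in> V0" by (rule subspace_0[OF V0_subspace])
  \<comment> \<open>The other component is 0, of value \<open>\<infinity>\<close>, so the minimum is
    the value on the summand. The same holds on \<open>V0\<close>.\<close>
  have on_W: "wedge V0 W \<beta> \<alpha> w = \<alpha> w" if "w \<in> W" for w
    using wedge_V0_W[OF zero that, of \<beta> \<alpha>] norm_zero[OF \<beta>_norm zero] by simp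
  fix x assume x: "x \<in> V0"
  have on_V0: "wedge V0 W \<beta> \<alpha> x = \<beta> x"
    using wedge_V0_W[OF x zero_in_W, of \<beta> \<alpha>] norm_zero[OF \<alpha>_norm zero_in_W] by simp
  show "\<beta> x \<le> N x"
  proof (rule N_geI)
    fix w assume w: "w \<in> W"
    have "wedge V0 W \<beta> \<alpha> x + wedge V0 W \<beta> \<alpha> w \<le> wedge V0 W \<beta> \<alpha> (x \<odot> w)"
      using wedge unfolding self_dual_algebra_norm_def by blast
    then show "\<beta> x + \<alpha> w \<le> \<alpha> (x \<odot> w)" by (simp add: on_V0 on_W w V0_mul_W[OF x w])
  qed
qed

end

section \<open>Quadratic extensions\<close>

context nonarch_local_field
begin

lemma v_surj_int: "\<exists>c. v c = ereal (of_int k)"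
proof -
  obtain \<pi> where \<pi>: "v \<pi> = 1" using v_uniformizer by blast
  then have \<pi>0: "\<pi> \<noteq> 0" using v_zero by auto
  have power: "v (\<pi> ^ n) = ereal (real n)" for n
    by (induction n) (simp_all add: v_one v_mult \<pi> one_ereal_def)
  show ?thesis
  proof (cases "0 \<le> k")
    case True
    then show ?thesis using power[of "nat k"] by (intro exI[of _ "\<pi> ^ nat k"]) simp
  next
    case False
    have "v (inverse (\<pi> ^ nat (- k))) = ereal (of_int k)"
      using v_inverse[of "\<pi> ^ nat (- k)"] \<pi>0 False power[of "nat (- k)"]
      by (cases "v (inverse (\<pi> ^ nat (- k)))") auto
    then show ?thesis by blast
  qed
qed

end

section \<open>Trace, hermitian form and valuation of a quadratic subfield\<close>

locale quadratic_extension = valued_quaternion_subalgebra scale mul one Q V0 W v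
  for scale :: "'f::field \<Rightarrow> 'v::ab_group_add \<Rightarrow> 'v" and mul one Q V0 W and v :: "'f \<Rightarrow> ereal" +
  fixes L :: "'v set"
  assumes L: "quadratic_subfield scale mul one L"
begin

lemma L_subspace: "subspace L" and one_in_L: "one \<in> L" and dim_L: "dim L = 2"
  and L_mul: "x \<in> L \<Longrightarrow> y \<in> L \<Longrightarrow> x \<odot> y \<in> L"
  and L_commute: "x \<in> L \<Longrightarrow> y \<in> L \<Longrightarrow> x \<odot> y = y \<odot> x"
  and L_inverse: "x \<in> L \<Longrightarrow> x \<noteq> 0 \<Longrightarrow> \<exists>y\<in>L. x \<odot> y = one"
  using L unfolding quadratic_subfield_def unital_subalgebra_def by blast+

lemma scalar_in_L: "scale c one \<in> L"
  by (rule subspace_scale[OF L_subspace one_in_L])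

lemma L_anisotropic: "anisotropic_on Q L"
  unfolding anisotropic_on_def
proof (intro ballI impI, rule ccontr)
  fix x assume x: "x \<in> L" "Q x = 0" "x \<noteq> 0"
  then obtain y where "x \<odot> y = one" using L_inverse by blast
  then show False using Q_mul[of x y] x(2) by (simp add: Q_one)
qed

lemma Q_L_nonzero: "x \<in> L \<Longrightarrow> x \<noteq> 0 \<Longrightarrow> Q x \<noteq> 0"
  using L_anisotropic by (auto simp: anisotropic_on_def)

text \<open>A generator of trace zero: its conjugate is its negative and its square is the scalar
  \<open>- Q gen\<close>. It makes \<open>L\<close> an explicit quadratic extension with basis
  \<open>one\<close>, \<open>gen\<close>.\<close>

definition gen :: 'v where
  "gen = (SOME i. i \<in> L \<and> form i one = 0 \<and> i \<noteq> 0 \<and> (\<forall>x\<in>L. \<exists>a b. x = scale a one + scale b i))"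

lemma gen: "gen \<in> L" "form gen one = 0" "gen \<noteq> 0"
    "x \<in> L \<Longrightarrow> \<exists>a b. x = scale a one + scale b gen"
proof -
  have "\<not> L \<subseteq> span {one}"
  proof
    assume "L \<subseteq> span {one}"
    then have "dim L \<le> card {one}" by (rule dim_le_card) simp
    then show False by (simp add: dim_L)
  qed
  then obtain g where g: "g \<in> L" "g \<notin> span {one}" by blast
  \<comment> \<open>Subtracting half the trace makes \<open>i\<close> orthogonal to
    \<open>one\<close>.\<close>
  define i where "i = g - scale (form g one / 2) one"
  have i: "i \<in> L" "form i one = 0" "i \<noteq> 0"
  proof -
    show "i \<in> L" unfolding i_def using g scalar_in_L by (intro subspace_diff[OF L_subspace])
    show "form i one = 0" using two_nonzero by (simp add: i_def form_simps form_one_one)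
    show "i \<noteq> 0"
    proof
      assume "i = 0"
      then have "g = scale (form g one / 2) one" by (simp add: i_def)
      moreover have "scale (form g one / 2) one \<in> span {one}" by (intro span_scale span_base) simp
      ultimately show False using g(2) by simp
    qed
  qed
  have "orthogonal_set {one, i}"
    using i Q_L_nonzero one_nonzero by (auto simp: orthogonal_set_def Q_one form_commute[of one i])
  then have "independent {one, i}" by (rule orthogonal_set_independent)
  moreover have "one \<noteq> i" using i(2) form_one_one two_nonzero by auto
  ultimately have "L \<subseteq> span {one, i}"
    using i(1) one_in_L by (intro span_of_card_ge) (auto simp: dim_L)
  then have "\<exists>a b. x = scale a one + scale b i" if xL: "x \<in> L" for x
  proof -
    obtain a where "x - scale a one \<in> span {i}"
      using xL \<open>L \<subseteq> span {one, i}\<close> span_breakdown_eq[of x one "{i}"] by blast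
    then obtain b where "x - scale a one = scale b i" by (auto simp: span_singleton)
    then have "x = scale a one + scale b i" by (simp add: algebra_simps)
    then show ?thesis by blast
  qed
  then have "\<exists>i. i \<in> L \<and> form i one = 0 \<and> i \<noteq> 0 \<and> (\<forall>x\<in>L. \<exists>a b. x = scale a one + scale b i)"
    using i by blast
  from someI_ex[OF this] show "gen \<in> L" "form gen one = 0" "gen \<noteq> 0"
    "x \<in> L \<Longrightarrow> \<exists>a b. x = scale a one + scale b gen"
    unfolding gen_def[symmetric] by auto
qed

lemma Q_gen: "Q gen \<noteq> 0"
  by (rule Q_L_nonzero[OF gen(1,3)])

lemma conj_gen: "conj gen = - gen"
  by (simp add: conj_def gen)

lemma gen_mul_gen: "gen \<odot> gen = scale (- Q gen) one"
  using conj_mul_self[of gen] by (simp add: conj_gen mul_minus_left) (metis minus_minus)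

lemma gen_mul_gen_mul: "gen \<odot> (gen \<odot> x) = scale (- Q gen) x"
  using conj_mul_cancel_left[of gen x] by (simp add: conj_gen mul_minus_left) (metis minus_minus)

lemma L_conj: "x \<in> L \<Longrightarrow> conj x \<in> L"
  unfolding conj_def using scalar_in_L by (intro subspace_diff[OF L_subspace])

lemma conj_add: "conj (x + y) = conj x + conj y"
  by (simp add: conj_def form_simps scale_left_distrib)

lemma conj_diff: "conj (x - y) = conj x - conj y"
  by (simp add: conj_def form_simps scale_left_diff_distrib)

lemma conj_scale: "conj (scale c x) = scale c (conj x)"
  by (simp add: conj_def form_simps scale_right_diff_distrib)

text \<open>An automorphism fixing scalars preserves the square of \<open>gen\<close>, so it sends
  \<open>gen\<close> to itself or to its negative. The first choice gives the identity, the second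
  gives \<open>conj\<close>.\<close>

lemma galois_conj_eq: "galois_conj scale mul one L = restrict conj L"
  unfolding galois_conj_def
proof (rule the_equality, intro conjI ballI allI)
  show "bij_betw (restrict conj L) L L"
    by (rule bij_betwI[where g = "restrict conj L"]) (auto simp: L_conj conj_conj)
  have "conj gen \<noteq> gen"
  proof
    assume "conj gen = gen"
    then have "scale 2 gen = 0"
      using scale_left_distrib[of 1 1 gen] by (simp add: conj_gen) (metis add.right_inverse)
    then show False using gen(3) two_nonzero by simp
  qed
  then show "\<exists>x\<in>L. restrict conj L x \<noteq> x" using gen(1) by auto
next
  fix x y assume xy: "x \<in> L" "y \<in> L"
  then show "restrict conj L (x + y) = restrict conj L x + restrict conj L y"
    by (simp add: conj_add subspace_add[OF L_subspace])
  show "restrict conj L (x \<odot> y) = restrict conj L x \<odot> restrict conj L y"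
    using xy by (simp add: conj_mul L_mul L_conj L_commute[of "conj x" "conj y"])
next
  fix c show "restrict conj L (scale c one) = scale c one"
    by (simp add: scalar_in_L conj_scale conj_one)
next
  fix s assume "s \<in> extensional L \<and> bij_betw s L L \<and>
      (\<forall>x\<in>L. \<forall>y\<in>L. s (x + y) = s x + s y) \<and> (\<forall>x\<in>L. \<forall>y\<in>L. s (x \<odot> y) = s x \<odot> s y) \<and>
      (\<forall>c. s (scale c one) = scale c one) \<and> (\<exists>x\<in>L. s x \<noteq> x)"
  then have ext: "s \<in> extensional L" and bij: "bij_betw s L L"
    and add: "\<And>x y. x \<in> L \<Longrightarrow> y \<in> L \<Longrightarrow> s (x + y) = s x + s y"
    and mul: "\<And>x y. x \<in> L \<Longrightarrow> y \<in> L \<Longrightarrow> s (x \<odot> y) = s x \<odot> s y"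
    and const: "\<And>c. s (scale c one) = scale c one" and nontriv: "\<exists>x\<in>L. s x \<noteq> x"
    by auto
  have s_eq: "s (scale a one + scale b gen) = scale a one + scale b (s gen)" for a b
  proof -
    have "scale b gen = scale b one \<odot> gen" for b by (simp add: mul_simps)
    then have "s (scale b gen) = scale b (s gen)"
      using mul[OF scalar_in_L gen(1), of b] by (simp add: const mul_simps)
    then show ?thesis
      using add[OF scalar_in_L subspace_scale[OF L_subspace gen(1)]] by (simp add: const)
  qed
  have sgen: "s gen \<in> L" using bij gen(1) by (auto simp: bij_betw_def)
  have "s gen \<odot> s gen = gen \<odot> gen"
    using mul[OF gen(1,1)] const[of "- Q gen"] by (simp only: gen_mul_gen)
  \<comment> \<open>Commutativity of \<open>L\<close> is what lets the difference of squares factor;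
    multiplicativity of \<open>Q\<close> then excludes zero divisors.\<close>
  then have "(s gen - gen) \<odot> (s gen + gen) = 0"
    using L_commute[OF sgen gen(1)] by (simp add: mul_simps)
  then have "Q (s gen - gen) * Q (s gen + gen) = 0"
    by (metis Q_mul Q_zero)
  then have "s gen - gen = 0 \<or> s gen + gen = 0"
    using Q_L_nonzero subspace_diff[OF L_subspace sgen gen(1)] subspace_add[OF L_subspace sgen gen(1)]
    by (metis mult_eq_0_iff)
  moreover have "s gen \<noteq> gen"
  proof
    assume "s gen = gen"
    then have "s x = x" if "x \<in> L" for x using gen(4)[OF that] s_eq by auto
    then show False using nontriv by blast
  qed
  ultimately have "s gen = conj gen" by (simp add: conj_gen eq_neg_iff_add_eq_0)
  then have "s x = conj x" if "x \<in> L" for x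
    using gen(4)[OF that] s_eq by (auto simp: conj_add conj_scale conj_one)
  then show "s = restrict conj L" using ext by (intro extensionalityI) auto
qed (simp add: restrict_extensional)

lemma field_trace_eq: assumes "z \<in> L" shows "field_trace scale mul one L z = form z one"
  unfolding field_trace_def
proof (rule the_equality)
  show "scale (form z one) one = z + galois_conj scale mul one L z"
    using assms by (simp add: galois_conj_eq conj_def)
  then show "t = form z one" if "scale t one = z + galois_conj scale mul one L z" for t
    using that one_nonzero by (metis scale_right_imp_eq)
qed

text \<open>To unfold the \<open>THE\<close>, an explicit form \<open>k\<close> is exhibited.
  Uniqueness holds because the traces of \<open>h x y\<close> and of
  \<open>gen \<odot> h x y = h (gen \<odot> x) y\<close> determine both coordinates of
  \<open>h x y\<close>.\<close>

lemma hermitian_form_properties: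
  defines "h \<equiv> hermitian_form scale mul one Q L"
  shows "h x y \<in> L" "a \<in> L \<Longrightarrow> h (a \<odot> x) y = a \<odot> h x y" "form (h x y) one = form x y"
proof -
  let ?P = "\<lambda>h. (\<forall>x y. h x y \<in> L) \<and> (\<forall>x y z. h (x + y) z = h x z + h y z) \<and>
      (\<forall>a\<in>L. \<forall>x y. h (a \<odot> x) y = a \<odot> h x y) \<and>
      (\<forall>x y. h y x = galois_conj scale mul one L (h x y)) \<and>
      (\<forall>x y. form x y = field_trace scale mul one L (h x y))"
  \<comment> \<open>If \<open>h x y = scale a one + scale b gen\<close>, taking traces gives
    \<open>2 * a = form x y\<close> and
    \<open>- 2 * b * Q gen = form (gen \<odot> x) y\<close>.\<close>
  define k where "k x y = scale (form x y / 2) one + scale (- form (gen \<odot> x) y / (2 * Q gen)) gen" for x y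
  have kL: "k x y \<in> L" for x y
    unfolding k_def by (intro subspace_add subspace_scale L_subspace gen(1) one_in_L)
  have k_add: "k (x + y) z = k x z + k y z" for x y z
    by (simp add: k_def mul_simps form_simps add_divide_distrib diff_divide_distrib scale_left_distrib
        scale_left_diff_distrib)
  have k_scale: "k (scale c x) z = scale c (k x z)" for c x z
    by (simp add: k_def mul_simps form_simps scale_right_distrib scale_right_diff_distrib)
  have k_gen: "k (gen \<odot> x) y = gen \<odot> k x y" for x y
    using Q_gen by (simp add: k_def mul_simps form_simps gen_mul_gen gen_mul_gen_mul field_simps)
  have "?P k"
  proof (intro conjI allI ballI kL k_add)
    fix a x y assume "a \<in> L"
    then obtain b c where "a = scale b one + scale c gen" using gen(4) by blast
    then show "k (a \<odot> x) y = a \<odot> k x y" by (simp add: mul_simps k_add k_scale k_gen)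
  next
    fix x y
    have "form (gen \<odot> y) x = - form (gen \<odot> x) y"
      by (simp add: form_mul_left_adjoint[of gen y] conj_gen mul_simps form_simps form_commute[of y])
    then show "k y x = galois_conj scale mul one L (k x y)"
      using kL by (simp add: galois_conj_eq) (simp add: k_def conj_add conj_diff conj_scale conj_one conj_gen form_commute)
    show "form x y = field_trace scale mul one L (k x y)"
      using two_nonzero by (simp add: field_trace_eq kL) (simp add: k_def form_simps form_one_one gen(2))
  qed
  moreover have unique: "h' = k" if h': "?P h'" for h'
  proof (intro ext)
    fix x y
    have h'L: "h' x y \<in> L" for x y using h' by blast
    have trace: "form (h' x y) one = form x y" for x y
      using h' field_trace_eq[OF h'L] by metis
    obtain a b where ab: "h' x y = scale a one + scale b gen" using gen(4)[OF h'L] by blast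
    have "form x y = a * 2"
      using trace[of x y] by (simp add: ab form_simps form_one_one gen(2))
    moreover have "h' (gen \<odot> x) y = gen \<odot> h' x y" using h' gen(1) by blast
    then have "form (gen \<odot> x) y = - (b * Q gen) * 2"
      using trace[of "gen \<odot> x" y] by (simp add: ab mul_simps form_simps form_one_one gen(2) gen_mul_gen)
    ultimately show "h' x y = k x y" using Q_gen two_nonzero by (simp add: ab k_def)
  qed
  ultimately have P: "?P h"
    unfolding h_def hermitian_form_def by (rule theI)
  note P1 = conjunct1[OF P] and P' = conjunct2[OF conjunct2[OF P]]
  note P3 = conjunct1[OF P'] and P5 = conjunct2[OF conjunct2[OF P']]
  show hL: "h x y \<in> L" using P1 by blast
  show "a \<in> L \<Longrightarrow> h (a \<odot> x) y = a \<odot> h x y" using P3 by blast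
  have "form x y = field_trace scale mul one L (h x y)" using P5 by blast
  then show "form (h x y) one = form x y" by (simp add: field_trace_eq[OF hL])
qed

lemma half_norm_one: "half_norm one = 0"
  by (simp add: half_norm_def Q_one v_one)

text \<open>The trace of \<open>x\<close> is its pairing with \<open>one\<close>, whose half norm is
  0. In particular integral elements have integral trace.\<close>

lemma v_trace_ge: "x \<in> L \<Longrightarrow> half_norm x \<le> v (form x one)"
  using anisotropic_half_norm_le[OF L_subspace L_anisotropic _ one_in_L, of x]
  by (simp add: half_norm_one)

lemma half_norm_conj: "half_norm (conj x) = half_norm x"
  by (simp add: half_norm_def Q_conj)

text \<open>An element \<open>y\<close> of norm 1 is integral, being a root of \<open>y\<^sup>2 - t y + 1\<close> with \<open>t\<close> integral,
  and so is its inverse, hence every valuation vanishes on \<open>y\<close>; up to a scalar, \<open>x\<^sup>2\<close> is of this kind.\<close>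

lemma valuation_L_eq:
  assumes w: "normalized_valuation L mul w" and e: "\<And>c. w (scale c one) = ereal (real e) * v c"
    and x: "x \<in> L"
  shows "w x = ereal (real e) * half_norm x"
proof (cases "x = 0")
  case True
  \<comment> \<open>In \<open>ereal\<close> the product of 0 and \<open>\<infinity>\<close> is 0, so
    \<open>e = 0\<close> would contradict \<open>w 0 = \<infinity>\<close>.\<close>
  have "e \<noteq> 0"
  proof
    assume "e = 0"
    then have "w (scale 0 one) = 0" by (simp only: e) (simp add: zero_ereal_def[symmetric])
    moreover have "w (scale 0 one) = \<infinity>"
      using w subspace_0[OF L_subspace] by (simp add: normalized_valuation_def)
    ultimately show False by simp
  qed
  moreover have "w 0 = \<infinity>" using w subspace_0[OF L_subspace] by (simp add: normalized_valuation_def)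
  ultimately show ?thesis using True by (simp add: half_norm_def Q_zero v_zero)
next
  case False
  have w_mul: "w (x \<odot> y) = w x + w y" if "x \<in> L" "y \<in> L" for x y
    using w that by (simp add: normalized_valuation_def)
  have w_add: "min (w x) (w y) \<le> w (x + y)" if "x \<in> L" "y \<in> L" for x y
    using w that by (simp add: normalized_valuation_def)
  have w_int: "\<exists>n::int. w x = ereal (of_int n)" if "x \<in> L" "x \<noteq> 0" for x
    using w that by (simp add: normalized_valuation_def)
  have nonneg: "0 \<le> w y" if y: "y \<in> L" "Q y = 1" for y
  proof -
    define t where "t = form y one"
    have "half_norm y \<le> v t" unfolding t_def by (rule v_trace_ge[OF y(1)])
    then have t: "0 \<le> v t" using y by (simp add: half_norm_def v_one)
    have "y \<noteq> 0" using y by (auto simp: Q_zero)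
    then obtain n where n: "w y = ereal (of_int n)" using w_int y by blast
    have "y \<odot> y = scale t one \<odot> y + scale (- 1) one"
      using conj_mul_self[of y] y(2) by (simp add: conj_def t_def mul_simps)
        (metis diff_diff_eq2 diff_add_cancel add_diff_cancel_left')
    then have "min (w (scale t one \<odot> y)) (w (scale (- 1) one)) \<le> w (y \<odot> y)"
      using w_add[of "scale t one \<odot> y" "scale (- 1) one"] L_mul scalar_in_L y by (simp only:)
    then have "min (ereal (real e) * v t + w y) (ereal (real e) * v (- 1)) \<le> w y + w y"
      by (simp only: w_mul scalar_in_L y e)
    moreover have "ereal (real e) * v (- 1) = 0" by (simp add: v_minus v_one)
    moreover have "w y \<le> ereal (real e) * v t + w y"
      using t add_right_mono[of 0 "ereal (real e) * v t" "w y"] by simp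
    then have "min (w y) 0 \<le> min (ereal (real e) * v t + w y) 0" by (intro min.mono order_refl)
    ultimately have "min (w y) 0 \<le> w y + w y" by (simp only:)
    then show ?thesis by (auto simp: n min_def split: if_splits)
  qed
  define y where "y = scale (inverse (Q x)) (x \<odot> x)"
  have Qx: "Q x \<noteq> 0" by (rule Q_L_nonzero[OF x False])
  have y: "y \<in> L" "Q y = 1"
    using x Qx by (simp_all add: y_def subspace_scale[OF L_subspace] L_mul Q_scale Q_mul power2_eq_square field_simps)
  have "w y + w (conj y) = w one"
    using w_mul[OF y(1) L_conj[OF y(1)]] y(2) by (simp add: mul_conj_self)
  also have "w one = 0" using e[of 1] by (simp add: v_one)
  finally have "w y + w (conj y) = 0" .
  then have wy: "w y = 0"
    using nonneg[OF y] nonneg[OF L_conj[OF y(1)]] y(2) by (cases "w y"; cases "w (conj y)") (auto simp: Q_conj)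
  have "x \<odot> x = scale (Q x) one \<odot> y" using Qx by (simp add: y_def mul_simps)
  then have "w x + w x = ereal (real e) * v (Q x) + w y"
    using w_mul[OF x x] w_mul[OF scalar_in_L y(1), of "Q x"] by (simp only: e)
  then have "w x + w x = ereal (real e) * half_norm x + ereal (real e) * half_norm x"
    by (simp add: wy half_norm_double[symmetric] ereal_pos_distrib)
  then show ?thesis by (rule ereal_double_eq)
qed

text \<open>If some value of \<open>Q\<close> on \<open>L\<close> has odd valuation, then
  \<open>e = 2\<close>. Otherwise \<open>half_norm\<close> is already integral on nonzero elements
  and \<open>e = 1\<close>.\<close>

lemma valuation_L_exists:
  obtains e where "0 < e" "normalized_valuation L mul (restrict (\<lambda>x. ereal (real e) * half_norm x) L)"
proof -
  have half_norm_L: "norm L half_norm" by (rule half_norm_norm[OF L_subspace L_anisotropic])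
  have valuation: "normalized_valuation L mul (restrict (\<lambda>x. ereal (real e) * half_norm x) L)"
    if e: "0 < e" and int: "\<And>x. x \<in> L \<Longrightarrow> x \<noteq> 0 \<Longrightarrow> \<exists>n::int. ereal (real e) * half_norm x = ereal (of_int n)"
      and one: "\<exists>x\<in>L. ereal (real e) * half_norm x = 1" for e :: nat
    unfolding normalized_valuation_def
  proof (intro conjI ballI impI)
    fix x assume x: "x \<in> L"
    show "(restrict (\<lambda>x. ereal (real e) * half_norm x) L x = \<infinity>) = (x = 0)"
      using x e int[OF x] by (cases "x = 0") (auto simp: half_norm_def Q_zero v_zero)
    show "x \<noteq> 0 \<Longrightarrow> \<exists>n::int. restrict (\<lambda>x. ereal (real e) * half_norm x) L x = ereal (of_int n)"
      using int x by simp
    fix y assume y: "y \<in> L"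
    show "restrict (\<lambda>x. ereal (real e) * half_norm x) L (x \<odot> y) =
        restrict (\<lambda>x. ereal (real e) * half_norm x) L x + restrict (\<lambda>x. ereal (real e) * half_norm x) L y"
      using x y by (simp add: L_mul half_norm_mul ereal_pos_distrib)
    have "min (ereal (real e) * half_norm x) (ereal (real e) * half_norm y)
        = ereal (real e) * min (half_norm x) (half_norm y)"
      using e by (simp add: min_def ereal_mult_le_mult_iff)
    also have "\<dots> \<le> ereal (real e) * half_norm (x + y)"
      using half_norm_L x y by (intro ereal_mult_left_mono) (auto simp: norm_on_def)
    finally show "min (restrict (\<lambda>x. ereal (real e) * half_norm x) L x) (restrict (\<lambda>x. ereal (real e) * half_norm x) L y)
        \<le> restrict (\<lambda>x. ereal (real e) * half_norm x) L (x + y)"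
      using x y by (simp add: subspace_add[OF L_subspace])
  next
    show "\<exists>x\<in>L. restrict (\<lambda>x. ereal (real e) * half_norm x) L x = 1"
      using one by auto
  qed
  show thesis
  proof (cases "\<exists>x\<in>L. \<exists>k::int. v (Q x) = ereal (of_int (2 * k + 1))")
    case True
    then obtain x and k :: int where x: "x \<in> L" "v (Q x) = ereal (of_int (2 * k + 1))" by blast
    \<comment> \<open>Scaling by \<open>c\<close> lowers \<open>v (Q x)\<close> by
      \<open>2 * k\<close>, leaving exactly 1.\<close>
    obtain c where c: "v c = ereal (of_int (- k))" using v_surj_int by blast
    have double: "ereal (real 2) * half_norm y = v (Q y)" for y
      by (cases "v (Q y)") (auto simp: half_norm_def)
    show thesis
    proof (rule that[OF _ valuation])
      show "\<exists>x\<in>L. ereal (real 2) * half_norm x = 1"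
        unfolding double
        by (rule bexI[of _ "scale c x"])
          (use x c in \<open>simp_all add: Q_scale v_mult power2_eq_square one_ereal_def subspace_scale[OF L_subspace]\<close>)
      show "\<exists>n::int. ereal (real 2) * half_norm x = ereal (of_int n)" if "x \<in> L" "x \<noteq> 0" for x
        unfolding double using v_int Q_L_nonzero that by blast
    qed simp_all
  next
    case False
    show thesis
    proof (rule that[OF _ valuation])
      obtain c where "v c = 1" using v_uniformizer by blast
      then show "\<exists>x\<in>L. ereal (real 1) * half_norm x = 1"
        by (intro bexI[of _ "scale c one"] scalar_in_L) (simp add: half_norm_scale half_norm_one)
      show "\<exists>n::int. ereal (real 1) * half_norm x = ereal (of_int n)" if x: "x \<in> L" "x \<noteq> 0" for x
      proof -
        obtain n where n: "v (Q x) = ereal (of_int n)" using v_int Q_L_nonzero[OF x] by blast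
        moreover have "even n" using False x n by (metis oddE)
        then obtain m where "n = 2 * m" by (rule evenE)
        ultimately have "half_norm x = ereal (of_int m)" by (simp add: half_norm_def)
        then show ?thesis by simp
      qed
    qed simp_all
  qed
qed

text \<open>By \<open>valuation_L_eq\<close> every candidate valuation is a multiple of
  \<open>half_norm\<close>, so only the factor has to be shown unique.\<close>

lemma ramification:
  obtains e where "0 < e" "ramification_index v scale mul one L = e"
    "\<And>x. x \<in> L \<Longrightarrow> ext_valuation v scale mul one L x = ereal (real e) * half_norm x"
proof -
  obtain e where e: "0 < e" and val: "normalized_valuation L mul (restrict (\<lambda>x. ereal (real e) * half_norm x) L)"
    by (rule valuation_L_exists)
  let ?w = "restrict (\<lambda>x. ereal (real e) * half_norm x) L"
  have const: "?w (scale c one) = ereal (real e) * v c" for c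
    by (simp add: scalar_in_L half_norm_scale half_norm_one)
  have ext: "ext_valuation v scale mul one L = ?w"
    unfolding ext_valuation_def
  proof (rule the_equality)
    show "?w \<in> extensional L \<and> normalized_valuation L mul ?w \<and>
        (\<exists>e::nat. \<forall>c. ?w (scale c one) = ereal (real e) * v c)"
      using val const by blast
    fix w assume "w \<in> extensional L \<and> normalized_valuation L mul w \<and>
        (\<exists>e::nat. \<forall>c. w (scale c one) = ereal (real e) * v c)"
    then obtain e' :: nat where w: "w \<in> extensional L" "normalized_valuation L mul w"
      and e': "\<And>c. w (scale c one) = ereal (real e') * v c" by blast
    have w_eq: "w x = ereal (real e') * half_norm x" if "x \<in> L" for x
      by (rule valuation_L_eq[OF w(2) e' that])
    \<comment> \<open>An element of value 1 under the factor \<open>a\<close> has the integer value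
      \<open>b / a\<close> under the factor \<open>b\<close>. Using this both ways identifies the
      two factors.\<close>
    have dvd: "int a dvd int b"
      if one: "\<exists>x\<in>L. ereal (real a) * half_norm x = 1"
        and int: "\<And>x. x \<in> L \<Longrightarrow> x \<noteq> 0 \<Longrightarrow> \<exists>n::int. ereal (real b) * half_norm x = ereal (of_int n)" for a b :: nat
    proof -
      obtain x where x: "x \<in> L" "ereal (real a) * half_norm x = 1" using one by blast
      then have "x \<noteq> 0" by (auto simp: half_norm_def Q_zero v_zero split: if_splits)
      then obtain n :: int where n: "ereal (real b) * half_norm x = ereal (of_int n)" using int x by blast
      obtain r where r: "half_norm x = ereal r"
        using half_norm_finite[OF Q_L_nonzero[OF x(1) \<open>x \<noteq> 0\<close>]] by (cases "half_norm x") auto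
      have "real a * r = 1" "real b * r = of_int n" using x n by (simp_all add: r one_ereal_def)
      then have "real b = of_int n * real a" by (metis mult.assoc mult.commute mult_1)
      then have "real_of_int (int b) = real_of_int (n * int a)" by simp
      then have "int b = n * int a" by (simp only: of_int_eq_iff)
      then show ?thesis by simp
    qed
    have "int e dvd int e'" "int e' dvd int e"
      using val w(2) by (intro dvd; auto simp: normalized_valuation_def w_eq)+
    then have "e = e'" by (simp add: dvd_antisym)
    then show "w = ?w" using w(1) w_eq by (intro extensionalityI[of _ L]) auto
  qed
  have "ramification_index v scale mul one L = e"
    unfolding ramification_index_def ext
  proof (rule the_equality)
    show "\<forall>c. ?w (scale c one) = ereal (real e) * v c" using const by blast
    fix e' :: nat assume e': "\<forall>c. ?w (scale c one) = ereal (real e') * v c"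
    obtain c where "v c = 1" using v_uniformizer by blast
    then show "e' = e" using e' const[of c] by (metis ereal.inject mult.right_neutral of_nat_eq_iff)
  qed
  then show thesis using that e ext by simp
qed

end

section \<open>Hermitian self-duality of the operator norm\<close>

context self_dual_norm_W
begin

text \<open>Multiplication by \<open>c\<close> in \<open>L\<close> shifts \<open>\<alpha>\<close> on
  \<open>W\<close> by \<open>half_norm c\<close>; the rule
  \<open>(c \<odot> x) \<odot> w = x \<odot> (c \<odot> w)\<close> transfers this to
  \<open>N\<close>. Duality for the hermitian form is then deduced from duality for its
  trace.\<close>

lemma N_self_dual_ext_norm:
  assumes L: "quadratic_subfield scale mul one L" and LV0: "L \<subseteq> V0"
    and \<alpha>': "self_dual_ext_norm v scale mul one Q L W \<alpha>'"
    and \<alpha>_eq: "\<And>x. x \<in> W \<Longrightarrow> \<alpha> x = \<alpha>' x / ereal (real (ramification_index v scale mul one L))"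
  shows "self_dual_ext_norm v scale mul one Q L V0
    (\<lambda>x. ereal (real (ramification_index v scale mul one L)) * N x)"
proof -
  interpret quadratic_extension scale mul one Q V0 W v L
    by unfold_locales (rule L)
  obtain e where e: "0 < e" "ramification_index v scale mul one L = e"
    and ext: "\<And>x. x \<in> L \<Longrightarrow> ext_valuation v scale mul one L x = ereal (real e) * half_norm x"
    by (rule ramification) (rule that)
  let ?h = "hermitian_form scale mul one Q L"
  let ?w = "ext_valuation v scale mul one L"
  have cancel: "ereal (real e) * a \<le> ereal (real e) * b \<longleftrightarrow> a \<le> b" for a b
    using e(1) by (simp add: ereal_mult_le_mult_iff)
  have L_finite: "\<bar>half_norm c\<bar> \<noteq> \<infinity>" if "c \<in> L" "c \<noteq> 0" for c
    by (rule half_norm_finite[OF Q_L_nonzero[OF that]])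
  have \<alpha>_L: "\<alpha> (c \<odot> x) = half_norm c + \<alpha> x" if c: "c \<in> L" and x: "x \<in> W" for c x
  proof -
    have cx: "c \<odot> x \<in> W" using c x LV0 V0_mul_W by blast
    have "\<alpha>' (c \<odot> x) = ereal (real e) * half_norm c + \<alpha>' x"
      using \<alpha>' c x ext by (simp add: self_dual_ext_norm_def norm_on_def)
    moreover have "(ereal (real e) * a + b) / ereal (real e) = a + b / ereal (real e)" for a b
      using e(1) by (cases a; cases b) (simp_all add: add_divide_distrib)
    ultimately show ?thesis by (simp add: \<alpha>_eq[OF x] \<alpha>_eq[OF cx] e(2))
  qed
  have N_L_ge: "half_norm c + N x \<le> N (c \<odot> x)" if c: "c \<in> L" and x: "x \<in> V0" for c x
  proof (rule N_geI)
    fix w assume w: "w \<in> W"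
    have cV0: "c \<in> V0" using c LV0 by blast
    have "half_norm c + N x + \<alpha> w = N x + \<alpha> (c \<odot> w)" by (simp add: \<alpha>_L[OF c w] add_ac)
    also have "\<dots> \<le> \<alpha> (x \<odot> (c \<odot> w))" by (rule N_le[OF V0_mul_W[OF cV0 w]])
    finally show "half_norm c + N x + \<alpha> w \<le> \<alpha> ((c \<odot> x) \<odot> w)" by (simp add: mul_mul_W[OF cV0 x w])
  qed
  \<comment> \<open>Multiplying back by \<open>conj c\<close> gives the scalar \<open>Q c\<close>,
    of valuation twice \<open>half_norm c\<close>, so the inequality for \<open>conj c\<close>
    yields the reverse one for \<open>c\<close>.\<close>
  have N_L: "N (c \<odot> x) = half_norm c + N x" if c: "c \<in> L" and x: "x \<in> V0" for c x
  proof (cases "c = 0")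
    case True
    then show ?thesis by (simp add: mul_zero_left N_zero half_norm_def Q_zero v_zero)
  next
    case False
    have cx: "c \<odot> x \<in> V0" using c x LV0 V0_mul by blast
    have "N (c \<odot> x) + half_norm c \<le> N (conj c \<odot> (c \<odot> x))"
      using N_L_ge[OF L_conj[OF c] cx] by (simp add: half_norm_conj add.commute)
    also have "\<dots> = half_norm c + N x + half_norm c"
      by (simp add: conj_mul_cancel_left N_scale[OF x] half_norm_double[symmetric] add_ac)
    finally show ?thesis
      using L_finite[OF c False] N_L_ge[OF c x] by (intro antisym) (rule ereal_add_right_cancel_le)
  qed
  have "norm_on L ?w mul V0 (\<lambda>x. ereal (real e) * N x)"
    unfolding norm_on_def
  proof (intro conjI ballI)
    fix x assume x: "x \<in> V0"
    show "ereal (real e) * N x \<in> insert \<infinity> (ereal ` \<rat>)"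
      using N_rational[OF x] e(1) by auto
    show "(ereal (real e) * N x = \<infinity>) = (x = 0)"
      using N_finite[OF x] N_zero e(1) by (cases "x = 0"; cases "N x") auto
    show "ereal (real e) * N (c \<odot> x) = ?w c + ereal (real e) * N x" if "c \<in> L" for c
      using that x by (simp add: ext N_L ereal_pos_distrib)
    fix y assume y: "y \<in> V0"
    have "min (ereal (real e) * N x) (ereal (real e) * N y) = ereal (real e) * min (N x) (N y)"
      by (simp add: min_def cancel)
    also have "\<dots> \<le> ereal (real e) * N (x + y)" unfolding cancel by (rule N_add[OF x y])
    finally show "min (ereal (real e) * N x) (ereal (real e) * N y) \<le> ereal (real e) * N (x + y)" .
  qed
  moreover have "self_dual ?w ?h V0 (\<lambda>x. ereal (real e) * N x)"
  proof (subst self_dual_iff)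
    show "\<bar>ereal (real e) * N x\<bar> \<noteq> \<infinity>" if "x \<in> V0" "x \<noteq> 0" for x
      using N_finite[OF that] e(1) by (cases "N x") auto
    have "c \<le> N u \<longleftrightarrow> (\<forall>x\<in>V0. x \<noteq> 0 \<longrightarrow> c + N x \<le> half_norm (?h u x))" if u: "u \<in> V0" for c u
    proof (intro iffI ballI impI)
      fix x assume c: "c \<le> N u" and x: "x \<in> V0" "x \<noteq> 0"
      \<comment> \<open>The trace of \<open>z\<close> may have larger valuation than
        \<open>half_norm z\<close>. Replacing \<open>u\<close> by \<open>conj z \<odot> u\<close>
        turns the hermitian value into the scalar \<open>Q z\<close>, whose trace
        \<open>2 * Q z\<close> has valuation exactly twice \<open>half_norm z\<close>.\<close>
      define z where "z = ?h u x"
      have z: "z \<in> L" unfolding z_def by (rule hermitian_form_properties(1))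
      have "N u + N x \<le> half_norm z"
      proof (cases "z = 0")
        case False
        have zu: "conj z \<odot> u \<in> V0" using L_conj[OF z] LV0 u V0_mul by blast
        have "?h (conj z \<odot> u) x = scale (Q z) one"
          unfolding hermitian_form_properties(2)[OF L_conj[OF z]] z_def[symmetric] by (rule conj_mul_self)
        then have "form (conj z \<odot> u) x = 2 * Q z"
          using hermitian_form_properties(3)[of "conj z \<odot> u" x] by (simp add: form_scale_left form_one_one mult.commute)
        then have "N (conj z \<odot> u) + N x \<le> half_norm z + half_norm z"
          using self_dual_norm_le[OF N_self_dual zu x(1)] by (simp add: v_2_mult half_norm_double)
        then have "N u + N x + half_norm z \<le> half_norm z + half_norm z"
          by (simp add: N_L[OF L_conj[OF z] u] half_norm_conj add_ac)
        then show ?thesis by (rule ereal_add_right_cancel_le[OF _ L_finite[OF z False]])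
      qed (simp add: half_norm_def Q_zero v_zero)
      then show "c + N x \<le> half_norm (?h u x)"
        unfolding z_def using add_right_mono[OF c] order_trans by blast
    next
      assume c: "\<forall>x\<in>V0. x \<noteq> 0 \<longrightarrow> c + N x \<le> half_norm (?h u x)"
      show "c \<le> N u"
      proof (rule self_dual_norm_ge[OF N_self_dual u])
        fix x assume "x \<in> V0" "x \<noteq> 0"
        then have "c + N x \<le> half_norm (?h u x)" using c by blast
        also have "\<dots> \<le> v (form (?h u x) one)"
          by (rule v_trace_ge[OF hermitian_form_properties(1)])
        finally show "c + N x \<le> v (form u x)" by (simp add: hermitian_form_properties(3))
      qed
    qed
    \<comment> \<open>Every lower bound is \<open>e\<close> times another one, so the equivalence
      for \<open>N\<close> and \<open>half_norm\<close> can be rescaled.\<close>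
    moreover have "\<exists>d. c = ereal (real e) * d" for c
      using e(1) by (intro exI[of _ "c / ereal (real e)"], cases c) auto
    moreover have "ereal (real e) * d + ereal (real e) * N x \<le> ?w (?h u x) \<longleftrightarrow> d + N x \<le> half_norm (?h u x)"
      for d u x
      by (simp add: ext hermitian_form_properties(1) ereal_pos_distrib[symmetric] cancel)
    ultimately show "\<forall>u\<in>V0. \<forall>c. (c \<le> ereal (real e) * N u) =
        (\<forall>x\<in>V0. x \<noteq> 0 \<longrightarrow> c + ereal (real e) * N x \<le> ?w (?h u x))"
      by (metis cancel)
  qed
  ultimately show ?thesis by (simp add: self_dual_ext_norm_def e(2))
qed

end

theorem proposition1p16:
  fixes v :: "'f::field \<Rightarrow> ereal" and p :: nat
    and scale :: "'f \<Rightarrow> 'v::ab_group_add \<Rightarrow> 'v" and mul :: "'v \<Rightarrow> 'v \<Rightarrow> 'v" and one :: 'v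
    and Q :: "'v \<Rightarrow> 'f" and V0 W :: "'v set"
  assumes "nonarch_local_field v"
    and "residual_characteristic v p" and "p \<notin> {2, 3}"
    and "split_octonion_algebra scale mul one Q"
    and "composition_subalgebra scale mul one Q V0"
    and "vector_space.dim scale V0 = 4"
    and "W = orthogonal_in Q UNIV V0"
  shows
    "(anisotropic_on Q V0 \<longrightarrow>
        anisotropic_on Q W \<and>
        self_dual_norm v scale Q V0 (\<lambda>x. v (Q x) / 2) \<and>
        (\<forall>\<beta>. self_dual_norm v scale Q V0 \<beta> \<longrightarrow> (\<forall>x\<in>V0. \<beta> x = v (Q x) / 2)) \<and>
        self_dual_norm v scale Q W (\<lambda>x. v (Q x) / 2) \<and>
        (\<forall>\<beta>. self_dual_norm v scale Q W \<beta> \<longrightarrow> (\<forall>x\<in>W. \<beta> x = v (Q x) / 2)) \<and>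
        self_dual_algebra_norm v scale mul Q UNIV (wedge V0 W (\<lambda>x. v (Q x) / 2) (\<lambda>x. v (Q x) / 2)) \<and>
        (\<forall>L. quadratic_subfield scale mul one L \<and> L \<subseteq> V0 \<longrightarrow>
           split_by V0 L (orthogonal_in Q V0 L) (\<lambda>x. v (Q x) / 2))) \<and>
     (split_on Q V0 \<longrightarrow>
        (\<forall>\<alpha>W. self_dual_norm v scale Q W \<alpha>W \<longrightarrow>
           (\<exists>\<alpha>0. self_dual_algebra_norm v scale mul Q V0 \<alpha>0 \<and>
              self_dual_algebra_norm v scale mul Q UNIV (wedge V0 W \<alpha>0 \<alpha>W) \<and>
              (\<forall>\<beta>. self_dual_algebra_norm v scale mul Q V0 \<beta> \<and>
                 self_dual_algebra_norm v scale mul Q UNIV (wedge V0 W \<beta> \<alpha>W) \<longrightarrow>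
                 (\<forall>x\<in>V0. \<beta> x = \<alpha>0 x)) \<and>
              (\<forall>L \<alpha>'. quadratic_subfield scale mul one L \<and> L \<subseteq> V0 \<and>
                 self_dual_ext_norm v scale mul one Q L W \<alpha>' \<and>
                 (\<forall>x\<in>W. \<alpha>W x = \<alpha>' x / ereal (real (ramification_index v scale mul one L))) \<longrightarrow>
                 self_dual_ext_norm v scale mul one Q L V0
                   (\<lambda>x. ereal (real (ramification_index v scale mul one L)) * \<alpha>0 x)))))"
proof -
  interpret split_octonion_algebra scale mul one Q by fact
  interpret nonarch_local_field v by fact
  have v2: "v 2 = 0" using assms(2,3) by (intro v_two_eq_zero) auto
  have "one \<noteq> 0"
  proof
    assume "one = 0"
    then have "x = 0" for x :: 'v using mul_one_left[of x] by (simp add: mul_zero_left)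
    then have "UNIV \<subseteq> span {}" by auto
    then show False using dim_le_card[of UNIV "{}"] dim_8 by simp
  qed
  moreover have "(2::'f) \<noteq> 0" using v2 v_zero by force
  ultimately interpret valued_quaternion_subalgebra scale mul one Q V0 W v
    using dim_8 assms(5-7) v2 by unfold_locales
  have part1: "anisotropic_on Q W \<and>
        self_dual_norm v scale Q V0 half_norm \<and>
        (\<forall>\<beta>. self_dual_norm v scale Q V0 \<beta> \<longrightarrow> (\<forall>x\<in>V0. \<beta> x = half_norm x)) \<and>
        self_dual_norm v scale Q W half_norm \<and>
        (\<forall>\<beta>. self_dual_norm v scale Q W \<beta> \<longrightarrow> (\<forall>x\<in>W. \<beta> x = half_norm x)) \<and>
        self_dual_algebra_norm v scale mul Q UNIV (wedge V0 W half_norm half_norm) \<and>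
        (\<forall>L. quadratic_subfield scale mul one L \<and> L \<subseteq> V0 \<longrightarrow>
           split_by V0 L (orthogonal_in Q V0 L) half_norm)"
    if V0: "anisotropic_on Q V0"
  proof -
    have W: "anisotropic_on Q W" by (rule anisotropic_W[OF V0])
    have sd0: "self_dual_norm v scale Q V0 half_norm"
      by (rule half_norm_self_dual[OF V0_subspace V0])
    have sdW: "self_dual_norm v scale Q W half_norm"
      by (rule half_norm_self_dual[OF W_subspace W])
    \<comment> \<open>\<open>half_norm\<close> is multiplicative on the whole algebra, so all four
      product inequalities are equalities.\<close>
    have "self_dual_algebra_norm v scale mul Q UNIV (wedge V0 W half_norm half_norm)"
      by (rule wedge_algebra_norm[OF sd0 sdW]) (simp_all only: half_norm_mul order_refl)
    moreover have "split_by V0 L (orthogonal_in Q V0 L) half_norm"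
      if "quadratic_subfield scale mul one L" "L \<subseteq> V0" for L
      using that by (intro split_by_subspace V0_subspace V0)
        (auto simp: quadratic_subfield_def unital_subalgebra_def)
    ultimately show ?thesis
      using W sd0 sdW half_norm_unique[OF sd0] half_norm_unique[OF sdW] by blast
  qed
  have part2: "\<exists>\<alpha>0. self_dual_algebra_norm v scale mul Q V0 \<alpha>0 \<and>
              self_dual_algebra_norm v scale mul Q UNIV (wedge V0 W \<alpha>0 \<alpha>W) \<and>
              (\<forall>\<beta>. self_dual_algebra_norm v scale mul Q V0 \<beta> \<and>
                 self_dual_algebra_norm v scale mul Q UNIV (wedge V0 W \<beta> \<alpha>W) \<longrightarrow>
                 (\<forall>x\<in>V0. \<beta> x = \<alpha>0 x)) \<and>
              (\<forall>L \<alpha>'. quadratic_subfield scale mul one L \<and> L \<subseteq> V0 \<and>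
                 self_dual_ext_norm v scale mul one Q L W \<alpha>' \<and>
                 (\<forall>x\<in>W. \<alpha>W x = \<alpha>' x / ereal (real (ramification_index v scale mul one L))) \<longrightarrow>
                 self_dual_ext_norm v scale mul one Q L V0
                   (\<lambda>x. ereal (real (ramification_index v scale mul one L)) * \<alpha>0 x))"
    if \<alpha>W: "self_dual_norm v scale Q W \<alpha>W" for \<alpha>W
  proof -
    interpret self_dual_norm_W scale mul one Q V0 W v \<alpha>W
      by unfold_locales (rule \<alpha>W)
    show ?thesis
      using N_self_dual_algebra_norm N_wedge N_unique N_self_dual_ext_norm
      by (intro exI[of _ N]) blast
  qed
  show ?thesis unfolding half_norm_def[symmetric] using part1 part2 by blast
qed

end
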